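(* Let $\mathcal F_1$ and $\mathcal F_2$ be saturated fusion systems on finite $p$-groups $S_1$ and $S_2$ respectively, and let $\omega_1\in A(S_1,S_1)_{(p)}$ and $\omega_2\in A(S_2,S_2)_{(p)}$ be their characteristic idempotents. For every element $X\in A(S_1,S_2)_{(p)}$ of the Burnside module, the product $\omega_2\circ X\circ\omega_1$ is right $\mathcal F_1$-stable and left $\mathcal F_2$-stable, and satisfies $$\Phi_D(\omega_2\circ X\circ\omega_1)=\frac{1}{|[D]_{\mathcal F_2\times\mathcal F_1}|}\sum_{D'\in[D]_{\mathcal F_2\times\mathcal F_1}}\Phi_{D'}(X)$$ for all subgroups $D\le S_2\times S_1$, where $[D]_{\mathcal F_2\times\mathcal F_1}$ is the isomorphism class of $D$ in the product fusion system $\mathcal F_2\times\mathcal F_1$ on $S_2\times S_1$.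
   Context: Here $p$ is a prime and $p$-groups are finite. A fusion system $\mathcal F$ on a $p$-group $S$ is a category whose objects are the subgroups of $S$, whose morphism sets $\mathcal F(P,Q)=\mathrm{Hom}_{\mathcal F}(P,Q)$ consist of injective group homomorphisms $P\to Q$ (composed as homomorphisms) and contain all homomorphisms $P\to Q$ induced by conjugation by elements of $S$, and such that for each $\varphi\in\mathcal F(P,Q)$ the isomorphism $\varphi\colon P\to\varphi P$ and its inverse are morphisms of $\mathcal F$. Write $\mathrm{Aut}_{\mathcal F}(P)=\mathcal F(P,P)$. Subgroups $P,Q$ are $\mathcal F$-conjugate if they are isomorphic in $\mathcal F$; $[P]_{\mathcal F}$ is the set of $\mathcal F$-conjugates of $P$. $P$ is fully $\mathcal F$-normalized (resp. fully $\mathcal F$-centralized) if $|N_SP|\ge|N_SQ|$ (resp. $|C_SP|\ge|C_SQ|$) for all $Q\in[P]_{\mathcal F}$. $\mathcal F$ is saturated if for all $P\le S$: (1) if $P$ is fully $\mathcal F$-normalized, then $P$ is fully $\mathcal F$-centralized and $\mathrm{Aut}_S(P)$ is a Sylow $p$-subgroup of $\mathrm{Aut}_{\mathcal F}(P)$; (2) every $\varphi\in\mathcal F(P,S)$ with $\varphi(P)$ fully $\mathcal F$-centralized extends to a morphism in $\mathcal F(N_\varphi,S)$, where $N_\varphi=\{x\in N_S(P)\mid \exists y\in S:\varphi\circ c_x=c_y\circ\varphi\}$. Product: for fusion systems $\mathcal F_i$ on $S_i$, the product $\mathcal F_2\times\mathcal F_1$ is the fusion system on $S_2\times S_1$ in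 which the morphisms $D\to C$ are the homomorphisms $D\to C$ that are restrictions to $D$ of $\varphi_2\times\varphi_1\colon D_2\times D_1\to S_2\times S_1$ with $\varphi_i\in\mathcal F_i(D_i,S_i)$, $D_i$ being the projection of $D$ to $S_i$. Bisets: for finite groups $G,H$, a $(G,H)$-biset is a finite set with commuting right $G$-action and left $H$-action, regarded as a left $(H\times G)$-set via $(h,g).x=hxg^{-1}$. $A(G,H)$ is the Grothendieck group of isomorphism classes of $(G,H)$-bisets under disjoint union (no freeness is required). For $D\le H\times G$, $\Phi_D\colon A(G,H)\to\mathbb Z$ is the additive map counting $D$-fixed points. Composition $\circ\colon A(H,K)\times A(G,H)\to A(G,K)$ is induced by $Y\circ X=Y\times_HX$. For $U\le G$ and a homomorphism $\varphi\colon U\to H$, $\Delta(U,\varphi)=\{(\varphi(u),u)\mid u\in U\}\le H\times G$ and $[U,\varphi]_G^H=[(H\times G)/\Delta(U,\varphi)]$. The subscript $(p)$ denotes tensoring with $\mathbb Z_{(p)}$. Stability: $X\in A(S_1,S_2)_{(p)}$ is right $\mathcal F_1$-stable if $X\circ[P,\varphi]_P^{S_1}=X\circ[P,\mathrm{id}]_P^{S_1}$ for all $P\le S_1$, $\varphi\in\mathcal F_1(P,S_1)$; it is left $\mathcal F_2$-stable if $[\varphi P,\varphi^{-1}]_{S_2}^P\circ X=[P,\mathrm{id}]_{S_2}^P\circ X$ for all $P\le S_2$, $\varphi\in\mathcal F_2(P,S_2)$. Characteristic idempotent: for a fusion system $\mathcal F$ on $S$, $X\in A(S,S)_{(p)}$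 is $\mathcal F$-generated if it is a $\mathbb Z_{(p)}$-linear combination of elements $[P,\varphi]_S^S$ with $P\le S$, $\varphi\in\mathcal F(P,S)$. It is $\mathcal F$-characteristic if it is $\mathcal F$-generated, left and right $\mathcal F$-stable, and $\varepsilon(X)$ is invertible in $\mathbb Z_{(p)}$, where $\varepsilon$ is the $\mathbb Z_{(p)}$-linear extension of $X\mapsto|X|/|S|$ to the span of left-free bisets. For each saturated $\mathcal F$ there is exactly one idempotent (with respect to $\circ$) in $A(S,S)_{(p)}$ that is $\mathcal F$-characteristic; it is the characteristic idempotent of $\mathcal F$. *)

theory Defs
  imports Complex_Main
    "HOL-Algebra.Group_Action" "HOL-Algebra.Left_Coset"
    "HOL-Library.Poly_Mapping" "HOL-Computational_Algebra.Primes"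
begin

section \<open>Fusion systems\<close>

locale p_group = group S for p :: nat and S (structure) +
  assumes prime_p: "prime p"
    and finite_carrier: "finite (carrier S)"
    and order_prime_power: "\<exists>n. order S = p ^ n"

abbreviation (input) subgrp :: "('a, 'm) monoid_scheme \<Rightarrow> 'a set \<Rightarrow> ('a, 'm) monoid_scheme"
  where "subgrp S P \<equiv> S\<lparr>carrier := P\<rparr>"

definition conj_map :: "('a, 'm) monoid_scheme \<Rightarrow> 'a set \<Rightarrow> 'a \<Rightarrow> 'a \<Rightarrow> 'a"
  where "conj_map S P x = (\<lambda>u\<in>P. x \<otimes>\<^bsub>S\<^esub> u \<otimes>\<^bsub>S\<^esub> inv\<^bsub>S\<^esub> x)"

text \<open>
  \<open>F P Q\<close> is the set of morphisms from \<open>P\<close> to \<open>Q\<close>. Morphisms are extensional functions on their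
  source, so that equality of morphisms is equality of functions; the values of \<open>F\<close> at sets that
  are not subgroups are irrelevant. Identities are the conjugations by the unit.
\<close>

locale fusion_system = p_group p S for p :: nat and S (structure) +
  fixes F :: "'a set \<Rightarrow> 'a set \<Rightarrow> ('a \<Rightarrow> 'a) set"
  assumes morphism:
      "\<lbrakk>subgroup P S; subgroup Q S\<rbrakk>
        \<Longrightarrow> F P Q \<subseteq> mon (subgrp S P) (subgrp S Q) \<inter> extensional P"
    and composition:
      "\<lbrakk>subgroup P S; subgroup Q S; subgroup R S; \<phi> \<in> F P Q; \<psi> \<in> F Q R\<rbrakk>
        \<Longrightarrow> compose P \<psi> \<phi> \<in> F P R"
    and conjugation:
      "\<lbrakk>subgroup P S; subgroup Q S; x \<in> carrier S; conj_map S P x ` P \<subseteq> Q\<rbrakk>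
        \<Longrightarrow> conj_map S P x \<in> F P Q"
    and iso_onto_image:
      "\<lbrakk>subgroup P S; subgroup Q S; \<phi> \<in> F P Q\<rbrakk> \<Longrightarrow> \<phi> \<in> F P (\<phi> ` P)"
    and inverse_from_image:
      "\<lbrakk>subgroup P S; subgroup Q S; \<phi> \<in> F P Q\<rbrakk>
        \<Longrightarrow> restrict (inv_into P \<phi>) (\<phi> ` P) \<in> F (\<phi> ` P) P"

definition fusion_class ::
  "('a, 'm) monoid_scheme \<Rightarrow> ('a set \<Rightarrow> 'a set \<Rightarrow> ('a \<Rightarrow> 'a) set) \<Rightarrow> 'a set \<Rightarrow> 'a set set"
  where "fusion_class S F P =
    {Q. subgroup Q S \<and>
        (\<exists>\<phi>\<in>F P Q. \<exists>\<psi>\<in>F Q P. (\<forall>u\<in>P. \<psi> (\<phi> u) = u) \<and> (\<forall>v\<in>Q. \<phi> (\<psi> v) = v))}"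

definition centralizer_in :: "('a, 'm) monoid_scheme \<Rightarrow> 'a set \<Rightarrow> 'a set"
  where "centralizer_in S P = {x \<in> carrier S. \<forall>u\<in>P. x \<otimes>\<^bsub>S\<^esub> u = u \<otimes>\<^bsub>S\<^esub> x}"

definition fully_normalized ::
  "('a, 'm) monoid_scheme \<Rightarrow> ('a set \<Rightarrow> 'a set \<Rightarrow> ('a \<Rightarrow> 'a) set) \<Rightarrow> 'a set \<Rightarrow> bool"
  where "fully_normalized S F P \<longleftrightarrow>
    (\<forall>Q\<in>fusion_class S F P. card (normalizer S Q) \<le> card (normalizer S P))"

definition fully_centralized ::
  "('a, 'm) monoid_scheme \<Rightarrow> ('a set \<Rightarrow> 'a set \<Rightarrow> ('a \<Rightarrow> 'a) set) \<Rightarrow> 'a set \<Rightarrow> bool"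
  where "fully_centralized S F P \<longleftrightarrow>
    (\<forall>Q\<in>fusion_class S F P. card (centralizer_in S Q) \<le> card (centralizer_in S P))"

definition sylow_subgroup :: "nat \<Rightarrow> ('a, 'm) monoid_scheme \<Rightarrow> 'a set \<Rightarrow> bool"
  where "sylow_subgroup p G H \<longleftrightarrow>
    subgroup H G \<and> card H = p ^ multiplicity p (order G)"

definition Aut_S :: "('a, 'm) monoid_scheme \<Rightarrow> 'a set \<Rightarrow> ('a \<Rightarrow> 'a) set"
  where "Aut_S S P = conj_map S P ` normalizer S P"

definition Aut_F :: "('a set \<Rightarrow> 'a set \<Rightarrow> ('a \<Rightarrow> 'a) set) \<Rightarrow> 'a set \<Rightarrow> ('a \<Rightarrow> 'a) monoid"
  where "Aut_F F P = (BijGroup P)\<lparr>carrier := F P P\<rparr>"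

definition extender :: "('a, 'm) monoid_scheme \<Rightarrow> 'a set \<Rightarrow> ('a \<Rightarrow> 'a) \<Rightarrow> 'a set"
  where "extender S P \<phi> =
    {x \<in> normalizer S P. \<exists>y\<in>carrier S. \<forall>u\<in>P.
       \<phi> (x \<otimes>\<^bsub>S\<^esub> u \<otimes>\<^bsub>S\<^esub> inv\<^bsub>S\<^esub> x) = y \<otimes>\<^bsub>S\<^esub> \<phi> u \<otimes>\<^bsub>S\<^esub> inv\<^bsub>S\<^esub> y}"

locale saturated_fusion_system = fusion_system p S F for p :: nat and S (structure) and F +
  assumes fully_normalized_sylow:
      "\<lbrakk>subgroup P S; fully_normalized S F P\<rbrakk>
        \<Longrightarrow> fully_centralized S F P \<and> sylow_subgroup p (Aut_F F P) (Aut_S S P)"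
    and extension:
      "\<lbrakk>subgroup P S; \<phi> \<in> F P (carrier S); fully_centralized S F (\<phi> ` P)\<rbrakk>
        \<Longrightarrow> \<exists>\<psi>\<in>F (extender S P \<phi>) (carrier S). \<forall>u\<in>P. \<psi> u = \<phi> u"

definition product_fusion ::
  "('b, 'n) monoid_scheme \<Rightarrow> ('b set \<Rightarrow> 'b set \<Rightarrow> ('b \<Rightarrow> 'b) set) \<Rightarrow>
   ('a, 'm) monoid_scheme \<Rightarrow> ('a set \<Rightarrow> 'a set \<Rightarrow> ('a \<Rightarrow> 'a) set) \<Rightarrow>
   ('b \<times> 'a) set \<Rightarrow> ('b \<times> 'a) set \<Rightarrow> ('b \<times> 'a \<Rightarrow> 'b \<times> 'a) set"
  where "product_fusion S\<^sub>2 F\<^sub>2 S\<^sub>1 F\<^sub>1 D C =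
    {\<psi> \<in> hom (subgrp (S\<^sub>2 \<times>\<times> S\<^sub>1) D) (subgrp (S\<^sub>2 \<times>\<times> S\<^sub>1) C) \<inter> extensional D.
       \<exists>\<phi>\<^sub>2\<in>F\<^sub>2 (fst ` D) (carrier S\<^sub>2). \<exists>\<phi>\<^sub>1\<in>F\<^sub>1 (snd ` D) (carrier S\<^sub>1).
         \<forall>(b, a)\<in>D. \<psi> (b, a) = (\<phi>\<^sub>2 b, \<phi>\<^sub>1 a)}"


section \<open>Finite sets with a group action\<close>

text \<open>
  A \<open>K\<close>-set is a carrier together with an action in the sense of \<^locale>\<open>group_action\<close>. A
  \<open>(G,H)\<close>-biset is a left \<open>(H \<times> G)\<close>-set via \<open>(h,g).x = h x g\<inverse>\<close>, so the left action of \<open>h\<close> is that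
  of \<open>(h,1)\<close>, and the right action of \<open>g\<close> is that of \<open>(1,g\<inverse>)\<close>.
\<close>

type_synonym ('k, 'x) gset = "'x set \<times> ('k \<Rightarrow> 'x \<Rightarrow> 'x)"

definition finite_gset :: "('k, 'm) monoid_scheme \<Rightarrow> ('k, 'x) gset \<Rightarrow> bool"
  where "finite_gset K X \<longleftrightarrow> finite (fst X) \<and> group_action K (fst X) (snd X)"

definition gset_iso :: "('k, 'm) monoid_scheme \<Rightarrow> ('k, 'x) gset \<Rightarrow> ('k, 'y) gset \<Rightarrow> bool"
  where "gset_iso K X Y \<longleftrightarrow>
    (\<exists>f. bij_betw f (fst X) (fst Y) \<and>
         (\<forall>k\<in>carrier K. \<forall>x\<in>fst X. f (snd X k x) = snd Y k (f x)))"

text \<open>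
  Every finite \<open>K\<close>-set is isomorphic to one whose points are natural numbers, so the isomorphism
  class of an arbitrary one is represented by the \<open>K\<close>-sets on natural numbers isomorphic to it.
\<close>

type_synonym 'k iso_class = "('k, nat) gset set"

definition iso_class :: "('k, 'm) monoid_scheme \<Rightarrow> ('k, 'x) gset \<Rightarrow> 'k iso_class"
  where "iso_class K X = {Y. finite_gset K Y \<and> gset_iso K X Y}"

definition rep :: "'k iso_class \<Rightarrow> ('k, nat) gset"
  where "rep C = (SOME X. X \<in> C)"

definition gset_sum :: "('k, 'x) gset \<Rightarrow> ('k, 'y) gset \<Rightarrow> ('k, 'x + 'y) gset"
  where "gset_sum X Y =
    (fst X <+> fst Y, \<lambda>k. restrict (map_sum (snd X k) (snd Y k)) (fst X <+> fst Y))"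

definition fixed_points :: "'k set \<Rightarrow> ('k, 'x) gset \<Rightarrow> 'x set"
  where "fixed_points D X = {x \<in> fst X. \<forall>d\<in>D. snd X d x = x}"

definition coset_gset :: "('k, 'm) monoid_scheme \<Rightarrow> 'k set \<Rightarrow> ('k, 'k set) gset"
  where "coset_gset K D = (lcosets\<^bsub>K\<^esub> D, \<lambda>k. \<lambda>C\<in>lcosets\<^bsub>K\<^esub> D. k <#\<^bsub>K\<^esub> C)"

definition left_act :: "('g, 'm) monoid_scheme \<Rightarrow> ('h \<times> 'g, 'x) gset \<Rightarrow> 'h \<Rightarrow> 'x \<Rightarrow> 'x"
  where "left_act G X h x = snd X (h, \<one>\<^bsub>G\<^esub>) x"

definition right_act ::
  "('g, 'm) monoid_scheme \<Rightarrow> ('h, 'n) monoid_scheme \<Rightarrow> ('h \<times> 'g, 'x) gset \<Rightarrow> 'x \<Rightarrow> 'g \<Rightarrow> 'x"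
  where "right_act G H X x g = snd X (\<one>\<^bsub>H\<^esub>, inv\<^bsub>G\<^esub> g) x"

text \<open>
  \<open>Y \<times>\<^sub>H X\<close> for a \<open>(K \<times> H)\<close>-set \<open>Y\<close> and an \<open>(H \<times> G)\<close>-set \<open>X\<close>: the quotient of \<open>Y \<times> X\<close> by
  \<open>(y h, x) \<sim> (y, h x)\<close>, which is an equivalence relation as it stands since \<open>H\<close> is a group.
\<close>

definition tensor_rel ::
  "('g, 'l) monoid_scheme \<Rightarrow> ('h, 'm) monoid_scheme \<Rightarrow> ('k, 'n) monoid_scheme \<Rightarrow>
   ('k \<times> 'h, 'y) gset \<Rightarrow> ('h \<times> 'g, 'x) gset \<Rightarrow> (('y \<times> 'x) \<times> ('y \<times> 'x)) set"
  where "tensor_rel G H K Y X =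
    {((right_act H K Y y h, x), (y, left_act G X h x)) | y h x.
       y \<in> fst Y \<and> h \<in> carrier H \<and> x \<in> fst X}"

definition tensor ::
  "('g, 'l) monoid_scheme \<Rightarrow> ('h, 'm) monoid_scheme \<Rightarrow> ('k, 'n) monoid_scheme \<Rightarrow>
   ('k \<times> 'h, 'y) gset \<Rightarrow> ('h \<times> 'g, 'x) gset \<Rightarrow> ('k \<times> 'g, ('y \<times> 'x) set) gset"
  where "tensor G H K Y X =
    (let Q = (fst Y \<times> fst X) // tensor_rel G H K Y X in
      (Q, \<lambda>(k, g). \<lambda>C\<in>Q.
        (\<lambda>(y, x). (left_act H Y k y, right_act G H X x (inv\<^bsub>G\<^esub> g))) ` C))"


section \<open>The \<open>p\<close>-localized Burnside module\<close>

definition Z_loc :: "nat \<Rightarrow> rat set"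
  where "Z_loc p = {of_int a / of_int b | a b. \<not> int p dvd b}"

text \<open>
  \<open>A(G,H)\<^sub>(\<^sub>p\<^sub>)\<close> is presented as the free \<open>\<int>\<^sub>(\<^sub>p\<^sub>)\<close>-module on the isomorphism classes of finite
  \<open>(H \<times> G)\<close>-sets modulo the span of all \<open>[X \<squnion> Y] - [X] - [Y]\<close>; by right exactness of the tensor
  product this is the Grothendieck group tensored with \<open>\<int>\<^sub>(\<^sub>p\<^sub>)\<close>. The elements of the quotient are
  equivalence classes of formal linear combinations.
\<close>

type_synonym 'k formal = "'k iso_class \<Rightarrow>\<^sub>0 rat"

definition formal_sums :: "nat \<Rightarrow> ('k, 'm) monoid_scheme \<Rightarrow> 'k formal set"
  where "formal_sums p K =
    {f. Poly_Mapping.keys f \<subseteq> {iso_class K X | X :: ('k, nat) gset. finite_gset K X} \<and>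
        range (Poly_Mapping.lookup f) \<subseteq> Z_loc p}"

inductive_set relation_span :: "nat \<Rightarrow> ('k, 'm) monoid_scheme \<Rightarrow> 'k formal set"
  for p :: nat and K :: "('k, 'm) monoid_scheme"
  where
    zero: "0 \<in> relation_span p K"
  | add: "\<lbrakk>f \<in> relation_span p K; r \<in> Z_loc p;
           finite_gset K (X :: ('k, nat) gset); finite_gset K (Y :: ('k, nat) gset)\<rbrakk>
      \<Longrightarrow> f + (Poly_Mapping.single (iso_class K (gset_sum X Y)) r
               - Poly_Mapping.single (iso_class K X) r
               - Poly_Mapping.single (iso_class K Y) r) \<in> relation_span p K"

definition burnside_rel ::
  "nat \<Rightarrow> ('g, 'm) monoid_scheme \<Rightarrow> ('h, 'n) monoid_scheme \<Rightarrow>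
   (('h \<times> 'g) formal \<times> ('h \<times> 'g) formal) set"
  where "burnside_rel p G H =
    {(f, f'). f \<in> formal_sums p (H \<times>\<times> G) \<and> f' \<in> formal_sums p (H \<times>\<times> G) \<and>
              f - f' \<in> relation_span p (H \<times>\<times> G)}"

definition burnside ::
  "nat \<Rightarrow> ('g, 'm) monoid_scheme \<Rightarrow> ('h, 'n) monoid_scheme \<Rightarrow> ('h \<times> 'g) formal set set"
  where "burnside p G H = formal_sums p (H \<times>\<times> G) // burnside_rel p G H"

text \<open>
  The maps below are defined on formal linear combinations by \<open>\<int>\<^sub>(\<^sub>p\<^sub>)\<close>-(bi)linear extension and
  respect \<^const>\<open>burnside_rel\<close>, so they descend to \<^const>\<open>burnside\<close>. The values of the
  fixed-point maps in \<open>\<int>\<^sub>(\<^sub>p\<^sub>)\<close> are regarded as rationals.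
\<close>

definition formal_comp ::
  "('g, 'l) monoid_scheme \<Rightarrow> ('h, 'm) monoid_scheme \<Rightarrow> ('k, 'n) monoid_scheme \<Rightarrow>
   ('k \<times> 'h) formal \<Rightarrow> ('h \<times> 'g) formal \<Rightarrow> ('k \<times> 'g) formal"
  where "formal_comp G H K f f' =
    (\<Sum>B\<in>Poly_Mapping.keys f. \<Sum>C\<in>Poly_Mapping.keys f'.
       Poly_Mapping.single (iso_class (K \<times>\<times> G) (tensor G H K (rep B) (rep C)))
         (Poly_Mapping.lookup f B * Poly_Mapping.lookup f' C))"

definition burnside_comp ::
  "nat \<Rightarrow> ('g, 'l) monoid_scheme \<Rightarrow> ('h, 'm) monoid_scheme \<Rightarrow> ('k, 'n) monoid_scheme \<Rightarrow>
   ('k \<times> 'h) formal set \<Rightarrow> ('h \<times> 'g) formal set \<Rightarrow> ('k \<times> 'g) formal set"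
  where "burnside_comp p G H K Y X =
    (\<Union>f\<in>Y. \<Union>f'\<in>X. burnside_rel p G K `` {formal_comp G H K f f'})"

definition formal_mark :: "'k set \<Rightarrow> 'k formal \<Rightarrow> rat"
  where "formal_mark D f =
    (\<Sum>C\<in>Poly_Mapping.keys f. Poly_Mapping.lookup f C * of_nat (card (fixed_points D (rep C))))"

definition mark :: "'k set \<Rightarrow> 'k formal set \<Rightarrow> rat"
  where "mark D X = the_elem (formal_mark D ` X)"

definition graph_subgroup :: "'g set \<Rightarrow> ('g \<Rightarrow> 'h) \<Rightarrow> ('h \<times> 'g) set"
  where "graph_subgroup U \<phi> = {(\<phi> u, u) | u. u \<in> U}"

definition graph_class ::
  "('g, 'm) monoid_scheme \<Rightarrow> ('h, 'n) monoid_scheme \<Rightarrow> 'g set \<Rightarrow> ('g \<Rightarrow> 'h) \<Rightarrow>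
   ('h \<times> 'g) iso_class"
  where "graph_class G H U \<phi> =
    iso_class (H \<times>\<times> G) (coset_gset (H \<times>\<times> G) (graph_subgroup U \<phi>))"

definition graph_elem ::
  "nat \<Rightarrow> ('g, 'm) monoid_scheme \<Rightarrow> ('h, 'n) monoid_scheme \<Rightarrow> 'g set \<Rightarrow> ('g \<Rightarrow> 'h) \<Rightarrow>
   ('h \<times> 'g) formal set"
  where "graph_elem p G H U \<phi> =
    burnside_rel p G H `` {Poly_Mapping.single (graph_class G H U \<phi>) 1}"


section \<open>Stability and characteristic idempotents\<close>

definition right_stable ::
  "nat \<Rightarrow> ('a, 'm) monoid_scheme \<Rightarrow> ('b, 'n) monoid_scheme \<Rightarrow>
   ('a set \<Rightarrow> 'a set \<Rightarrow> ('a \<Rightarrow> 'a) set) \<Rightarrow> ('b \<times> 'a) formal set \<Rightarrow> bool"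
  where "right_stable p S\<^sub>1 S\<^sub>2 F\<^sub>1 X \<longleftrightarrow>
    X \<in> burnside p S\<^sub>1 S\<^sub>2 \<and>
    (\<forall>P \<phi>. subgroup P S\<^sub>1 \<longrightarrow> \<phi> \<in> F\<^sub>1 P (carrier S\<^sub>1) \<longrightarrow>
       burnside_comp p (subgrp S\<^sub>1 P) S\<^sub>1 S\<^sub>2 X (graph_elem p (subgrp S\<^sub>1 P) S\<^sub>1 P \<phi>)
     = burnside_comp p (subgrp S\<^sub>1 P) S\<^sub>1 S\<^sub>2 X (graph_elem p (subgrp S\<^sub>1 P) S\<^sub>1 P id))"

definition left_stable ::
  "nat \<Rightarrow> ('a, 'm) monoid_scheme \<Rightarrow> ('b, 'n) monoid_scheme \<Rightarrow>
   ('b set \<Rightarrow> 'b set \<Rightarrow> ('b \<Rightarrow> 'b) set) \<Rightarrow> ('b \<times> 'a) formal set \<Rightarrow> bool"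
  where "left_stable p S\<^sub>1 S\<^sub>2 F\<^sub>2 X \<longleftrightarrow>
    X \<in> burnside p S\<^sub>1 S\<^sub>2 \<and>
    (\<forall>P \<phi>. subgroup P S\<^sub>2 \<longrightarrow> \<phi> \<in> F\<^sub>2 P (carrier S\<^sub>2) \<longrightarrow>
       burnside_comp p S\<^sub>1 S\<^sub>2 (subgrp S\<^sub>2 P)
         (graph_elem p S\<^sub>2 (subgrp S\<^sub>2 P) (\<phi> ` P) (inv_into P \<phi>)) X
     = burnside_comp p S\<^sub>1 S\<^sub>2 (subgrp S\<^sub>2 P) (graph_elem p S\<^sub>2 (subgrp S\<^sub>2 P) P id) X)"

definition generated ::
  "nat \<Rightarrow> ('a, 'm) monoid_scheme \<Rightarrow> ('a set \<Rightarrow> 'a set \<Rightarrow> ('a \<Rightarrow> 'a) set) \<Rightarrow>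
   ('a \<times> 'a) formal set \<Rightarrow> bool"
  where "generated p S F X \<longleftrightarrow>
    (\<exists>I c. finite I \<and> I \<subseteq> {(P, \<phi>). subgroup P S \<and> \<phi> \<in> F P (carrier S)} \<and> c ` I \<subseteq> Z_loc p \<and>
       X = burnside_rel p S S `` {\<Sum>(P, \<phi>)\<in>I. Poly_Mapping.single (graph_class S S P \<phi>) (c (P, \<phi>))})"

text \<open>
  The linear extension of \<open>X \<mapsto> |X| / |S|\<close>. It makes sense on all of \<open>A(S,S)\<^sub>(\<^sub>p\<^sub>)\<close> with values in the
  rationals; on the span of left-free bisets, which contains all generated elements, it takes
  values in \<open>\<int>\<^sub>(\<^sub>p\<^sub>)\<close>.
\<close>

definition augmentation :: "('a, 'm) monoid_scheme \<Rightarrow> ('a \<times> 'a) formal set \<Rightarrow> rat"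
  where "augmentation S X = the_elem ((\<lambda>f. \<Sum>C\<in>Poly_Mapping.keys f.
    Poly_Mapping.lookup f C * (of_nat (card (fst (rep C))) / of_nat (order S))) ` X)"

definition characteristic ::
  "nat \<Rightarrow> ('a, 'm) monoid_scheme \<Rightarrow> ('a set \<Rightarrow> 'a set \<Rightarrow> ('a \<Rightarrow> 'a) set) \<Rightarrow>
   ('a \<times> 'a) formal set \<Rightarrow> bool"
  where "characteristic p S F X \<longleftrightarrow>
    generated p S F X \<and> left_stable p S S F X \<and> right_stable p S S F X \<and>
    (\<exists>u\<in>Z_loc p. augmentation S X \<in> Z_loc p \<and> augmentation S X * u = 1)"

definition characteristic_idempotent ::
  "nat \<Rightarrow> ('a, 'm) monoid_scheme \<Rightarrow> ('a set \<Rightarrow> 'a set \<Rightarrow> ('a \<Rightarrow> 'a) set) \<Rightarrow>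
   ('a \<times> 'a) formal set \<Rightarrow> bool"
  where "characteristic_idempotent p S F X \<longleftrightarrow>
    characteristic p S F X \<and> burnside_comp p S S S X X = X"

end

theory Submission
  imports Defs
begin

text \<open>
  Everything is read off from stabilizers. A formal sum of finite \<open>(H \<times> G)\<close>-sets determines, for
  each subgroup \<open>L\<close>, the weighted number of points with stabilizer exactly \<open>L\<close>, its coordinate at
  \<open>L\<close>. Decomposing into orbits shows that two formal sums define the same element of the Burnside
  module exactly when they have the same coordinates (\<open>relation_span_iff_coords\<close>), and by Moebius
  inversion this means that they have the same marks (\<open>marks_determine_coords\<close>). In a composite
  \<open>Y \<times>\<^sub>H X\<close> the class of \<open>(y, x)\<close> has as stabilizer the relational composition of the stabilizers
  of \<open>y\<close> and \<open>x\<close>, and the size of the class depends only on these two stabilizers as well. Hence the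
  marks of a composite are an explicit bilinear expression in the coordinates of the factors
  (\<open>marks_formal_comp\<close>), and stability becomes invariance of marks: \<open>X\<close> is right stable iff
  \<open>\<Phi>\<^bsub>(1 \<times> \<phi>)D\<^esub>(X) = \<Phi>\<^sub>D(X)\<close> for all morphisms \<open>\<phi>\<close> (\<open>right_stable_iff\<close>, \<open>left_stable_iff\<close>).

  Let \<open>\<omega>\<close> be a characteristic idempotent of \<open>F\<close> on \<open>S\<close>. Since \<open>\<omega>\<close> is generated, its coordinates
  live on the graphs of morphisms of \<open>F\<close>, and the composition formula becomes
  \<open>|S| \<Phi>\<^sub>D(X \<circ> \<omega>) = \<Sum>\<psi>. \<Phi>\<^bsub>(1 \<times> \<psi>)D\<^esub>(X) \<Phi>\<^bsub>\<Delta>(P,\<psi>)\<^esub>(\<omega>)\<close>, where \<open>P\<close> is the projection of \<open>D\<close> to \<open>S\<close>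
  and \<open>\<psi>\<close> runs over \<open>F(P,S)\<close> (\<open>comp_marks_generated\<close>). By left stability the second factor is
  a number \<open>m(P)\<close> that does not depend on \<open>\<psi>\<close>, so \<open>\<Phi>\<^sub>D(X \<circ> \<omega>)\<close> is \<open>\<lambda> = m(P) |F(P,S)| / |S|\<close> times the
  average of the \<open>\<Phi>\<^bsub>(1 \<times> \<psi>)D\<^esub>(X)\<close>. For \<open>X = \<omega>\<close> and \<open>D\<close> the diagonal of \<open>P\<close>, right stability and
  idempotency turn this into \<open>m(P) = \<lambda> m(P)\<close>, so \<open>\<lambda> = 1\<close> as soon as \<open>m(P) \<noteq> 0\<close>
  (\<open>comp_marks_idempotent\<close>). For the latter, compose the one-point biset with \<open>\<omega>\<close>: the mark of the
  result is \<open>\<lambda>\<close> at \<open>1 \<times> P\<close> and \<open>\<epsilon>(\<omega>)\<close> at the trivial subgroup. Marks at a \<open>p\<close>-group and at the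
  trivial group agree modulo \<open>p\<close>, and \<open>\<epsilon>(\<omega>)\<close> is a unit, whence \<open>\<lambda> \<noteq> 0\<close>
  (\<open>characteristic_marks_nonzero\<close>).

  Passing to the converse relation exchanges left and right, so the same holds for multiplication by
  \<open>\<omega>\<^sub>2\<close> from the left. Together, \<open>\<Phi>\<^sub>D(\<omega>\<^sub>2 \<circ> X \<circ> \<omega>\<^sub>1)\<close> is the average of \<open>\<Phi>\<^bsub>(\<psi>\<^sub>2 \<times> \<psi>\<^sub>1)D\<^esub>(X)\<close> over all
  pairs of morphisms on the projections of \<open>D\<close>. Such an average does not change when \<open>D\<close> is replaced by
  its image under a morphism (\<open>fusion_average_invariant\<close>), which gives both stability claims; and every
  member of the class of \<open>D\<close> is hit equally often (\<open>card_fibre\<close>), which gives the formula.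
\<close>

section \<open>Integers localized at a prime\<close>

lemma Z_loc_ofI: "\<not> int p dvd b \<Longrightarrow> of_int a / of_int b \<in> Z_loc p"
  unfolding Z_loc_def by blast

lemma Z_loc_of_int: "prime p \<Longrightarrow> of_int a \<in> Z_loc p"
  using Z_loc_ofI[of p 1 a] by (auto simp: prime_nat_iff)

lemma Z_loc_add:
  assumes "prime p" "x \<in> Z_loc p" "y \<in> Z_loc p" shows "x + y \<in> Z_loc p"
proof -
  obtain a b c d where *: "x = of_int a / of_int b" "\<not> int p dvd b"
    "y = of_int c / of_int d" "\<not> int p dvd d"
    using assms(2,3) unfolding Z_loc_def by blast
  have "\<not> int p dvd b * d" using * assms(1) by (simp add: prime_dvd_mult_iff)
  moreover have "b \<noteq> 0" "d \<noteq> 0" using * by auto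
  then have "x + y = of_int (a * d + c * b) / of_int (b * d)"
    using * by (simp add: add_frac_eq split: if_splits)
  ultimately show ?thesis using Z_loc_ofI by metis
qed

lemma Z_loc_mult:
  assumes "prime p" "x \<in> Z_loc p" "y \<in> Z_loc p" shows "x * y \<in> Z_loc p"
proof -
  obtain a b c d where *: "x = of_int a / of_int b" "\<not> int p dvd b"
    "y = of_int c / of_int d" "\<not> int p dvd d"
    using assms(2,3) unfolding Z_loc_def by blast
  have "\<not> int p dvd b * d" using * assms(1) by (simp add: prime_dvd_mult_iff)
  moreover have "x * y = of_int (a * c) / of_int (b * d)" using * by auto
  ultimately show ?thesis using Z_loc_ofI by metis
qed

lemma Z_loc_uminus: "prime p \<Longrightarrow> x \<in> Z_loc p \<Longrightarrow> - x \<in> Z_loc p"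
  using Z_loc_mult[of p x "of_int (- 1)"] Z_loc_of_int[of p "- 1"] by simp

lemma Z_loc_sum:
  assumes "prime p" "\<And>i. i \<in> I \<Longrightarrow> x i \<in> Z_loc p" shows "sum x I \<in> Z_loc p"
proof (cases "finite I")
  case True
  then show ?thesis using assms(2)
    by (induction I) (auto simp: assms(1) Z_loc_add Z_loc_of_int[of p 0, simplified])
qed (simp add: Z_loc_of_int[OF assms(1), of 0, simplified])

lemma unit_not_p_multiple:
  assumes "prime p" "z \<in> Z_loc p" shows "of_nat p * z \<noteq> (1 :: rat)"
proof
  assume eq: "of_nat p * z = 1"
  obtain a b where z: "z = of_int a / of_int b" "\<not> int p dvd b"
    using assms(2) unfolding Z_loc_def by blast
  then have "(of_int (int p * a) :: rat) = of_int b"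
    using eq by (auto simp: field_simps split: if_splits)
  then have "int p * a = b" using of_int_eq_iff by blast
  with z show False by auto
qed

section \<open>Finite sets with a group action\<close>

lemma group_actionI:
  assumes K: "group K"
    and ext: "\<And>k. k \<in> carrier K \<Longrightarrow> \<phi> k \<in> extensional E"
    and closed: "\<And>k x. \<lbrakk>k \<in> carrier K; x \<in> E\<rbrakk> \<Longrightarrow> \<phi> k x \<in> E"
    and one: "\<And>x. x \<in> E \<Longrightarrow> \<phi> \<one>\<^bsub>K\<^esub> x = x"
    and mult: "\<And>k l x. \<lbrakk>k \<in> carrier K; l \<in> carrier K; x \<in> E\<rbrakk> \<Longrightarrow> \<phi> (k \<otimes>\<^bsub>K\<^esub> l) x = \<phi> k (\<phi> l x)"
  shows "group_action K E \<phi>"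
proof -
  interpret group K by fact
  have bij: "\<phi> k \<in> Bij E" if k: "k \<in> carrier K" for k
  proof -
    have "\<phi> (inv\<^bsub>K\<^esub> k) (\<phi> k x) = x \<and> \<phi> k (\<phi> (inv\<^bsub>K\<^esub> k) x) = x" if "x \<in> E" for x
      using mult[of "inv\<^bsub>K\<^esub> k" k x] mult[of k "inv\<^bsub>K\<^esub> k" x] k that one by auto
    then have "bij_betw (\<phi> k) E E"
      by (intro bij_betw_byWitness[where f' = "\<phi> (inv\<^bsub>K\<^esub> k)"]) (auto simp: closed k)
    then show ?thesis using ext[OF k] by (simp add: Bij_def)
  qed
  have "\<phi> (k \<otimes>\<^bsub>K\<^esub> l) = compose E (\<phi> k) (\<phi> l)" if "k \<in> carrier K" "l \<in> carrier K" for k l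
    using that ext by (intro extensionalityI[where A = E]) (auto simp: compose_eq mult)
  then have "\<phi> \<in> hom K (BijGroup E)"
    using bij by (auto simp: hom_def BijGroup_def)
  then show ?thesis
    by (simp add: group_action_def group_hom_def group_hom_axioms_def group_BijGroup K)
qed

lemma finite_gsetI:
  assumes "group K" "finite (fst X)"
    and "\<And>k. k \<in> carrier K \<Longrightarrow> snd X k \<in> extensional (fst X)"
    and "\<And>k x. \<lbrakk>k \<in> carrier K; x \<in> fst X\<rbrakk> \<Longrightarrow> snd X k x \<in> fst X"
    and "\<And>x. x \<in> fst X \<Longrightarrow> snd X \<one>\<^bsub>K\<^esub> x = x"
    and "\<And>k l x. \<lbrakk>k \<in> carrier K; l \<in> carrier K; x \<in> fst X\<rbrakk>
          \<Longrightarrow> snd X (k \<otimes>\<^bsub>K\<^esub> l) x = snd X k (snd X l x)"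
  shows "finite_gset K X"
  unfolding finite_gset_def using assms by (auto intro!: group_actionI)

lemma finite_gsetD:
  assumes "finite_gset K X"
  shows "finite (fst X)" "group_action K (fst X) (snd X)" "group K"
proof -
  show A: "finite (fst X)" "group_action K (fst X) (snd X)"
    using assms by (auto simp: finite_gset_def)
  show "group K" using group_hom.axioms(1)[OF group_action.group_hom[OF A(2)]] .
qed

lemma gset_closed: "\<lbrakk>finite_gset K X; k \<in> carrier K; x \<in> fst X\<rbrakk> \<Longrightarrow> snd X k x \<in> fst X"
  using group_action.element_image finite_gsetD(2) by metis

lemma gset_one: "\<lbrakk>finite_gset K X; x \<in> fst X\<rbrakk> \<Longrightarrow> snd X \<one>\<^bsub>K\<^esub> x = x"
  using group_action.id_eq_one[OF finite_gsetD(2)] by (metis restrict_apply')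

lemma gset_mult:
  "\<lbrakk>finite_gset K X; k \<in> carrier K; l \<in> carrier K; x \<in> fst X\<rbrakk>
    \<Longrightarrow> snd X (k \<otimes>\<^bsub>K\<^esub> l) x = snd X k (snd X l x)"
  using group_action.composition_rule[OF finite_gsetD(2)] by metis

lemma gset_extensional: "\<lbrakk>finite_gset K X; k \<in> carrier K\<rbrakk> \<Longrightarrow> snd X k \<in> extensional (fst X)"
  using group_action.bij_prop0[OF finite_gsetD(2), of K X k] unfolding Bij_def by blast

lemma gset_inv:
  assumes "finite_gset K X" "k \<in> carrier K" "x \<in> fst X"
  shows "snd X (inv\<^bsub>K\<^esub> k) (snd X k x) = x" "snd X k (snd X (inv\<^bsub>K\<^esub> k) x) = x"
  using gset_mult[OF assms(1), of "inv\<^bsub>K\<^esub> k" k x] gset_mult[OF assms(1), of k "inv\<^bsub>K\<^esub> k" x]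
    gset_one[OF assms(1,3)] group.inv_closed[OF finite_gsetD(3)[OF assms(1)] assms(2)]
    group.l_inv[OF finite_gsetD(3)[OF assms(1)] assms(2)]
    group.r_inv[OF finite_gsetD(3)[OF assms(1)] assms(2)] assms(2,3)
  by auto

definition gset_stab :: "('k, 'm) monoid_scheme \<Rightarrow> ('k, 'x) gset \<Rightarrow> 'x \<Rightarrow> 'k set"
  where "gset_stab K X x = stabilizer K (snd X) x"

lemma mem_gset_stab: "k \<in> gset_stab K X x \<longleftrightarrow> k \<in> carrier K \<and> snd X k x = x"
  by (simp add: gset_stab_def stabilizer_def)

lemma gset_stab_subgroup: "\<lbrakk>finite_gset K X; x \<in> fst X\<rbrakk> \<Longrightarrow> subgroup (gset_stab K X x) K"
  unfolding gset_stab_def using group_action.stabilizer_subgroup finite_gsetD(2) by metis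

lemma finite_subgroups: "finite (carrier K) \<Longrightarrow> finite {L. subgroup L K}"
  by (rule finite_subset[of _ "Pow (carrier K)"]) (auto dest: subgroup.subset)

text \<open>
  Counting points by their exact stabilizer, and not only the points fixed by a subgroup, allows every
  sum over points of a function of the stabilizer to be rewritten as a sum over subgroups.
\<close>
definition stab_count :: "('k, 'm) monoid_scheme \<Rightarrow> ('k, 'x) gset \<Rightarrow> 'k set \<Rightarrow> nat"
  where "stab_count K X L = card {x \<in> fst X. gset_stab K X x = L}"

lemma sum_by_stabilizer:
  fixes h :: "'k set \<Rightarrow> rat"
  assumes "finite_gset K X" "finite (carrier K)"
  shows "(\<Sum>x\<in>fst X. h (gset_stab K X x)) = (\<Sum>L | subgroup L K. of_nat (stab_count K X L) * h L)"
proof -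
  have "(\<Sum>x\<in>fst X. h (gset_stab K X x)) =
      (\<Sum>L\<in>{L. subgroup L K}. \<Sum>x\<in>{x \<in> fst X. gset_stab K X x = L}. h (gset_stab K X x))"
    using assms by (intro sum.group[symmetric])
      (auto simp: finite_gsetD finite_subgroups gset_stab_subgroup)
  also have "\<dots> = (\<Sum>L | subgroup L K. of_nat (stab_count K X L) * h L)"
    by (intro sum.cong) (auto simp: stab_count_def)
  finally show ?thesis .
qed

lemma card_fixed_points:
  assumes "finite_gset K X" "finite (carrier K)" "D \<subseteq> carrier K"
  shows "of_nat (card (fixed_points D X)) =
    (\<Sum>L | subgroup L K \<and> D \<subseteq> L. of_nat (stab_count K X L) :: rat)"
proof -
  have "fixed_points D X = {x \<in> fst X. D \<subseteq> gset_stab K X x}"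
    using assms(3) by (auto simp: fixed_points_def mem_gset_stab)
  then have "(of_nat (card (fixed_points D X)) :: rat) =
      (\<Sum>x\<in>fst X. if D \<subseteq> gset_stab K X x then 1 else 0)"
    using finite_gsetD(1)[OF assms(1)] by (simp add: sum.If_cases Int_def)
  also have "\<dots> = (\<Sum>L | subgroup L K. of_nat (stab_count K X L) * (if D \<subseteq> L then 1 else 0))"
    by (rule sum_by_stabilizer[OF assms(1,2)])
  also have "\<dots> = (\<Sum>L | subgroup L K \<and> D \<subseteq> L. of_nat (stab_count K X L))"
    by (intro sum.mono_neutral_cong_right) (auto simp: finite_subgroups assms)
  finally show ?thesis .
qed

lemma gset_iso_sym:
  assumes "finite_gset K X" "gset_iso K X Y" shows "gset_iso K Y X"
proof -
  obtain f where f: "bij_betw f (fst X) (fst Y)"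
      "\<And>k x. k \<in> carrier K \<Longrightarrow> x \<in> fst X \<Longrightarrow> f (snd X k x) = snd Y k (f x)"
    using assms(2) unfolding gset_iso_def by blast
  have "inv_into (fst X) f (snd Y k y) = snd X k (inv_into (fst X) f y)"
    if k: "k \<in> carrier K" and y: "y \<in> fst Y" for k y
  proof -
    obtain x where x: "x \<in> fst X" "y = f x" using y f(1) by (auto simp: bij_betw_def)
    have inj: "inj_on f (fst X)" using f(1) by (simp add: bij_betw_def)
    have "inv_into (fst X) f (snd Y k y) = inv_into (fst X) f (f (snd X k x))"
      using f(2) x k by simp
    also have "\<dots> = snd X k x"
      by (rule inv_into_f_f[OF inj gset_closed[OF assms(1) k x(1)]])
    finally show ?thesis using x inj by simp
  qed
  then show ?thesis
    unfolding gset_iso_def using bij_betw_inv_into[OF f(1)] by blast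
qed

lemma gset_iso_trans:
  assumes "gset_iso K X Y" "gset_iso K Y Z" shows "gset_iso K X Z"
proof -
  obtain f g where fg: "bij_betw f (fst X) (fst Y)" "bij_betw g (fst Y) (fst Z)"
      "\<And>k x. k \<in> carrier K \<Longrightarrow> x \<in> fst X \<Longrightarrow> f (snd X k x) = snd Y k (f x)"
      "\<And>k x. k \<in> carrier K \<Longrightarrow> x \<in> fst Y \<Longrightarrow> g (snd Y k x) = snd Z k (g x)"
    using assms unfolding gset_iso_def by blast
  have "f x \<in> fst Y" if "x \<in> fst X" for x using fg(1) that by (auto simp: bij_betw_def)
  then show ?thesis
    unfolding gset_iso_def using bij_betw_trans[OF fg(1,2)] fg(3,4)
    by (intro exI[of _ "g \<circ> f"]) auto
qed

lemma iso_class_eqI: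
  assumes "finite_gset K X" "gset_iso K X Y" shows "iso_class K X = iso_class K Y"
  unfolding iso_class_def
  using gset_iso_trans[OF gset_iso_sym[OF assms]] gset_iso_trans[OF assms(2)] by blast

lemma stab_count_iso:
  assumes "finite_gset K X" "gset_iso K X Y" shows "stab_count K X L = stab_count K Y L"
proof -
  obtain f where f: "bij_betw f (fst X) (fst Y)"
      "\<And>k x. k \<in> carrier K \<Longrightarrow> x \<in> fst X \<Longrightarrow> f (snd X k x) = snd Y k (f x)"
    using assms(2) unfolding gset_iso_def by blast
  have inj: "inj_on f (fst X)" and im: "fst Y = f ` fst X" using f(1) by (auto simp: bij_betw_def)
  have "gset_stab K Y (f x) = gset_stab K X x" if "x \<in> fst X" for x
    unfolding set_eq_iff mem_gset_stab
    using f(2)[OF _ that] gset_closed[OF assms(1) _ that] inj_onD[OF inj _ _ that] by metis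
  then have "{y \<in> fst Y. gset_stab K Y y = L} = f ` {x \<in> fst X. gset_stab K X x = L}"
    unfolding im by auto
  then show ?thesis
    unfolding stab_count_def using inj by (simp add: card_image inj_on_def)
qed

text \<open>
  Isomorphism classes are sets of \<open>K\<close>-sets on natural numbers; that they are never empty is what
  makes \<^const>\<open>rep\<close> meaningful, also for coset spaces and tensor products.
\<close>
lemma nat_copy_exists:
  fixes X :: "('k, 'x) gset"
  assumes "finite_gset K X"
  obtains Y :: "('k, nat) gset" where "finite_gset K Y" "gset_iso K X Y"
proof -
  obtain f :: "'x \<Rightarrow> nat" where inj: "inj_on f (fst X)"
    using finite_imp_inj_to_nat_seg[OF finite_gsetD(1)[OF assms]] by blast
  define Y :: "('k, nat) gset" where
    "Y = (f ` fst X, \<lambda>k. \<lambda>n\<in>f ` fst X. f (snd X k (inv_into (fst X) f n)))"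
  have Y: "snd Y k (f x) = f (snd X k x)" if "x \<in> fst X" for k x
    using that inj by (simp add: Y_def)
  have Y1: "fst Y = f ` fst X" by (simp add: Y_def)
  have "finite_gset K Y"
  proof (rule finite_gsetI)
    show "snd Y k \<in> extensional (fst Y)" for k by (simp add: Y_def)
  qed (use assms in \<open>auto simp: Y Y1 gset_closed gset_one gset_mult finite_gsetD\<close>)
  moreover have "gset_iso K X Y"
    unfolding gset_iso_def Y1 using inj by (auto simp: bij_betw_def Y intro!: exI[of _ f])
  ultimately show ?thesis using that by blast
qed

lemma rep_iso_class:
  fixes X :: "('k, 'x) gset"
  assumes "finite_gset K X"
  shows "finite_gset K (rep (iso_class K X))" "gset_iso K X (rep (iso_class K X))"
proof -
  obtain Y :: "('k, nat) gset" where "finite_gset K Y" "gset_iso K X Y"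
    by (rule nat_copy_exists[OF assms])
  then have "\<exists>Y. Y \<in> iso_class K X" unfolding iso_class_def by blast
  then have "rep (iso_class K X) \<in> iso_class K X" unfolding rep_def by (rule someI_ex)
  then show "finite_gset K (rep (iso_class K X))" "gset_iso K X (rep (iso_class K X))"
    by (auto simp: iso_class_def)
qed

lemma stab_count_rep:
  "finite_gset K X \<Longrightarrow> stab_count K (rep (iso_class K X)) L = stab_count K X L"
  using stab_count_iso rep_iso_class by metis

definition gset_classes :: "('k, 'm) monoid_scheme \<Rightarrow> 'k iso_class set"
  where "gset_classes K = {iso_class K X | X :: ('k, nat) gset. finite_gset K X}"

lemma iso_class_in_gset_classes: "finite_gset K X \<Longrightarrow> iso_class K X \<in> gset_classes K"
  unfolding gset_classes_def using rep_iso_class[of K X] iso_class_eqI[of K X] by blast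

lemma gset_classesD:
  assumes "C \<in> gset_classes K" shows "finite_gset K (rep C)" "iso_class K (rep C) = C"
proof -
  obtain X :: "('a, nat) gset" where X: "finite_gset K X" "C = iso_class K X"
    using assms unfolding gset_classes_def by blast
  show "finite_gset K (rep C)" using rep_iso_class(1)[OF X(1)] X(2) by simp
  show "iso_class K (rep C) = C"
    using iso_class_eqI[OF X(1) rep_iso_class(2)[OF X(1)]] X(2) by simp
qed

lemma gset_sum_finite_gset:
  assumes "finite_gset K X" "finite_gset K Y" shows "finite_gset K (gset_sum X Y)"
proof (rule finite_gsetI)
  show "group K" using finite_gsetD(3)[OF assms(1)] .
qed (use assms in \<open>auto simp: gset_sum_def gset_closed gset_one gset_mult finite_gsetD\<close>)

lemma stab_count_gset_sum:
  assumes "finite_gset K X" "finite_gset K Y"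
  shows "stab_count K (gset_sum X Y) L = stab_count K X L + stab_count K Y L"
proof -
  have "{z \<in> fst (gset_sum X Y). gset_stab K (gset_sum X Y) z = L} =
      Inl ` {x \<in> fst X. gset_stab K X x = L} \<union> Inr ` {x \<in> fst Y. gset_stab K Y x = L}"
    (is "?A = ?B")
  proof -
    have "gset_stab K (gset_sum X Y) (Inl x) = gset_stab K X x" if "x \<in> fst X" for x
      using that by (auto simp: gset_sum_def mem_gset_stab Plus_def)
    moreover have "gset_stab K (gset_sum X Y) (Inr y) = gset_stab K Y y" if "y \<in> fst Y" for y
      using that by (auto simp: gset_sum_def mem_gset_stab Plus_def)
    moreover have "fst (gset_sum X Y) = fst X <+> fst Y" by (simp add: gset_sum_def)
    ultimately show ?thesis by (auto simp: Plus_def)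
  qed
  moreover have "card \<dots> = stab_count K X L + stab_count K Y L"
    using assms unfolding stab_count_def
    by (subst card_Un_disjoint) (auto simp: finite_gsetD card_image)
  ultimately show ?thesis unfolding stab_count_def by simp
qed

lemma coset_gset_finite_gset:
  assumes "group K" "finite (carrier K)" "subgroup L K"
  shows "finite_gset K (coset_gset K L)"
proof -
  interpret group K by fact
  have sub: "L \<subseteq> carrier K" using assms(3) by (rule subgroup.subset)
  have cosets: "C \<subseteq> carrier K" if "C \<in> lcosets\<^bsub>K\<^esub> L" for C
    using lcosets_subset_PowG[OF assms(3)] that by auto
  show ?thesis
  proof (rule finite_gsetI)
    show "finite (fst (coset_gset K L))"
      using assms(2) lcosets_subset_PowG[OF assms(3)] finite_subset
      by (fastforce simp: coset_gset_def)
    show "snd (coset_gset K L) k x \<in> fst (coset_gset K L)"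
      if "k \<in> carrier K" "x \<in> fst (coset_gset K L)" for k x
      using that sub by (auto simp: coset_gset_def LCOSETS_def lcos_m_assoc)
    then show "snd (coset_gset K L) (k \<otimes>\<^bsub>K\<^esub> l) x = snd (coset_gset K L) k (snd (coset_gset K L) l x)"
      if "k \<in> carrier K" "l \<in> carrier K" "x \<in> fst (coset_gset K L)" for k l x
      using that lcos_m_assoc[of x k l] cosets[of x] by (auto simp: coset_gset_def)
    show "snd (coset_gset K L) \<one>\<^bsub>K\<^esub> x = x" if "x \<in> fst (coset_gset K L)" for x
      using that cosets[of x] by (auto simp: coset_gset_def lcos_mult_one)
  qed (auto simp: coset_gset_def assms(1))
qed

section \<open>Coordinates and marks of formal sums\<close>

abbreviation (input) "single \<equiv> Poly_Mapping.single"
abbreviation (input) "lookup \<equiv> Poly_Mapping.lookup"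
abbreviation (input) "keys \<equiv> Poly_Mapping.keys"

definition linear_ext :: "('k iso_class \<Rightarrow> rat) \<Rightarrow> 'k formal \<Rightarrow> rat"
  where "linear_ext v f = (\<Sum>C\<in>keys f. lookup f C * v C)"

lemma linear_ext_superset:
  assumes "finite A" "keys f \<subseteq> A"
  shows "linear_ext v f = (\<Sum>C\<in>A. lookup f C * v C)"
  unfolding linear_ext_def using assms
  by (intro sum.mono_neutral_left) (auto simp: in_keys_iff)

lemma linear_ext_add: "linear_ext v (f + g) = linear_ext v f + linear_ext v g"
proof -
  let ?A = "keys f \<union> keys g"
  have "linear_ext v h = (\<Sum>C\<in>?A. lookup h C * v C)"
    if "keys h \<subseteq> ?A" for h
    by (rule linear_ext_superset[OF _ that]) simp
  then show ?thesis
    using keys_add[of f g] by (simp add: lookup_add sum.distrib distrib_right)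
qed

lemma linear_ext_single: "linear_ext v (single C r) = r * v C"
  by (simp add: linear_ext_def)

lemma linear_ext_zero: "linear_ext v 0 = 0"
  by (simp add: linear_ext_def)

lemma linear_ext_diff: "linear_ext v (f - g) = linear_ext v f - linear_ext v g"
  using linear_ext_add[of v "f - g" g] by simp

lemma linear_ext_sum: "linear_ext v (\<Sum>i\<in>I. f i) = (\<Sum>i\<in>I. linear_ext v (f i))"
  by (induction I rule: infinite_finite_induct) (auto simp: linear_ext_zero linear_ext_add)

lemma formal_eq_sum_singles:
  "f = (\<Sum>C\<in>keys f. single C (lookup f C))"
  by (rule poly_mapping_eqI)
    (simp add: lookup_sum lookup_single when_def sum.If_cases Int_def in_keys_iff)

lemma sum_single_const:
  "finite A \<Longrightarrow> (\<Sum>x\<in>A. single C (r :: rat)) = single C (of_nat (card A) * r)"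
  by (rule poly_mapping_eqI) (auto simp: lookup_sum lookup_single when_def)

lemma single_sum:
  "(\<Sum>x\<in>A. single C (r x :: rat)) = single C (\<Sum>x\<in>A. r x)"
  by (rule poly_mapping_eqI) (auto simp: lookup_sum lookup_single when_def)

lemma formal_sums_iff:
  "f \<in> formal_sums p K \<longleftrightarrow>
    keys f \<subseteq> gset_classes K \<and> (\<forall>C. lookup f C \<in> Z_loc p)"
  by (auto simp: formal_sums_def gset_classes_def)

lemma formal_sums_single:
  assumes "prime p" "C \<in> gset_classes K" "r \<in> Z_loc p"
  shows "single C r \<in> formal_sums p K"
  using assms Z_loc_of_int[of p 0] by (auto simp: formal_sums_iff lookup_single when_def)

lemma formal_sums_add:
  assumes "prime p" "f \<in> formal_sums p K" "g \<in> formal_sums p K"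
  shows "f + g \<in> formal_sums p K"
proof -
  have "keys (f + g) \<subseteq> gset_classes K"
    using assms keys_add[of f g] unfolding formal_sums_iff by blast
  moreover have "lookup (f + g) C \<in> Z_loc p" for C
    unfolding lookup_add using assms Z_loc_add[OF assms(1)] unfolding formal_sums_iff by simp
  ultimately show ?thesis by (simp add: formal_sums_iff)
qed

lemma formal_sums_sum:
  assumes "prime p" "\<And>i. i \<in> I \<Longrightarrow> f i \<in> formal_sums p K"
  shows "(\<Sum>i\<in>I. f i) \<in> formal_sums p K"
proof -
  have "0 \<in> formal_sums p K" using Z_loc_of_int[OF assms(1), of 0] by (simp add: formal_sums_iff)
  then show ?thesis using assms(2)
    by (induction I rule: infinite_finite_induct) (auto intro: formal_sums_add assms(1))
qed

text \<open>
  The linear extension of \<^const>\<open>stab_count\<close>. The marks of a formal sum are recovered by summing its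
  coordinates over the subgroups above a given one.
\<close>
definition coords :: "('k, 'm) monoid_scheme \<Rightarrow> 'k formal \<Rightarrow> 'k set \<Rightarrow> rat"
  where "coords K f L = linear_ext (\<lambda>C. of_nat (stab_count K (rep C) L)) f"

definition marks_of :: "('k, 'm) monoid_scheme \<Rightarrow> ('k set \<Rightarrow> rat) \<Rightarrow> 'k set \<Rightarrow> rat"
  where "marks_of K a D = (\<Sum>L | subgroup L K \<and> D \<subseteq> L. a L)"

lemma formal_mark_eq_marks_of:
  assumes "f \<in> formal_sums p K" "finite (carrier K)" "D \<subseteq> carrier K"
  shows "formal_mark D f = marks_of K (coords K f) D"
proof -
  have "formal_mark D f = (\<Sum>C\<in>keys f. \<Sum>L | subgroup L K \<and> D \<subseteq> L.
      lookup f C * of_nat (stab_count K (rep C) L))"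
    unfolding formal_mark_def
  proof (intro sum.cong refl)
    fix C assume "C \<in> keys f"
    then have "finite_gset K (rep C)" using assms(1) gset_classesD(1) unfolding formal_sums_iff by blast
    from card_fixed_points[OF this assms(2,3)]
    show "lookup f C * of_nat (card (fixed_points D (rep C))) =
      (\<Sum>L | subgroup L K \<and> D \<subseteq> L. lookup f C * of_nat (stab_count K (rep C) L))"
      by (simp add: sum_distrib_left)
  qed
  then show ?thesis
    unfolding marks_of_def coords_def linear_ext_def by (subst sum.swap) simp
qed

lemma relation_span_add:
  assumes "f \<in> relation_span p K" "g \<in> relation_span p K" shows "f + g \<in> relation_span p K"
  using assms(2)
proof (induction g rule: relation_span.induct)
  case zero
  then show ?case using assms(1) by simp
next
  case (add g r X Y)
  from relation_span.add[OF add.IH add.hyps(2-4)] show ?case by (simp add: algebra_simps)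
qed

lemma relation_span_sum:
  "(\<And>i. i \<in> I \<Longrightarrow> f i \<in> relation_span p K) \<Longrightarrow> (\<Sum>i\<in>I. f i) \<in> relation_span p K"
  by (induction I rule: infinite_finite_induct) (auto intro: relation_span.zero relation_span_add)

lemma relation_span_uminus:
  assumes "prime p" "f \<in> relation_span p K" shows "- f \<in> relation_span p K"
  using assms(2)
proof (induction f rule: relation_span.induct)
  case zero
  then show ?case by (simp add: relation_span.zero)
next
  case (add g r X Y)
  from relation_span.add[OF add.IH Z_loc_uminus[OF assms(1) add.hyps(2)] add.hyps(3,4)]
  show ?case by (simp add: algebra_simps single_uminus)
qed

lemma relation_span_gen:
  assumes "r \<in> Z_loc p" "finite_gset K (X :: ('k, nat) gset)" "finite_gset K (Y :: ('k, nat) gset)"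
  shows "single (iso_class K (gset_sum X Y)) r - single (iso_class K X) r
    - single (iso_class K Y) r \<in> relation_span p K"
  using relation_span.add[OF relation_span.zero assms] by simp

lemma coords_relation_span: "f \<in> relation_span p K \<Longrightarrow> coords K f L = 0"
proof (induction f rule: relation_span.induct)
  case (add f r X Y)
  then show ?case
    by (simp add: coords_def linear_ext_add linear_ext_diff linear_ext_single stab_count_rep
        gset_sum_finite_gset stab_count_gset_sum algebra_simps)
qed (simp add: coords_def linear_ext_zero)

definition sub_gset :: "('k, 'x) gset \<Rightarrow> 'x set \<Rightarrow> ('k, 'x) gset"
  where "sub_gset X A = (A, \<lambda>k. restrict (snd X k) A)"

lemma sub_gset_finite_gset:
  assumes "finite_gset K X" "A \<subseteq> fst X" "\<And>k x. k \<in> carrier K \<Longrightarrow> x \<in> A \<Longrightarrow> snd X k x \<in> A"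
  shows "finite_gset K (sub_gset X A)"
proof (rule finite_gsetI)
  show "finite (fst (sub_gset X A))"
    using assms(2) finite_gsetD(1)[OF assms(1)] by (auto simp: sub_gset_def intro: finite_subset)
qed (use assms in \<open>auto simp: sub_gset_def finite_gsetD subset_iff gset_one gset_mult\<close>)

lemma gset_stab_sub_gset: "x \<in> A \<Longrightarrow> gset_stab K (sub_gset X A) x = gset_stab K X x"
  by (auto simp: sub_gset_def mem_gset_stab)

lemma gset_iso_sum_sub_gset:
  assumes "finite_gset K X" "A \<subseteq> fst X"
    and "\<And>k x. k \<in> carrier K \<Longrightarrow> x \<in> A \<Longrightarrow> snd X k x \<in> A"
    and "\<And>k x. k \<in> carrier K \<Longrightarrow> x \<in> fst X - A \<Longrightarrow> snd X k x \<in> fst X - A"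
  shows "gset_iso K X (gset_sum (sub_gset X A) (sub_gset X (fst X - A)))"
proof -
  define f where "f x = (if x \<in> A then Inl x else Inr x)" for x
  let ?Y = "gset_sum (sub_gset X A) (sub_gset X (fst X - A))"
  have "fst ?Y = A <+> (fst X - A)" by (simp add: gset_sum_def sub_gset_def)
  then have bij: "bij_betw f (fst X) (fst ?Y)"
    by (intro bij_betw_byWitness[where f' = "case_sum id id"]) (use assms(2) in \<open>auto simp: f_def\<close>)
  have "f (snd X k x) = snd ?Y k (f x)" if "k \<in> carrier K" "x \<in> fst X" for k x
  proof (cases "x \<in> A")
    case True
    then show ?thesis using assms(3)[OF that(1) True]
      by (simp add: f_def gset_sum_def sub_gset_def InlI)
  next
    case False
    then show ?thesis using assms(4)[OF that(1), of x] that(2)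
      by (simp add: f_def gset_sum_def sub_gset_def InrI)
  qed
  with bij show ?thesis unfolding gset_iso_def by blast
qed

text \<open>
  A point \<open>y\<close> corresponds to the coset of all group elements that carry \<open>x\<close> to \<open>y\<close>; this needs no
  choice of representatives.
\<close>
lemma transitive_iso_coset_gset:
  assumes X: "finite_gset K X" and x: "x \<in> fst X"
    and trans: "\<And>y. y \<in> fst X \<Longrightarrow> \<exists>k\<in>carrier K. y = snd X k x"
  shows "gset_iso K X (coset_gset K (gset_stab K X x))"
proof -
  interpret group K using finite_gsetD(3)[OF X] .
  define f where "f y = {k \<in> carrier K. snd X k x = y}" for y
  have coset: "f (snd X k y) = k <#\<^bsub>K\<^esub> f y" if k: "k \<in> carrier K" and y: "y \<in> fst X" for k y
  proof (intro Set.set_eqI iffI)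
    fix l assume "l \<in> f (snd X k y)"
    then have l: "l \<in> carrier K" "snd X l x = snd X k y" by (auto simp: f_def)
    then have "inv\<^bsub>K\<^esub> k \<otimes>\<^bsub>K\<^esub> l \<in> f y"
      using k y by (simp add: f_def gset_mult[OF X _ _ x] gset_inv[OF X])
    moreover have "l = k \<otimes>\<^bsub>K\<^esub> (inv\<^bsub>K\<^esub> k \<otimes>\<^bsub>K\<^esub> l)" using k l by (simp add: m_assoc[symmetric])
    ultimately show "l \<in> k <#\<^bsub>K\<^esub> f y" unfolding l_coset_def by blast
  next
    fix l assume "l \<in> k <#\<^bsub>K\<^esub> f y"
    then show "l \<in> f (snd X k y)" using k
      by (auto simp: l_coset_def f_def gset_mult[OF X _ _ x])
  qed
  have fx: "f x = gset_stab K X x" by (auto simp: f_def mem_gset_stab)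
  have "inj_on f (fst X)"
  proof (rule inj_onI)
    fix y z assume yz: "y \<in> fst X" "z \<in> fst X" "f y = f z"
    obtain k where "k \<in> carrier K" "y = snd X k x" using trans yz(1) by blast
    then have "k \<in> f z" using yz(3) by (auto simp: f_def)
    then show "y = z" using \<open>y = snd X k x\<close> by (simp add: f_def)
  qed
  moreover have "f ` fst X = lcosets\<^bsub>K\<^esub> (gset_stab K X x)"
  proof (intro Set.set_eqI iffI)
    fix C assume "C \<in> f ` fst X"
    then obtain y where "y \<in> fst X" "C = f y" by blast
    then obtain k where "k \<in> carrier K" "C = f (snd X k x)" using trans by blast
    then show "C \<in> lcosets\<^bsub>K\<^esub> (gset_stab K X x)"
      using coset[OF _ x] fx by (auto simp: LCOSETS_def)
  next
    fix C assume "C \<in> lcosets\<^bsub>K\<^esub> (gset_stab K X x)"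
    then obtain k where "k \<in> carrier K" "C = k <#\<^bsub>K\<^esub> f x" using fx by (auto simp: LCOSETS_def)
    then show "C \<in> f ` fst X" using coset[OF _ x] gset_closed[OF X _ x] by blast
  qed
  ultimately have "bij_betw f (fst X) (fst (coset_gset K (gset_stab K X x)))"
    by (simp add: bij_betw_def coset_gset_def)
  moreover have "f y \<in> lcosets\<^bsub>K\<^esub> (gset_stab K X x)" if "y \<in> fst X" for y
    using \<open>f ` fst X = _\<close> that by blast
  then have "\<forall>k\<in>carrier K. \<forall>y\<in>fst X. f (snd X k y) = snd (coset_gset K (gset_stab K X x)) k (f y)"
    using coset by (simp add: coset_gset_def)
  ultimately show ?thesis unfolding gset_iso_def by blast
qed

definition coset_class :: "('k, 'm) monoid_scheme \<Rightarrow> 'k set \<Rightarrow> 'k iso_class"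
  where "coset_class K L = iso_class K (coset_gset K L)"

text \<open>
  The decomposition of \<open>r [X]\<close> into coset spaces. Each orbit \<open>K x\<close> contributes \<open>r [K/Stab x]\<close>, and
  the weight \<open>|Stab x| / |K| = 1 / |K x|\<close> distributes this term over the points of the orbit, so that no
  orbit representatives have to be chosen.
\<close>
definition orbit_form :: "('k, 'm) monoid_scheme \<Rightarrow> ('k, 'x) gset \<Rightarrow> rat \<Rightarrow> 'k formal"
  where "orbit_form K X r = (\<Sum>x\<in>fst X. single (coset_class K (gset_stab K X x))
    (r * of_nat (card (gset_stab K X x)) / of_nat (order K)))"

lemma orbit_form_transitive:
  assumes X: "finite_gset K X" and x: "x \<in> fst X" and fin: "finite (carrier K)"
    and trans: "\<And>y. y \<in> fst X \<Longrightarrow> \<exists>k\<in>carrier K. y = snd X k x"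
  shows "orbit_form K X r = single (iso_class K X) r"
proof -
  interpret group_action K "fst X" "snd X" using finite_gsetD(2)[OF X] .
  have orb: "orbit K (snd X) y = fst X" if y: "y \<in> fst X" for y
  proof
    show "orbit K (snd X) y \<subseteq> fst X" using gset_closed[OF X _ y] by (auto simp: orbit_def)
    show "fst X \<subseteq> orbit K (snd X) y"
    proof
      fix z assume z: "z \<in> fst X"
      have "z \<in> orbit K (snd X) x" "y \<in> orbit K (snd X) x"
        using trans z y by (auto simp: orbit_def)
      then show "z \<in> orbit K (snd X) y"
        using orbit_trans[OF y x z orbit_sym[OF x y]] by blast
    qed
  qed
  have "coset_class K (gset_stab K X y) = iso_class K X" if y: "y \<in> fst X" for y
    unfolding coset_class_def
  proof (rule iso_class_eqI[symmetric, OF X transitive_iso_coset_gset[OF X y]])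
    fix z assume "z \<in> fst X"
    then show "\<exists>k\<in>carrier K. z = snd X k y" using orb[OF y] by (auto simp: orbit_def)
  qed
  then have "orbit_form K X r = (\<Sum>y\<in>fst X. single (iso_class K X)
      (r * of_nat (card (gset_stab K X y)) / of_nat (order K)))"
    unfolding orbit_form_def by (intro sum.cong) auto
  also have "\<dots> = (\<Sum>y\<in>fst X. single (iso_class K X) (r / of_nat (card (fst X))))"
  proof (intro sum.cong refl)
    fix y assume y: "y \<in> fst X"
    have "card (fst X) * card (gset_stab K X y) = order K"
      using orbit_stabilizer_theorem[OF y] orb[OF y] by (simp add: gset_stab_def)
    moreover have "order K > 0"
      using monoid.order_gt_0_iff_finite[OF group.is_monoid[OF finite_gsetD(3)[OF X]]] fin by blast
    ultimately have "card (gset_stab K X y) \<noteq> 0" "(of_nat (order K) :: rat) = of_nat (card (fst X)) * of_nat (card (gset_stab K X y))"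
      by (metis mult_is_0 not_gr_zero, metis of_nat_mult)
    then have "r * of_nat (card (gset_stab K X y)) / of_nat (order K) = r / of_nat (card (fst X))"
      by simp
    then show "single (iso_class K X) (r * of_nat (card (gset_stab K X y)) / of_nat (order K))
        = single (iso_class K X) (r / of_nat (card (fst X)))"
      by simp
  qed
  also have "\<dots> = single (iso_class K X) r"
    using x finite_gsetD(1)[OF X] by (subst sum_single_const) auto
  finally show ?thesis .
qed

text \<open>
  Split off one orbit at a time. For the empty \<open>K\<close>-set the generator \<open>[X \<squnion> X] - [X] - [X]\<close> is
  \<open>- [X]\<close>, which is why \<open>[X]\<close> itself lies in the span of the relations.
\<close>
lemma orbit_decomposition:
  fixes X :: "('k, nat) gset"
  assumes p: "prime p" and fin: "finite (carrier K)" and r: "r \<in> Z_loc p"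
    and "finite_gset K X"
  shows "single (iso_class K X) r - orbit_form K X r \<in> relation_span p K"
  using assms(4)
proof (induction "card (fst X)" arbitrary: X rule: less_induct)
  case less
  note X = less.prems
  show ?case
  proof (cases "fst X = {}")
    case True
    then have "gset_iso K X (gset_sum X X)" by (auto simp: gset_iso_def gset_sum_def bij_betw_def)
    then have "iso_class K (gset_sum X X) = iso_class K X" using iso_class_eqI[OF X] by blast
    from relation_span_gen[OF Z_loc_uminus[OF p r] X X, unfolded this]
    show ?thesis using True by (simp add: orbit_form_def single_uminus)
  next
    case False
    then obtain x where x: "x \<in> fst X" by blast
    interpret group_action K "fst X" "snd X" using finite_gsetD(2)[OF X] .
    interpret K: group K using finite_gsetD(3)[OF X] .
    let ?A = "orbit K (snd X) x" and ?B = "fst X - orbit K (snd X) x"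
    have A: "?A \<subseteq> fst X" using gset_closed[OF X _ x] by (auto simp: orbit_def)
    have stepA: "snd X k y \<in> ?A" if "k \<in> carrier K" "y \<in> ?A" for k y
      using that gset_mult[OF X _ _ x, symmetric] K.m_closed unfolding orbit_def by fastforce
    have stepB: "snd X k y \<in> ?B" if k: "k \<in> carrier K" and y: "y \<in> ?B" for k y
    proof -
      have "snd X (inv\<^bsub>K\<^esub> k) (snd X k y) = y" using gset_inv(1)[OF X k] y by blast
      then show ?thesis using stepA[of "inv\<^bsub>K\<^esub> k" "snd X k y"] gset_closed[OF X k, of y] y k by auto
    qed
    let ?XA = "sub_gset X ?A" and ?XB = "sub_gset X ?B"
    have XA: "finite_gset K ?XA" by (rule sub_gset_finite_gset[OF X A stepA])
    have XB: "finite_gset K ?XB" by (rule sub_gset_finite_gset[OF X _ stepB]) auto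
    have "iso_class K X = iso_class K (gset_sum ?XA ?XB)"
      by (rule iso_class_eqI[OF X gset_iso_sum_sub_gset[OF X A stepA stepB]])
    then have split: "single (iso_class K X) r - single (iso_class K ?XA) r
        - single (iso_class K ?XB) r \<in> relation_span p K"
      using relation_span_gen[OF r XA XB] by simp
    have "card (fst ?XB) < card (fst X)"
      unfolding sub_gset_def fst_conv using x orbit_refl[OF x] finite_gsetD(1)[OF X]
      by (intro psubset_card_mono) auto
    from less.hyps[OF this XB]
    have B: "single (iso_class K ?XB) r - orbit_form K ?XB r \<in> relation_span p K" .
    have "orbit_form K ?XA r = single (iso_class K ?XA) r"
    proof (rule orbit_form_transitive[OF XA _ fin])
      show "x \<in> fst ?XA" using orbit_refl[OF x] by (simp add: sub_gset_def)
      then show "\<exists>k\<in>carrier K. y = snd ?XA k x" if "y \<in> fst ?XA" for y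
        using that by (auto simp: sub_gset_def orbit_def)
    qed
    moreover have "orbit_form K X r = orbit_form K ?XA r + orbit_form K ?XB r"
    proof -
      have "orbit_form K X r = (\<Sum>x\<in>?A \<union> ?B. single (coset_class K (gset_stab K X x))
          (r * of_nat (card (gset_stab K X x)) / of_nat (order K)))"
        unfolding orbit_form_def using A by (simp add: Un_absorb1)
      also have "\<dots> = orbit_form K ?XA r + orbit_form K ?XB r"
        unfolding orbit_form_def using finite_gsetD(1)[OF X] A
        by (subst sum.union_disjoint)
          (auto simp: sub_gset_def gset_stab_sub_gset[unfolded sub_gset_def] finite_subset intro!: arg_cong2[of _ _ _ _ "(+)"] sum.cong)
      finally show ?thesis .
    qed
    ultimately show ?thesis
      using relation_span_add[OF split B] by (simp add: algebra_simps)
  qed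
qed

lemma orbit_form_by_stabilizer:
  assumes "finite_gset K X" "finite (carrier K)"
  shows "orbit_form K X r = (\<Sum>L | subgroup L K. single (coset_class K L)
    (r * of_nat (stab_count K X L) * of_nat (card L) / of_nat (order K)))"
proof -
  have "orbit_form K X r = (\<Sum>L\<in>{L. subgroup L K}. \<Sum>x\<in>{x \<in> fst X. gset_stab K X x = L}.
      single (coset_class K (gset_stab K X x))
        (r * of_nat (card (gset_stab K X x)) / of_nat (order K)))"
    unfolding orbit_form_def using assms
    by (intro sum.group[symmetric]) (auto simp: finite_gsetD finite_subgroups gset_stab_subgroup)
  also have "\<dots> = (\<Sum>L | subgroup L K. \<Sum>x\<in>{x \<in> fst X. gset_stab K X x = L}.
      single (coset_class K L) (r * of_nat (card L) / of_nat (order K)))"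
    by (intro sum.cong) auto
  also have "\<dots> = (\<Sum>L | subgroup L K. single (coset_class K L)
    (r * of_nat (stab_count K X L) * of_nat (card L) / of_nat (order K)))"
    using finite_gsetD(1)[OF assms(1)]
    by (intro sum.cong refl) (simp add: sum_single_const stab_count_def mult_ac)
  finally show ?thesis .
qed

text \<open>
  Modulo the relations, a formal sum equals one that is built from its coordinates alone.
\<close>
lemma formal_orbit_form:
  assumes p: "prime p" and fin: "finite (carrier K)" and f: "f \<in> formal_sums p K"
  shows "f - (\<Sum>L | subgroup L K. single (coset_class K L)
    (coords K f L * of_nat (card L) / of_nat (order K))) \<in> relation_span p K"
proof -
  let ?c = "lookup f"
  have C: "finite_gset K (rep C)" "iso_class K (rep C) = C" "?c C \<in> Z_loc p"
    if "C \<in> keys f" for C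
  proof -
    have "C \<in> gset_classes K" using that f unfolding formal_sums_iff by blast
    then show "finite_gset K (rep C)" "iso_class K (rep C) = C" by (rule gset_classesD)+
    show "?c C \<in> Z_loc p" using f unfolding formal_sums_iff by blast
  qed
  have "(\<Sum>C\<in>keys f. single C (?c C) - orbit_form K (rep C) (?c C))
      \<in> relation_span p K"
    using orbit_decomposition[OF p fin C(3) C(1)] C(2) by (intro relation_span_sum) simp
  moreover have "(\<Sum>C\<in>keys f. orbit_form K (rep C) (?c C)) =
      (\<Sum>L | subgroup L K. single (coset_class K L)
        (coords K f L * of_nat (card L) / of_nat (order K)))"
  proof -
    have "(\<Sum>C\<in>keys f. orbit_form K (rep C) (?c C)) =
        (\<Sum>C\<in>keys f. \<Sum>L | subgroup L K. single (coset_class K L)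
          (?c C * of_nat (stab_count K (rep C) L) * of_nat (card L) / of_nat (order K)))"
      using C(1) fin by (intro sum.cong refl orbit_form_by_stabilizer)
    then show ?thesis
      unfolding coords_def linear_ext_def
      by (subst (asm) sum.swap) (simp add: single_sum sum_distrib_right sum_divide_distrib)
  qed
  ultimately show ?thesis
    using formal_eq_sum_singles[of f] by (simp add: sum_subtractf)
qed

lemma relation_span_iff_coords:
  assumes p: "prime p" and fin: "finite (carrier K)"
    and f: "f \<in> formal_sums p K" and g: "g \<in> formal_sums p K"
  shows "f - g \<in> relation_span p K \<longleftrightarrow> (\<forall>L. subgroup L K \<longrightarrow> coords K f L = coords K g L)"
proof
  assume "f - g \<in> relation_span p K"
  then have "coords K (f - g) L = 0" for L by (rule coords_relation_span)
  then show "\<forall>L. subgroup L K \<longrightarrow> coords K f L = coords K g L"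
    by (simp add: coords_def linear_ext_diff)
next
  assume eq: "\<forall>L. subgroup L K \<longrightarrow> coords K f L = coords K g L"
  let ?N = "\<lambda>f. \<Sum>L | subgroup L K. single (coset_class K L)
    (coords K f L * of_nat (card L) / of_nat (order K))"
  have "?N f = ?N g" using eq by (intro sum.cong) auto
  then have "(f - ?N f) + - (g - ?N g) = f - g" by simp
  then show "f - g \<in> relation_span p K"
    using relation_span_add[OF formal_orbit_form[OF p fin f]
        relation_span_uminus[OF p formal_orbit_form[OF p fin g]]] by simp
qed

text \<open>
  Moebius inversion on the subgroup lattice, from the top downwards.
\<close>
lemma marks_determine_coords:
  assumes fin: "finite (carrier K)"
    and eq: "\<And>D. subgroup D K \<Longrightarrow> marks_of K a D = marks_of K b D"
    and "subgroup L K"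
  shows "a L = b L"
  using assms(3)
proof (induction "card (carrier K) - card L" arbitrary: L rule: less_induct)
  case less
  let ?S = "{M. subgroup M K \<and> L \<subset> M}"
  have fS: "finite ?S" by (rule finite_subset[OF _ finite_subgroups[OF fin]]) auto
  have split: "marks_of K c L = c L + sum c ?S" for c :: "_ \<Rightarrow> rat"
  proof -
    have "{M. subgroup M K \<and> L \<subseteq> M} = insert L ?S" using less.prems by auto
    then show ?thesis unfolding marks_of_def using fS by simp
  qed
  have "sum a ?S = sum b ?S"
  proof (intro sum.cong refl)
    fix M assume "M \<in> ?S"
    then have M: "subgroup M K" "L \<subset> M" by auto
    have "finite M" using finite_subset[OF subgroup.subset[OF M(1)] fin] .
    then have "card L < card M" using M(2) by (rule psubset_card_mono)
    moreover have "card M \<le> card (carrier K)" by (rule card_mono[OF fin subgroup.subset[OF M(1)]])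
    ultimately show "a M = b M" by (intro less.hyps[OF _ M(1)]) linarith
  qed
  then show ?case using eq[OF less.prems] split[of a] split[of b] by simp
qed

section \<open>Elements of the Burnside module and their composites\<close>

definition finite_group :: "('k, 'm) monoid_scheme \<Rightarrow> bool"
  where "finite_group K \<longleftrightarrow> group K \<and> finite (carrier K)"

lemma finite_group_DirProd: "\<lbrakk>finite_group K; finite_group H\<rbrakk> \<Longrightarrow> finite_group (K \<times>\<times> H)"
  by (simp add: finite_group_def DirProd_group)

lemma finite_group_subgroup: "\<lbrakk>finite_group K; subgroup P K\<rbrakk> \<Longrightarrow> finite_group (subgrp K P)"
  by (auto simp: finite_group_def subgroup.subgroup_is_group intro: finite_subset dest: subgroup.subset)

lemma burnside_rel_class_eq:
  assumes p: "prime p" and fin: "finite (carrier (H \<times>\<times> G))"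
    and f: "f \<in> formal_sums p (H \<times>\<times> G)"
  shows "burnside_rel p G H `` {f} = {g \<in> formal_sums p (H \<times>\<times> G).
    \<forall>D. subgroup D (H \<times>\<times> G) \<longrightarrow> marks_of (H \<times>\<times> G) (coords (H \<times>\<times> G) f) D
      = marks_of (H \<times>\<times> G) (coords (H \<times>\<times> G) g) D}" (is "_ = ?R")
proof -
  let ?K = "H \<times>\<times> G"
  have "(\<forall>L. subgroup L ?K \<longrightarrow> coords ?K f L = coords ?K g L) \<longleftrightarrow>
      (\<forall>D. subgroup D ?K \<longrightarrow> marks_of ?K (coords ?K f) D = marks_of ?K (coords ?K g) D)"
    (is "?A \<longleftrightarrow> ?B") for g
  proof
    assume ?A
    then show ?B unfolding marks_of_def by (auto intro!: sum.cong)
  next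
    assume ?B
    then show ?A using marks_determine_coords[OF fin] by blast
  qed
  then show ?thesis
    using f relation_span_iff_coords[OF p fin f] unfolding burnside_rel_def by auto
qed

lemma burnside_class_self:
  assumes "f \<in> formal_sums p (H \<times>\<times> G)"
  shows "f \<in> burnside_rel p G H `` {f}"
  using assms relation_span.zero by (auto simp: burnside_rel_def)

lemma burnside_classE:
  assumes "X \<in> burnside p G H"
  obtains f where "f \<in> formal_sums p (H \<times>\<times> G)" "X = burnside_rel p G H `` {f}"
  using assms unfolding burnside_def quotient_def by blast

lemma burnside_classI:
  "f \<in> formal_sums p (H \<times>\<times> G) \<Longrightarrow> burnside_rel p G H `` {f} \<in> burnside p G H"
  unfolding burnside_def quotient_def by blast

lemma burnside_class_eq_iff:
  assumes p: "prime p" and fin: "finite (carrier (H \<times>\<times> G))"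
    and fg: "f \<in> formal_sums p (H \<times>\<times> G)" "g \<in> formal_sums p (H \<times>\<times> G)"
  shows "burnside_rel p G H `` {f} = burnside_rel p G H `` {g} \<longleftrightarrow>
    (\<forall>D. subgroup D (H \<times>\<times> G) \<longrightarrow> marks_of (H \<times>\<times> G) (coords (H \<times>\<times> G) f) D
      = marks_of (H \<times>\<times> G) (coords (H \<times>\<times> G) g) D)" (is "?A \<longleftrightarrow> ?B")
proof
  assume ?A
  then have "g \<in> burnside_rel p G H `` {f}" using burnside_class_self[OF fg(2)] by simp
  then show ?B unfolding burnside_rel_class_eq[OF p fin fg(1)] by blast
next
  assume ?B
  then show ?A
    unfolding burnside_rel_class_eq[OF p fin fg(1)] burnside_rel_class_eq[OF p fin fg(2)] by auto
qed

lemma the_elem_image_const: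
  assumes "x \<in> A" "\<And>y. y \<in> A \<Longrightarrow> F y = F x" shows "the_elem (F ` A) = F x"
proof -
  have "F ` A = (\<lambda>_. F x) ` A" using assms(2) by (intro image_cong refl)
  also have "\<dots> = {F x}" using assms(1) by auto
  finally have "F ` A = {F x}" .
  then show ?thesis by simp
qed

lemma mark_class:
  assumes p: "prime p" and fin: "finite (carrier (H \<times>\<times> G))"
    and f: "f \<in> formal_sums p (H \<times>\<times> G)" and D: "subgroup D (H \<times>\<times> G)"
  shows "mark D (burnside_rel p G H `` {f}) = marks_of (H \<times>\<times> G) (coords (H \<times>\<times> G) f) D"
proof -
  note marks = formal_mark_eq_marks_of[OF _ fin subgroup.subset[OF D]]
  have "mark D (burnside_rel p G H `` {f}) = formal_mark D f"
    unfolding mark_def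
  proof (rule the_elem_image_const[OF burnside_class_self[OF f]])
    fix g assume "g \<in> burnside_rel p G H `` {f}"
    then have g: "g \<in> formal_sums p (H \<times>\<times> G)" and
        eq: "marks_of (H \<times>\<times> G) (coords (H \<times>\<times> G) f) D = marks_of (H \<times>\<times> G) (coords (H \<times>\<times> G) g) D"
      using burnside_rel_class_eq[OF p fin f] D by auto
    show "formal_mark D g = formal_mark D f" unfolding marks[OF f] marks[OF g] eq ..
  qed
  then show ?thesis using marks[OF f] by simp
qed

lemma inverse_of_nat_factor:
  assumes "m * n = k" "0 < k" shows "1 / of_nat m = (of_nat n / of_nat k :: rat)"
proof -
  have "m \<noteq> 0" "n \<noteq> 0" using assms by auto
  then show ?thesis using assms(1)[symmetric] by simp
qed

text \<open>
  The contribution to the \<open>D\<close>-fixed points of \<open>Y \<times>\<^sub>H X\<close> of a pair \<open>(y, x)\<close> of points with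
  stabilizers \<open>L\<close> and \<open>R\<close>. The class of the pair has stabilizer \<open>L O R\<close>, so it is fixed iff
  \<open>D \<subseteq> L O R\<close>; its share in its class is the reciprocal of the size of that class, which is an
  orbit of \<open>H\<close>.
\<close>
definition comp_weight ::
  "('g, 'l) monoid_scheme \<Rightarrow> ('h, 'm) monoid_scheme \<Rightarrow> ('k, 'n) monoid_scheme \<Rightarrow>
   ('k \<times> 'g) set \<Rightarrow> ('k \<times> 'h) set \<Rightarrow> ('h \<times> 'g) set \<Rightarrow> rat"
  where "comp_weight G H K D L R =
    (if D \<subseteq> L O R
     then of_nat (card {h \<in> carrier H. (\<one>\<^bsub>K\<^esub>, h) \<in> L \<and> (h, \<one>\<^bsub>G\<^esub>) \<in> R}) / of_nat (order H) else 0)"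

definition comp_marks ::
  "('g, 'l) monoid_scheme \<Rightarrow> ('h, 'm) monoid_scheme \<Rightarrow> ('k, 'n) monoid_scheme \<Rightarrow>
   (('k \<times> 'h) set \<Rightarrow> rat) \<Rightarrow> (('h \<times> 'g) set \<Rightarrow> rat) \<Rightarrow> ('k \<times> 'g) set \<Rightarrow> rat"
  where "comp_marks G H K a b D =
    (\<Sum>L | subgroup L (K \<times>\<times> H). \<Sum>R | subgroup R (H \<times>\<times> G). comp_weight G H K D L R * a L * b R)"

context
  fixes G :: "('g, 'l) monoid_scheme" and H :: "('h, 'm) monoid_scheme"
    and K :: "('k, 'n) monoid_scheme" and Y :: "('k \<times> 'h, 'y) gset" and X :: "('h \<times> 'g, 'x) gset"
  assumes groups: "finite_group G" "finite_group H" "finite_group K"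
    and gsets: "finite_gset (K \<times>\<times> H) Y" "finite_gset (H \<times>\<times> G) X"
begin

interpretation G: group G using groups by (simp add: finite_group_def)
interpretation H: group H using groups by (simp add: finite_group_def)
interpretation K: group K using groups by (simp add: finite_group_def)

private abbreviation (input) "eG \<equiv> \<one>\<^bsub>G\<^esub>"
private abbreviation (input) "eH \<equiv> \<one>\<^bsub>H\<^esub>"
private abbreviation (input) "eK \<equiv> \<one>\<^bsub>K\<^esub>"

private lemma closedY: "\<lbrakk>k \<in> carrier K; h \<in> carrier H; y \<in> fst Y\<rbrakk> \<Longrightarrow> snd Y (k, h) y \<in> fst Y"
  by (rule gset_closed[OF gsets(1)]) auto

private lemma closedX: "\<lbrakk>h \<in> carrier H; g \<in> carrier G; x \<in> fst X\<rbrakk> \<Longrightarrow> snd X (h, g) x \<in> fst X"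
  by (rule gset_closed[OF gsets(2)]) auto

private lemma multY:
  "\<lbrakk>k \<in> carrier K; h \<in> carrier H; k' \<in> carrier K; h' \<in> carrier H; y \<in> fst Y\<rbrakk>
    \<Longrightarrow> snd Y (k, h) (snd Y (k', h') y) = snd Y (k \<otimes>\<^bsub>K\<^esub> k', h \<otimes>\<^bsub>H\<^esub> h') y"
  using gset_mult[OF gsets(1), of "(k, h)" "(k', h')" y] by simp

private lemma multX:
  "\<lbrakk>h \<in> carrier H; g \<in> carrier G; h' \<in> carrier H; g' \<in> carrier G; x \<in> fst X\<rbrakk>
    \<Longrightarrow> snd X (h, g) (snd X (h', g') x) = snd X (h \<otimes>\<^bsub>H\<^esub> h', g \<otimes>\<^bsub>G\<^esub> g') x"
  using gset_mult[OF gsets(2), of "(h, g)" "(h', g')" x] by simp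

private lemma oneY: "y \<in> fst Y \<Longrightarrow> snd Y (eK, eH) y = y"
  using gset_one[OF gsets(1)] by simp

private lemma oneX: "x \<in> fst X \<Longrightarrow> snd X (eH, eG) x = x"
  using gset_one[OF gsets(2)] by simp

text \<open>
  The classes of \<open>Y \<times>\<^sub>H X\<close> are the orbits of the diagonal action \<open>h (y, x) = (y h\<inverse>, h x)\<close> of \<open>H\<close>;
  in terms of the \<open>(K \<times> H)\<close>-set \<open>Y\<close>, the point \<open>y h\<inverse>\<close> is \<open>(1, h) y\<close>.
\<close>
private definition diag :: "('h, 'y \<times> 'x) gset" where
  "diag = (fst Y \<times> fst X,
     \<lambda>h. \<lambda>z\<in>fst Y \<times> fst X. (snd Y (eK, h) (fst z), snd X (h, eG) (snd z)))"

private definition cls :: "'y \<Rightarrow> 'x \<Rightarrow> ('y \<times> 'x) set" where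
  "cls y x = {(snd Y (eK, h) y, snd X (h, eG) x) | h. h \<in> carrier H}"

private lemma diag_gset: "finite_gset H diag"
  by (rule finite_gsetI)
    (auto simp: diag_def H.group_axioms finite_gsetD(1)[OF gsets(1)] finite_gsetD(1)[OF gsets(2)]
      closedX closedY oneX oneY multX multY)

private lemma orbit_diag: "\<lbrakk>y \<in> fst Y; x \<in> fst X\<rbrakk> \<Longrightarrow> orbit H (snd diag) (y, x) = cls y x"
  unfolding orbit_def cls_def diag_def by auto

private lemma tensor_rel_image:
  assumes "y \<in> fst Y" "x \<in> fst X"
  shows "tensor_rel G H K Y X `` {(y, x)} = cls y x"
proof (intro equalityI subsetI)
  fix z assume "z \<in> tensor_rel G H K Y X `` {(y, x)}"
  then obtain y0 h where *: "z = (y0, snd X (h, eG) x)" "y0 \<in> fst Y" "h \<in> carrier H"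
      "y = snd Y (eK, inv\<^bsub>H\<^esub> h) y0"
    unfolding tensor_rel_def left_act_def right_act_def by auto
  then have "snd Y (eK, h) y = y0" by (simp add: multY oneY)
  then show "z \<in> cls y x" using * unfolding cls_def by blast
next
  fix z assume "z \<in> cls y x"
  then obtain h where *: "h \<in> carrier H" "z = (snd Y (eK, h) y, snd X (h, eG) x)"
    unfolding cls_def by blast
  have "y = right_act H K Y (snd Y (eK, h) y) h"
    using * assms by (simp add: right_act_def multY oneY)
  moreover have "snd Y (eK, h) y \<in> fst Y" using * assms by (simp add: closedY)
  ultimately have "((y, x), (snd Y (eK, h) y, left_act G X h x)) \<in> tensor_rel G H K Y X"
    unfolding tensor_rel_def using * assms(2) by blast
  then show "z \<in> tensor_rel G H K Y X `` {(y, x)}" using * by (simp add: left_act_def)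
qed

private lemma fst_tensor: "fst (tensor G H K Y X) = {cls y x | y x. y \<in> fst Y \<and> x \<in> fst X}"
  unfolding tensor_def Let_def fst_conv quotient_def
  by (auto simp: tensor_rel_image; blast)

private lemma fst_tensor_orbits: "fst (tensor G H K Y X) = orbits H (fst Y \<times> fst X) (snd diag)"
  unfolding fst_tensor orbits_def by (auto simp: orbit_diag; (blast | metis orbit_diag))

private lemma snd_tensor:
  assumes "k \<in> carrier K" "g \<in> carrier G" "y \<in> fst Y" "x \<in> fst X"
  shows "snd (tensor G H K Y X) (k, g) (cls y x) = cls (snd Y (k, eH) y) (snd X (eH, g) x)"
proof -
  have "cls y x \<in> fst (tensor G H K Y X)" using assms unfolding fst_tensor by blast
  then have "snd (tensor G H K Y X) (k, g) (cls y x) =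
      (\<lambda>(y, x). (left_act H Y k y, right_act G H X x (inv\<^bsub>G\<^esub> g))) ` cls y x"
    by (simp add: tensor_def Let_def)
  also have "\<dots> = {(snd Y (k, eH) (snd Y (eK, h) y), snd X (eH, g) (snd X (h, eG) x)) | h. h \<in> carrier H}"
    using assms(2) by (auto simp: cls_def left_act_def right_act_def image_def)
  also have "\<dots> = cls (snd Y (k, eH) y) (snd X (eH, g) x)"
    unfolding cls_def using assms by (auto simp: multX multY) (auto simp: multX multY intro!: exI)
  finally show ?thesis .
qed

private lemma cls_eq_iff:
  assumes "y \<in> fst Y" "x \<in> fst X" "y' \<in> fst Y" "x' \<in> fst X"
  shows "cls y' x' = cls y x \<longleftrightarrow> (y', x') \<in> cls y x"
proof -
  interpret group_action H "fst diag" "snd diag" using finite_gsetD(2)[OF diag_gset] .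
  have d: "(y, x) \<in> fst diag" "(y', x') \<in> fst diag" using assms by (auto simp: diag_def)
  show ?thesis
  proof
    assume "cls y' x' = cls y x"
    then show "(y', x') \<in> cls y x" using orbit_refl[OF d(2)] assms by (simp add: orbit_diag)
  next
    assume "(y', x') \<in> cls y x"
    then have 1: "(y', x') \<in> orbit H (snd diag) (y, x)" using assms by (simp add: orbit_diag)
    have 2: "(y, x) \<in> orbit H (snd diag) (y', x')" by (rule orbit_sym[OF d(1) d(2) 1])
    have sub: "orbit H (snd diag) z \<subseteq> fst diag" if "z \<in> fst diag" for z
      using gset_closed[OF diag_gset _ that] by (auto simp: orbit_def)
    have "orbit H (snd diag) (y', x') = orbit H (snd diag) (y, x)"
      using orbit_trans[OF d(1) d(2) _ 1] orbit_trans[OF d(2) d(1) _ 2] sub[OF d(1)] sub[OF d(2)]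
      by blast
    then show "cls y' x' = cls y x" using assms by (simp add: orbit_diag)
  qed
qed

lemma tensor_finite_gset: "finite_gset (K \<times>\<times> G) (tensor G H K Y X)"
proof (rule finite_gsetI)
  show "group (K \<times>\<times> G)" using DirProd_group K.group_axioms G.group_axioms by blast
  have "fst (tensor G H K Y X) = (\<lambda>(y, x). cls y x) ` (fst Y \<times> fst X)"
    unfolding fst_tensor by auto
  then show "finite (fst (tensor G H K Y X))"
    using finite_gsetD(1)[OF gsets(1)] finite_gsetD(1)[OF gsets(2)] by simp
  show "snd (tensor G H K Y X) k \<in> extensional (fst (tensor G H K Y X))" for k
    by (auto simp: tensor_def Let_def split_beta)
  show "snd (tensor G H K Y X) k c \<in> fst (tensor G H K Y X)"
    if "k \<in> carrier (K \<times>\<times> G)" "c \<in> fst (tensor G H K Y X)" for k c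
    using that by (auto simp: fst_tensor snd_tensor) (metis closedX closedY H.one_closed)
  show "snd (tensor G H K Y X) \<one>\<^bsub>K \<times>\<times> G\<^esub> c = c" if "c \<in> fst (tensor G H K Y X)" for c
    using that by (auto simp: fst_tensor snd_tensor oneX oneY)
  show "snd (tensor G H K Y X) (k \<otimes>\<^bsub>K \<times>\<times> G\<^esub> l) c
      = snd (tensor G H K Y X) k (snd (tensor G H K Y X) l c)"
    if "k \<in> carrier (K \<times>\<times> G)" "l \<in> carrier (K \<times>\<times> G)" "c \<in> fst (tensor G H K Y X)" for k l c
  proof -
    obtain k1 k2 l1 l2 where kl: "k = (k1, k2)" "l = (l1, l2)" by fastforce
    show ?thesis using that unfolding kl
      by (auto simp: fst_tensor snd_tensor closedX closedY multX multY)
  qed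
qed

text \<open>
  The element \<open>(k, g)\<close> fixes the class of \<open>(y, x)\<close> iff some \<open>h\<close> undoes its effect on the
  representative, that is, iff \<open>(k, h)\<close> fixes \<open>y\<close> and \<open>(h, g)\<close> fixes \<open>x\<close>.
\<close>
lemma gset_stab_tensor:
  assumes "y \<in> fst Y" "x \<in> fst X"
  shows "gset_stab (K \<times>\<times> G) (tensor G H K Y X) (cls y x)
    = gset_stab (K \<times>\<times> H) Y y O gset_stab (H \<times>\<times> G) X x"
proof (intro Set.set_eqI)
  fix d :: "'k \<times> 'g"
  obtain k g where d: "d = (k, g)" by fastforce
  have "d \<in> gset_stab (K \<times>\<times> G) (tensor G H K Y X) (cls y x) \<longleftrightarrow>
      k \<in> carrier K \<and> g \<in> carrier G \<and> (snd Y (k, eH) y, snd X (eH, g) x) \<in> cls y x"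
  proof (cases "k \<in> carrier K \<and> g \<in> carrier G")
    case True
    then have "snd Y (k, eH) y \<in> fst Y" "snd X (eH, g) x \<in> fst X"
      using assms closedX closedY by auto
    from cls_eq_iff[OF assms this] snd_tensor[OF _ _ assms, of k g] True
    show ?thesis unfolding d mem_gset_stab by simp
  next
    case False
    then show ?thesis unfolding d mem_gset_stab by auto
  qed
  also have "\<dots> \<longleftrightarrow> d \<in> gset_stab (K \<times>\<times> H) Y y O gset_stab (H \<times>\<times> G) X x"
  proof
    assume *: "k \<in> carrier K \<and> g \<in> carrier G \<and> (snd Y (k, eH) y, snd X (eH, g) x) \<in> cls y x"
    then obtain h where h: "h \<in> carrier H" "snd Y (k, eH) y = snd Y (eK, h) y"
        "snd X (eH, g) x = snd X (h, eG) x" unfolding cls_def by auto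
    have kg: "k \<in> carrier K" "g \<in> carrier G" using * by auto
    have "snd Y (k, inv\<^bsub>H\<^esub> h) y = snd Y (eK, inv\<^bsub>H\<^esub> h) (snd Y (k, eH) y)"
      using kg h(1) assms by (simp add: multY)
    also have "\<dots> = y" unfolding h(2) using h(1) assms by (simp add: multY oneY)
    finally have y: "snd Y (k, inv\<^bsub>H\<^esub> h) y = y" .
    have "snd X (inv\<^bsub>H\<^esub> h, g) x = snd X (inv\<^bsub>H\<^esub> h, eG) (snd X (eH, g) x)"
      using kg h(1) assms by (simp add: multX)
    also have "\<dots> = x" unfolding h(3) using h(1) assms by (simp add: multX oneX)
    finally have "snd X (inv\<^bsub>H\<^esub> h, g) x = x" .
    with y * h show "d \<in> gset_stab (K \<times>\<times> H) Y y O gset_stab (H \<times>\<times> G) X x"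
      unfolding d by (intro relcompI[of k "inv\<^bsub>H\<^esub> h"]) (auto simp: mem_gset_stab)
  next
    assume "d \<in> gset_stab (K \<times>\<times> H) Y y O gset_stab (H \<times>\<times> G) X x"
    then obtain h where h: "k \<in> carrier K" "h \<in> carrier H" "g \<in> carrier G"
        "snd Y (k, h) y = y" "snd X (h, g) x = x"
      unfolding d by (auto simp: mem_gset_stab)
    have "snd Y (eK, inv\<^bsub>H\<^esub> h) y = snd Y (eK, inv\<^bsub>H\<^esub> h) (snd Y (k, h) y)" using h by simp
    also have "\<dots> = snd Y (k, eH) y" using h(1-3) assms by (simp add: multY)
    finally have y: "snd Y (k, eH) y = snd Y (eK, inv\<^bsub>H\<^esub> h) y" by simp
    have "snd X (inv\<^bsub>H\<^esub> h, eG) x = snd X (inv\<^bsub>H\<^esub> h, eG) (snd X (h, g) x)" using h by simp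
    also have "\<dots> = snd X (eH, g) x" using h(1-3) assms by (simp add: multX)
    finally have "snd X (eH, g) x = snd X (inv\<^bsub>H\<^esub> h, eG) x" by simp
    with y h show "k \<in> carrier K \<and> g \<in> carrier G \<and> (snd Y (k, eH) y, snd X (eH, g) x) \<in> cls y x"
      unfolding cls_def using H.inv_closed by blast
  qed
  finally show "d \<in> gset_stab (K \<times>\<times> G) (tensor G H K Y X) (cls y x) \<longleftrightarrow>
    d \<in> gset_stab (K \<times>\<times> H) Y y O gset_stab (H \<times>\<times> G) X x" .
qed

lemma card_fixed_points_tensor:
  assumes D: "D \<subseteq> carrier (K \<times>\<times> G)"
  shows "of_nat (card (fixed_points D (tensor G H K Y X))) =
    (\<Sum>y\<in>fst Y. \<Sum>x\<in>fst X. comp_weight G H K D (gset_stab (K \<times>\<times> H) Y y) (gset_stab (H \<times>\<times> G) X x))"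
proof -
  interpret act: group_action H "fst Y \<times> fst X" "snd diag"
    using finite_gsetD(2)[OF diag_gset] by (simp add: diag_def)
  let ?T = "tensor G H K Y X"
  let ?stab = "gset_stab (K \<times>\<times> G) ?T"
  have fin: "finite (fst Y \<times> fst X)"
    using finite_gsetD(1)[OF gsets(1)] finite_gsetD(1)[OF gsets(2)] by simp
  have weight: "(if D \<subseteq> ?stab c then 1 else 0) / of_nat (card c) =
      comp_weight G H K D (gset_stab (K \<times>\<times> H) Y y) (gset_stab (H \<times>\<times> G) X x)"
    if c: "c \<in> fst ?T" and yx: "(y, x) \<in> c" for c y x
  proof -
    obtain y0 x0 where 0: "y0 \<in> fst Y" "x0 \<in> fst X" "c = cls y0 x0" using c fst_tensor by blast
    then have mem: "y \<in> fst Y" "x \<in> fst X" using yx by (auto simp: cls_def closedX closedY)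
    have c: "c = cls y x" using cls_eq_iff[OF 0(1,2) mem] yx 0(3) by blast
    let ?S = "{h \<in> carrier H. (eK, h) \<in> gset_stab (K \<times>\<times> H) Y y \<and> (h, eG) \<in> gset_stab (H \<times>\<times> G) X x}"
    have "stabilizer H (snd diag) (y, x) = ?S"
      using mem by (auto simp: stabilizer_def diag_def mem_gset_stab)
    then have "card c * card ?S = order H"
      using act.orbit_stabilizer_theorem[of "(y, x)"] mem by (simp add: orbit_diag c)
    moreover have "order H > 0"
      using H.order_gt_0_iff_finite groups(2) by (simp add: finite_group_def)
    ultimately have "1 / (of_nat (card c) :: rat) = of_nat (card ?S) / of_nat (order H)"
      by (rule inverse_of_nat_factor)
    then show ?thesis
      unfolding comp_weight_def c gset_stab_tensor[OF mem] by simp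
  qed
  have "fixed_points D ?T = {c \<in> fst ?T. D \<subseteq> ?stab c}"
    using D by (auto simp: fixed_points_def mem_gset_stab)
  then have "(of_nat (card (fixed_points D ?T)) :: rat) = (\<Sum>c\<in>fst ?T. if D \<subseteq> ?stab c then 1 else 0)"
    using finite_gsetD(1)[OF tensor_finite_gset] by (simp add: sum.If_cases Int_def)
  also have "\<dots> = (\<Sum>c\<in>fst ?T. \<Sum>z\<in>c. (if D \<subseteq> ?stab c then 1 else 0) / of_nat (card c))"
  proof (intro sum.cong refl)
    fix c assume "c \<in> fst ?T"
    then obtain y x where yx: "y \<in> fst Y" "x \<in> fst X" "c = cls y x" using fst_tensor by blast
    have "c \<subseteq> fst Y \<times> fst X" using yx by (auto simp: cls_def closedX closedY)
    then have "finite c" using fin finite_subset by blast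
    moreover have "c \<noteq> {}" using cls_eq_iff[OF yx(1,2,1,2)] yx(3) by blast
    ultimately have "card c \<noteq> 0" by simp
    then show "(if D \<subseteq> ?stab c then 1 else 0) =
        (\<Sum>z\<in>c. (if D \<subseteq> ?stab c then 1 else 0) / (of_nat (card c) :: rat))"
      by simp
  qed
  also have "\<dots> = (\<Sum>c\<in>fst ?T. \<Sum>(y, x)\<in>c.
      comp_weight G H K D (gset_stab (K \<times>\<times> H) Y y) (gset_stab (H \<times>\<times> G) X x))"
  proof (intro sum.cong refl)
    fix c z assume "c \<in> fst ?T" "z \<in> c"
    then show "(if D \<subseteq> ?stab c then 1 else 0) / of_nat (card c) = (case z of (y, x) \<Rightarrow>
        comp_weight G H K D (gset_stab (K \<times>\<times> H) Y y) (gset_stab (H \<times>\<times> G) X x))"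
      using weight[of c "fst z" "snd z"] by (simp add: split_beta)
  qed
  also have "\<dots> = (\<Sum>(y, x)\<in>fst Y \<times> fst X.
      comp_weight G H K D (gset_stab (K \<times>\<times> H) Y y) (gset_stab (H \<times>\<times> G) X x))"
    unfolding fst_tensor_orbits by (rule act.disjoint_sum[OF fin])
  finally show ?thesis by (simp add: sum.cartesian_product)
qed

lemma marks_tensor:
  assumes D: "D \<subseteq> carrier (K \<times>\<times> G)"
  shows "marks_of (K \<times>\<times> G) (\<lambda>L. of_nat (stab_count (K \<times>\<times> G) (tensor G H K Y X) L)) D =
    comp_marks G H K (\<lambda>L. of_nat (stab_count (K \<times>\<times> H) Y L)) (\<lambda>R. of_nat (stab_count (H \<times>\<times> G) X R)) D"
proof -
  have fin: "finite (carrier (K \<times>\<times> G))" "finite (carrier (K \<times>\<times> H))" "finite (carrier (H \<times>\<times> G))"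
    using groups by (auto simp: finite_group_def)
  have "marks_of (K \<times>\<times> G) (\<lambda>L. of_nat (stab_count (K \<times>\<times> G) (tensor G H K Y X) L)) D =
      of_nat (card (fixed_points D (tensor G H K Y X)))"
    unfolding marks_of_def by (rule card_fixed_points[symmetric, OF tensor_finite_gset fin(1) D])
  also have "\<dots> = (\<Sum>y\<in>fst Y. \<Sum>R | subgroup R (H \<times>\<times> G).
      of_nat (stab_count (H \<times>\<times> G) X R) * comp_weight G H K D (gset_stab (K \<times>\<times> H) Y y) R)"
    unfolding card_fixed_points_tensor[OF D]
    by (intro sum.cong refl sum_by_stabilizer[OF gsets(2) fin(3)])
  also have "\<dots> = (\<Sum>L | subgroup L (K \<times>\<times> H). of_nat (stab_count (K \<times>\<times> H) Y L) *
      (\<Sum>R | subgroup R (H \<times>\<times> G). of_nat (stab_count (H \<times>\<times> G) X R) * comp_weight G H K D L R))"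
    by (rule sum_by_stabilizer[OF gsets(1) fin(2)])
  also have "\<dots> = comp_marks G H K (\<lambda>L. of_nat (stab_count (K \<times>\<times> H) Y L))
      (\<lambda>R. of_nat (stab_count (H \<times>\<times> G) X R)) D"
    unfolding comp_marks_def sum_distrib_left by (intro sum.cong refl) (simp add: mult_ac)
  finally show ?thesis .
qed

end

lemma formal_sums_keysD:
  assumes "f \<in> formal_sums p K" "C \<in> keys f"
  shows "C \<in> gset_classes K" "finite_gset K (rep C)" "lookup f C \<in> Z_loc p"
  using assms gset_classesD(1)[of C K] unfolding formal_sums_iff by auto

lemma formal_comp_closed:
  assumes p: "prime p" and groups: "finite_group G" "finite_group H" "finite_group K"
    and f: "f \<in> formal_sums p (K \<times>\<times> H)" and g: "g \<in> formal_sums p (H \<times>\<times> G)"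
  shows "formal_comp G H K f g \<in> formal_sums p (K \<times>\<times> G)"
  unfolding formal_comp_def
  by (intro formal_sums_sum formal_sums_single iso_class_in_gset_classes tensor_finite_gset
      Z_loc_mult p groups formal_sums_keysD(2,3)[OF f] formal_sums_keysD(2,3)[OF g])

text \<open>
  The composition formula: the sum over pairs of points of their contributions, sorted by the two
  stabilizers and extended bilinearly. As the right-hand side depends on coordinates only, it also
  shows that composition is well defined on the Burnside module.
\<close>
lemma marks_formal_comp:
  assumes p: "prime p" and groups: "finite_group G" "finite_group H" "finite_group K"
    and f: "f \<in> formal_sums p (K \<times>\<times> H)" and g: "g \<in> formal_sums p (H \<times>\<times> G)"
    and D: "D \<subseteq> carrier (K \<times>\<times> G)"
  shows "marks_of (K \<times>\<times> G) (coords (K \<times>\<times> G) (formal_comp G H K f g)) D =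
    comp_marks G H K (coords (K \<times>\<times> H) f) (coords (H \<times>\<times> G) g) D"
proof -
  let ?f = "lookup f" and ?g = "lookup g"
  let ?cY = "\<lambda>B L. of_nat (stab_count (K \<times>\<times> H) (rep B) L) :: rat"
  let ?cX = "\<lambda>C R. of_nat (stab_count (H \<times>\<times> G) (rep C) R) :: rat"
  have "coords (K \<times>\<times> G) (formal_comp G H K f g) N =
      (\<Sum>B\<in>keys f. \<Sum>C\<in>keys g. ?f B * ?g C *
        of_nat (stab_count (K \<times>\<times> G) (tensor G H K (rep B) (rep C)) N))" for N
    unfolding coords_def formal_comp_def linear_ext_sum linear_ext_single
    by (intro sum.cong refl)
      (simp add: stab_count_rep tensor_finite_gset groups formal_sums_keysD(2)[OF f] formal_sums_keysD(2)[OF g])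
  then have "marks_of (K \<times>\<times> G) (coords (K \<times>\<times> G) (formal_comp G H K f g)) D =
      (\<Sum>N | subgroup N (K \<times>\<times> G) \<and> D \<subseteq> N. \<Sum>B\<in>keys f. \<Sum>C\<in>keys g.
        ?f B * ?g C * of_nat (stab_count (K \<times>\<times> G) (tensor G H K (rep B) (rep C)) N))"
    by (simp add: marks_of_def)
  also have "\<dots> = (\<Sum>B\<in>keys f. \<Sum>C\<in>keys g. ?f B * ?g C *
      marks_of (K \<times>\<times> G) (\<lambda>N. of_nat (stab_count (K \<times>\<times> G) (tensor G H K (rep B) (rep C)) N)) D)"
    unfolding marks_of_def sum_distrib_left
    by (subst sum.swap, intro sum.cong refl, subst sum.swap, rule refl)
  also have "\<dots> = (\<Sum>B\<in>keys f. \<Sum>C\<in>keys g. ?f B * ?g C *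
      comp_marks G H K (?cY B) (?cX C) D)"
    by (intro sum.cong refl arg_cong2[of _ _ _ _ "(*)"] marks_tensor groups D
        formal_sums_keysD(2)[OF f] formal_sums_keysD(2)[OF g])
  also have "\<dots> = (\<Sum>B\<in>keys f. \<Sum>C\<in>keys g.
      \<Sum>L | subgroup L (K \<times>\<times> H). \<Sum>R | subgroup R (H \<times>\<times> G).
        comp_weight G H K D L R * (?f B * ?cY B L) * (?g C * ?cX C R))"
    unfolding comp_marks_def sum_distrib_left by (intro sum.cong refl) (simp add: mult_ac)
  also have "\<dots> = (\<Sum>B\<in>keys f. \<Sum>L | subgroup L (K \<times>\<times> H). \<Sum>R | subgroup R (H \<times>\<times> G).
      \<Sum>C\<in>keys g. comp_weight G H K D L R * (?f B * ?cY B L) * (?g C * ?cX C R))"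
    by (intro sum.cong refl, subst sum.swap, intro sum.cong refl, subst sum.swap, rule refl)
  also have "\<dots> = (\<Sum>L | subgroup L (K \<times>\<times> H). \<Sum>R | subgroup R (H \<times>\<times> G). \<Sum>B\<in>keys f.
      \<Sum>C\<in>keys g. comp_weight G H K D L R * (?f B * ?cY B L) * (?g C * ?cX C R))"
    by (subst sum.swap, intro sum.cong refl, subst sum.swap, rule refl)
  also have "\<dots> = comp_marks G H K (coords (K \<times>\<times> H) f) (coords (H \<times>\<times> G) g) D"
    unfolding comp_marks_def coords_def linear_ext_def
    by (simp add: sum_distrib_left sum_distrib_right mult_ac)
  finally show ?thesis .
qed

lemma comp_marks_cong:
  assumes "\<And>L. subgroup L (K \<times>\<times> H) \<Longrightarrow> a L = a' L" "\<And>R. subgroup R (H \<times>\<times> G) \<Longrightarrow> b R = b' R"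
  shows "comp_marks G H K a b D = comp_marks G H K a' b' D"
  unfolding comp_marks_def using assms by (intro sum.cong refl) auto

text \<open>
  All composites of representatives have the same marks, so the union in the definition of
  \<^const>\<open>burnside_comp\<close> is a single class.
\<close>
lemma burnside_comp_class:
  assumes p: "prime p" and groups: "finite_group G" "finite_group H" "finite_group K"
    and f: "f \<in> formal_sums p (K \<times>\<times> H)" and g: "g \<in> formal_sums p (H \<times>\<times> G)"
  shows "burnside_comp p G H K (burnside_rel p H K `` {f}) (burnside_rel p G H `` {g})
    = burnside_rel p G K `` {formal_comp G H K f g}"
proof -
  have fin: "finite (carrier (K \<times>\<times> G))" "finite (carrier (K \<times>\<times> H))" "finite (carrier (H \<times>\<times> G))"
    using groups by (auto simp: finite_group_def)
  have eq: "burnside_rel p G K `` {formal_comp G H K f' g'} = burnside_rel p G K `` {formal_comp G H K f g}"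
    if f': "f' \<in> burnside_rel p H K `` {f}" and g': "g' \<in> burnside_rel p G H `` {g}" for f' g'
  proof -
    have f'': "f' \<in> formal_sums p (K \<times>\<times> H)" and g'': "g' \<in> formal_sums p (H \<times>\<times> G)"
      using f' g' by (auto simp: burnside_rel_def)
    have rel: "f - f' \<in> relation_span p (K \<times>\<times> H)" "g - g' \<in> relation_span p (H \<times>\<times> G)"
      using f' g' by (auto simp: burnside_rel_def)
    note c = rel(1)[unfolded relation_span_iff_coords[OF p fin(2) f f'']]
      rel(2)[unfolded relation_span_iff_coords[OF p fin(3) g g'']]
    show ?thesis
    proof (subst burnside_class_eq_iff[OF p fin(1)], safe)
      fix D assume D: "subgroup D (K \<times>\<times> G)"
      show "marks_of (K \<times>\<times> G) (coords (K \<times>\<times> G) (formal_comp G H K f' g')) D =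
          marks_of (K \<times>\<times> G) (coords (K \<times>\<times> G) (formal_comp G H K f g)) D"
        unfolding marks_formal_comp[OF p groups f g subgroup.subset[OF D]]
          marks_formal_comp[OF p groups f'' g'' subgroup.subset[OF D]]
        using c by (intro comp_marks_cong) auto
    qed (intro formal_comp_closed p groups f g f'' g'')+
  qed
  show ?thesis
    unfolding burnside_comp_def
    using eq burnside_class_self[OF f] burnside_class_self[OF g] by blast
qed

section \<open>Fixed points of \<open>p\<close>-groups\<close>

text \<open>
  The points that are not fixed by \<open>D\<close> form orbits whose sizes are powers of \<open>p\<close> other than \<open>1\<close>.
\<close>
lemma fixed_points_mod_p:
  assumes p: "prime p" and X: "finite_gset K X" and D: "subgroup D K" and card: "card D = p ^ n"
  shows "int p dvd int (card (fst X)) - int (card (fixed_points D X))"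
proof -
  let ?K = "subgrp K D"
  interpret K: group K using finite_gsetD(3)[OF X] .
  have DK: "D \<subseteq> carrier K" using subgroup.subset[OF D] .
  have XD: "finite_gset ?K X"
    by (rule finite_gsetI)
      (use DK X D in \<open>auto simp: finite_gsetD gset_extensional gset_closed gset_one gset_mult
        subgroup.subgroup_is_group subset_iff\<close>)
  let ?A = "fst X - fixed_points D X"
  have inv: "inv\<^bsub>K\<^esub> d \<in> D" "d \<in> carrier K" if "d \<in> D" for d
    using that D DK subgroup.m_inv_closed by auto
  have A: "snd X d x \<in> ?A" if d: "d \<in> D" and x: "x \<in> ?A" for d x
  proof -
    have "snd X d x \<notin> fixed_points D X"
    proof
      assume "snd X d x \<in> fixed_points D X"
      then have "snd X (inv\<^bsub>K\<^esub> d) (snd X d x) = snd X d x" using inv[OF d] by (simp add: fixed_points_def)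
      then have "snd X d x = x" using gset_inv(1)[OF X] inv[OF d] x by simp
      with \<open>snd X d x \<in> fixed_points D X\<close> x show False by simp
    qed
    then show ?thesis using gset_closed[OF X] inv[OF d] x by simp
  qed
  let ?Z = "sub_gset X ?A"
  have Z: "finite_gset ?K ?Z" by (rule sub_gset_finite_gset[OF XD]) (use A in auto)
  interpret act: group_action ?K ?A "snd ?Z"
    using finite_gsetD(2)[OF Z] by (simp add: sub_gset_def)
  have orbit: "p dvd card c" if c: "c \<in> orbits ?K ?A (snd ?Z)" for c
  proof -
    obtain x where x: "x \<in> ?A" "c = orbit ?K (snd ?Z) x" using c by (auto simp: orbits_def)
    have "card c * card (stabilizer ?K (snd ?Z) x) = p ^ n"
      using act.orbit_stabilizer_theorem[OF x(1)] x(2) card by (simp add: order_def)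
    then have "card c dvd p ^ n" by (metis dvd_triv_left)
    then obtain i where i: "card c = p ^ i" using divides_primepow_nat[OF p] by blast
    have "card c \<noteq> 1"
    proof
      assume "card c = 1"
      then obtain z where z: "c = {z}" by (auto simp: card_1_singleton_iff)
      have "x \<in> c" using act.orbit_refl[OF x(1)] x(2) by simp
      then have "snd X d x = x" if "d \<in> D" for d
        using that z x by (auto simp: orbit_def sub_gset_def)
      then show False using x(1) by (auto simp: fixed_points_def)
    qed
    then show ?thesis using i by (cases i) auto
  qed
  have "card ?A = (\<Sum>c\<in>orbits ?K ?A (snd ?Z). card c)"
    using act.disjoint_sum[of "\<lambda>_. 1 :: nat"] finite_gsetD(1)[OF X] by simp
  then have "p dvd card ?A" using orbit by (simp add: dvd_sum)
  moreover have "fixed_points D X \<subseteq> fst X" by (auto simp: fixed_points_def)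
  then have "int (card ?A) = int (card (fst X)) - int (card (fixed_points D X))"
    using finite_gsetD(1)[OF X]
    by (simp add: card_Diff_subset finite_subset card_mono of_nat_diff)
  ultimately show ?thesis by (metis int_dvd_int_iff)
qed

lemma formal_mark_mod_p:
  assumes p: "prime p" and f: "f \<in> formal_sums p K" and D: "subgroup D K" and card: "card D = p ^ n"
  shows "\<exists>z\<in>Z_loc p. formal_mark {\<one>\<^bsub>K\<^esub>} f - formal_mark D f = of_nat p * z"
proof -
  have "\<exists>m. (of_nat (card (fixed_points {\<one>\<^bsub>K\<^esub>} (rep C))) - of_nat (card (fixed_points D (rep C))) :: rat)
      = of_nat p * of_int m" if "C \<in> keys f" for C
  proof -
    note X = formal_sums_keysD(2)[OF f that]
    have "fixed_points {\<one>\<^bsub>K\<^esub>} (rep C) = fst (rep C)"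
      using gset_one[OF X] by (auto simp: fixed_points_def)
    moreover obtain m where "int (card (fst (rep C))) - int (card (fixed_points D (rep C))) = int p * m"
      using fixed_points_mod_p[OF p X D card] by (auto simp: dvd_def)
    then have "rat_of_int (int (card (fst (rep C))) - int (card (fixed_points D (rep C)))) = of_nat p * of_int m"
      by simp
    ultimately show ?thesis by auto
  qed
  then obtain m where m: "\<And>C. C \<in> keys f \<Longrightarrow>
      (of_nat (card (fixed_points {\<one>\<^bsub>K\<^esub>} (rep C))) - of_nat (card (fixed_points D (rep C))) :: rat)
      = of_nat p * of_int (m C)" by metis
  let ?z = "\<Sum>C\<in>keys f. lookup f C * of_int (m C)"
  have "formal_mark {\<one>\<^bsub>K\<^esub>} f - formal_mark D f = of_nat p * ?z"
    unfolding formal_mark_def sum_subtractf[symmetric] right_diff_distrib[symmetric] sum_distrib_left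
    by (intro sum.cong refl) (simp add: m mult_ac)
  moreover have "?z \<in> Z_loc p"
    by (intro Z_loc_sum Z_loc_mult Z_loc_of_int p formal_sums_keysD(3)[OF f])
  ultimately show ?thesis by blast
qed

section \<open>Graphs as stabilizers\<close>

definition conj_set :: "('k, 'm) monoid_scheme \<Rightarrow> 'k \<Rightarrow> 'k set \<Rightarrow> 'k set"
  where "conj_set K k D = (\<lambda>d. k \<otimes>\<^bsub>K\<^esub> d \<otimes>\<^bsub>K\<^esub> inv\<^bsub>K\<^esub> k) ` D"

lemma gset_stab_translate:
  assumes X: "finite_gset K X" and k: "k \<in> carrier K" and x: "x \<in> fst X"
  shows "gset_stab K X (snd X k x) = conj_set K k (gset_stab K X x)"
proof -
  interpret group K using finite_gsetD(3)[OF X] .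
  have *: "snd X l (snd X k x) = snd X k x \<longleftrightarrow> snd X (inv\<^bsub>K\<^esub> k \<otimes>\<^bsub>K\<^esub> l \<otimes>\<^bsub>K\<^esub> k) x = x"
    if l: "l \<in> carrier K" for l
  proof -
    have "snd X (inv\<^bsub>K\<^esub> k \<otimes>\<^bsub>K\<^esub> l \<otimes>\<^bsub>K\<^esub> k) x = snd X (inv\<^bsub>K\<^esub> k) (snd X l (snd X k x))"
      using k l x by (simp add: gset_mult[OF X] gset_closed[OF X])
    then show ?thesis
      using gset_inv[OF X k] x gset_closed[OF X] k l by metis
  qed
  show ?thesis
  proof (intro equalityI subsetI)
    fix l assume "l \<in> gset_stab K X (snd X k x)"
    then have l: "l \<in> carrier K" "inv\<^bsub>K\<^esub> k \<otimes>\<^bsub>K\<^esub> l \<otimes>\<^bsub>K\<^esub> k \<in> gset_stab K X x"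
      using * k by (auto simp: mem_gset_stab)
    moreover have "l = k \<otimes>\<^bsub>K\<^esub> (inv\<^bsub>K\<^esub> k \<otimes>\<^bsub>K\<^esub> l \<otimes>\<^bsub>K\<^esub> k) \<otimes>\<^bsub>K\<^esub> inv\<^bsub>K\<^esub> k"
      using k l(1) by (simp add: m_assoc) (simp add: m_assoc[symmetric])
    ultimately show "l \<in> conj_set K k (gset_stab K X x)" unfolding conj_set_def by blast
  next
    fix l assume "l \<in> conj_set K k (gset_stab K X x)"
    then obtain d where d: "d \<in> carrier K" "snd X d x = x" "l = k \<otimes>\<^bsub>K\<^esub> d \<otimes>\<^bsub>K\<^esub> inv\<^bsub>K\<^esub> k"
      by (auto simp: conj_set_def mem_gset_stab)
    moreover have "inv\<^bsub>K\<^esub> k \<otimes>\<^bsub>K\<^esub> l \<otimes>\<^bsub>K\<^esub> k = d" unfolding d(3)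
      using k d(1) by (simp add: m_assoc) (simp add: m_assoc[symmetric])
    ultimately show "l \<in> gset_stab K X (snd X k x)"
      using * k by (simp add: mem_gset_stab)
  qed
qed

lemma coset_gset_stab_conj:
  assumes K: "finite_group K" and D: "subgroup D K" and nz: "stab_count K (coset_gset K D) R \<noteq> 0"
  shows "\<exists>k\<in>carrier K. R = conj_set K k D"
proof -
  interpret group K using K by (simp add: finite_group_def)
  let ?X = "coset_gset K D"
  have X: "finite_gset K ?X"
    using K by (intro coset_gset_finite_gset D) (simp_all add: finite_group_def)
  have DX: "D \<in> fst ?X"
    using lcos_mult_one[OF subgroup.subset[OF D]] one_closed by (force simp: coset_gset_def LCOSETS_def)
  have act: "snd ?X k D = k <#\<^bsub>K\<^esub> D" for k
    using DX by (simp add: coset_gset_def)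
  have "k <#\<^bsub>K\<^esub> D = D \<longleftrightarrow> k \<in> D" if k: "k \<in> carrier K" for k
    using lcos_self[OF k D] l_repr_independence[of k "\<one>\<^bsub>K\<^esub>" D] D lcos_mult_one[OF subgroup.subset[OF D]]
    by auto
  then have stab: "gset_stab K ?X D = D"
    using subgroup.subset[OF D] by (auto simp: mem_gset_stab act)
  have "{x \<in> fst ?X. gset_stab K ?X x = R} \<noteq> {}" using nz unfolding stab_count_def by force
  then obtain x where x: "x \<in> fst ?X" "gset_stab K ?X x = R" by blast
  then obtain k where k: "k \<in> carrier K" "x = snd ?X k D"
    unfolding act by (auto simp: coset_gset_def LCOSETS_def)
  then show ?thesis using x(2) gset_stab_translate[OF X k(1) DX] stab by auto
qed

lemma sum_stab_count:
  assumes "finite_gset K X" "finite (carrier K)"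
  shows "(\<Sum>L | subgroup L K. of_nat (stab_count K X L) :: rat) = of_nat (card (fst X))"
  using sum_by_stabilizer[OF assms, of "\<lambda>_. 1"] by simp

lemma coords_single:
  "finite_gset K X \<Longrightarrow> coords K (single (iso_class K X) r) L = r * of_nat (stab_count K X L)"
  by (simp add: coords_def linear_ext_single stab_count_rep)

lemma marks_conj_invariant:
  assumes K: "finite_group K" and f: "f \<in> formal_sums p K" and k: "k \<in> carrier K" and D: "D \<subseteq> carrier K"
  shows "marks_of K (coords K f) (conj_set K k D) = marks_of K (coords K f) D"
proof -
  interpret group K using K by (simp add: finite_group_def)
  have cD: "conj_set K k D \<subseteq> carrier K" using k D by (auto simp: conj_set_def)
  have "card (fixed_points (conj_set K k D) (rep C)) = card (fixed_points D (rep C))"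
    if "C \<in> keys f" for C
  proof -
    let ?X = "rep C"
    note X = formal_sums_keysD(2)[OF f that]
    have iff: "snd ?X (k \<otimes>\<^bsub>K\<^esub> d \<otimes>\<^bsub>K\<^esub> inv\<^bsub>K\<^esub> k) (snd ?X k x) = snd ?X k x \<longleftrightarrow> snd ?X d x = x"
      if "d \<in> carrier K" "x \<in> fst ?X" for d x
    proof -
      have "snd ?X (k \<otimes>\<^bsub>K\<^esub> d \<otimes>\<^bsub>K\<^esub> inv\<^bsub>K\<^esub> k) (snd ?X k x) = snd ?X k (snd ?X d x)"
        using k that by (simp add: gset_mult[OF X] gset_closed[OF X] gset_inv[OF X])
      then show ?thesis using gset_inv(1)[OF X k] that gset_closed[OF X] by metis
    qed
    have "bij_betw (snd ?X k) (fixed_points D ?X) (fixed_points (conj_set K k D) ?X)"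
    proof (rule bij_betw_byWitness[where f' = "snd ?X (inv\<^bsub>K\<^esub> k)"])
      show "\<forall>x\<in>fixed_points D ?X. snd ?X (inv\<^bsub>K\<^esub> k) (snd ?X k x) = x"
        "\<forall>x\<in>fixed_points (conj_set K k D) ?X. snd ?X k (snd ?X (inv\<^bsub>K\<^esub> k) x) = x"
        using gset_inv[OF X k] by (auto simp: fixed_points_def)
      show "snd ?X k ` fixed_points D ?X \<subseteq> fixed_points (conj_set K k D) ?X"
        using iff D gset_closed[OF X k] by (auto simp: fixed_points_def conj_set_def)
      show "snd ?X (inv\<^bsub>K\<^esub> k) ` fixed_points (conj_set K k D) ?X \<subseteq> fixed_points D ?X"
      proof
        fix y assume "y \<in> snd ?X (inv\<^bsub>K\<^esub> k) ` fixed_points (conj_set K k D) ?X"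
        then obtain x where x: "x \<in> fst ?X" "y = snd ?X (inv\<^bsub>K\<^esub> k) x"
            "\<And>d. d \<in> D \<Longrightarrow> snd ?X (k \<otimes>\<^bsub>K\<^esub> d \<otimes>\<^bsub>K\<^esub> inv\<^bsub>K\<^esub> k) x = x"
          by (auto simp: fixed_points_def conj_set_def)
        have y: "y \<in> fst ?X" using x gset_closed[OF X] k by simp
        have xy: "snd ?X k y = x" using x gset_inv(2)[OF X k] by simp
        show "y \<in> fixed_points D ?X"
          unfolding fixed_points_def using y x(3)[folded xy] iff[OF _ y] D by auto
      qed
    qed
    then show ?thesis by (rule bij_betw_same_card[symmetric])
  qed
  then have "formal_mark (conj_set K k D) f = formal_mark D f"
    unfolding formal_mark_def by (intro sum.cong) auto
  then show ?thesis
    using formal_mark_eq_marks_of[OF f _ cD] formal_mark_eq_marks_of[OF f _ D] K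
    by (simp add: finite_group_def)
qed

lemma graph_subgroup_mem: "(h, g) \<in> graph_subgroup U \<phi> \<longleftrightarrow> g \<in> U \<and> h = \<phi> g"
  by (auto simp: graph_subgroup_def)

text \<open>
  Composing with the graph of a map is transport along the map: \<open>D \<subseteq> L O \<Delta>(U,\<phi>)\<close> says that
  \<open>\<phi>\<close> is defined on the second projection of \<open>D\<close> and carries \<open>D\<close> into \<open>L\<close>.
\<close>
lemma comp_weight_graph:
  assumes H: "finite_group H" and L: "subgroup L (K \<times>\<times> H)"
    and one: "\<one>\<^bsub>G\<^esub> \<in> U" "\<phi> \<one>\<^bsub>G\<^esub> = \<one>\<^bsub>H\<^esub>"
  shows "comp_weight G H K D L (graph_subgroup U \<phi>) =
    (if snd ` D \<subseteq> U \<and> map_prod id \<phi> ` D \<subseteq> L then 1 / of_nat (order H) else 0)"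
proof -
  have "D \<subseteq> L O graph_subgroup U \<phi> \<longleftrightarrow> snd ` D \<subseteq> U \<and> map_prod id \<phi> ` D \<subseteq> L"
    unfolding subset_iff by (force simp: graph_subgroup_mem relcomp_unfold)
  moreover have "{h \<in> carrier H. (\<one>\<^bsub>K\<^esub>, h) \<in> L \<and> (h, \<one>\<^bsub>G\<^esub>) \<in> graph_subgroup U \<phi>} = {\<one>\<^bsub>H\<^esub>}"
    using subgroup.one_closed[OF L] subgroup.subset[OF L] one by (auto simp: graph_subgroup_mem)
  ultimately show ?thesis by (simp add: comp_weight_def)
qed

lemma marks_of_if:
  "finite (carrier K) \<Longrightarrow> marks_of K a D = (\<Sum>L | subgroup L K. if D \<subseteq> L then a L else 0)"
  unfolding marks_of_def
  by (intro sum.mono_neutral_cong_left) (auto simp: finite_subgroups)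

text \<open>
  Taking converses exchanges left and right actions and reverses composition. This reduces statements
  about multiplication from the left to those about multiplication from the right.
\<close>
lemma subgroup_converse:
  assumes "group K" "group H" "subgroup L (K \<times>\<times> H)"
  shows "subgroup (L\<inverse>) (H \<times>\<times> K)"
proof -
  note L = subgroup.subset[OF assms(3)] subgroup.m_closed[OF assms(3)]
    subgroup.one_closed[OF assms(3)] subgroup.m_inv_closed[OF assms(3)]
  show ?thesis
  proof (rule group.subgroupI[OF DirProd_group[OF assms(2,1)]])
    show "L\<inverse> \<subseteq> carrier (H \<times>\<times> K)" using L(1) by auto
    show "L\<inverse> \<noteq> {}" using L(3) by auto
    show "inv\<^bsub>H \<times>\<times> K\<^esub> x \<in> L\<inverse>" if "x \<in> L\<inverse>" for x
    proof -
      obtain h k where x: "x = (h, k)" by fastforce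
      then have x: "x = (h, k)" "(k, h) \<in> L" using that by auto
      then have c: "k \<in> carrier K" "h \<in> carrier H" using L(1) by auto
      show ?thesis using L(4)[OF x(2)] x c assms by (simp add: inv_DirProd)
    qed
    show "x \<otimes>\<^bsub>H \<times>\<times> K\<^esub> y \<in> L\<inverse>" if "x \<in> L\<inverse>" "y \<in> L\<inverse>" for x y
      using that L(2) by (fastforce simp: mult_DirProd')
  qed
qed

lemma bij_converse_subgroups:
  assumes "group K" "group H"
  shows "bij_betw converse {L. subgroup L (K \<times>\<times> H)} {L. subgroup L (H \<times>\<times> K)}"
  by (rule bij_betw_byWitness[where f' = converse])
    (use assms subgroup_converse in auto)

lemma marks_of_converse:
  assumes "finite_group K" "finite_group H"
  shows "marks_of (K \<times>\<times> H) a D = marks_of (H \<times>\<times> K) (a \<circ> converse) (D\<inverse>)"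
proof -
  have fin: "finite (carrier (K \<times>\<times> H))" "finite (carrier (H \<times>\<times> K))" and gr: "group K" "group H"
    using assms by (auto simp: finite_group_def)
  have "marks_of (H \<times>\<times> K) (a \<circ> converse) (D\<inverse>) =
      (\<Sum>L | subgroup L (K \<times>\<times> H). if D\<inverse> \<subseteq> L\<inverse> then (a \<circ> converse) (L\<inverse>) else 0)"
    unfolding marks_of_if[OF fin(2)]
    by (rule sum.reindex_bij_betw[OF bij_converse_subgroups[OF gr], symmetric])
  then show ?thesis by (simp add: marks_of_if[OF fin(1)] o_def cong: if_cong)
qed

lemma comp_marks_converse:
  assumes "finite_group G" "finite_group H" "finite_group K"
  shows "comp_marks G H K a b D = comp_marks K H G (b \<circ> converse) (a \<circ> converse) (D\<inverse>)"
proof -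
  have gr: "group G" "group H" "group K" using assms by (auto simp: finite_group_def)
  have w: "comp_weight K H G (D\<inverse>) (R\<inverse>) (L\<inverse>) = comp_weight G H K D L R" for L R
  proof -
    have "D\<inverse> \<subseteq> R\<inverse> O L\<inverse> \<longleftrightarrow> D \<subseteq> L O R" by (metis converse_mono converse_relcomp)
    moreover have "{h \<in> carrier H. (\<one>\<^bsub>G\<^esub>, h) \<in> R\<inverse> \<and> (h, \<one>\<^bsub>K\<^esub>) \<in> L\<inverse>} =
        {h \<in> carrier H. (\<one>\<^bsub>K\<^esub>, h) \<in> L \<and> (h, \<one>\<^bsub>G\<^esub>) \<in> R}" by auto
    ultimately show ?thesis by (simp add: comp_weight_def)
  qed
  have "comp_marks K H G (b \<circ> converse) (a \<circ> converse) (D\<inverse>) =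
      (\<Sum>R | subgroup R (H \<times>\<times> G). \<Sum>L' | subgroup L' (H \<times>\<times> K).
        comp_weight K H G (D\<inverse>) (R\<inverse>) L' * b R * a (L'\<inverse>))"
    unfolding comp_marks_def
    by (subst sum.reindex_bij_betw[OF bij_converse_subgroups[OF gr(2,1)], symmetric]) simp
  also have "\<dots> = (\<Sum>R | subgroup R (H \<times>\<times> G). \<Sum>L | subgroup L (K \<times>\<times> H). comp_weight G H K D L R * b R * a L)"
    by (subst sum.reindex_bij_betw[OF bij_converse_subgroups[OF gr(3,2)], symmetric]) (simp add: w)
  also have "\<dots> = comp_marks G H K a b D"
    unfolding comp_marks_def by (subst sum.swap) (simp add: mult_ac)
  finally show ?thesis by simp
qed

text \<open>Multiplication from the right by \<open>[U, \<phi>]\<close>. The conditions on \<open>b\<close> describe the coordinates of this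
  transitive biset: it has \<open>|H|\<close> points, whose stabilizers are the graphs of the conjugates of \<open>\<phi>\<close> by
  elements of \<open>H\<close>. All of them contribute the same mark.\<close>
lemma comp_marks_graph_transitive:
  assumes gr: "finite_group G" "finite_group H" "finite_group K"
    and one: "\<one>\<^bsub>G\<^esub> \<in> U" "\<phi> \<one>\<^bsub>G\<^esub> = \<one>\<^bsub>H\<^esub>" and D: "snd ` D \<subseteq> U"
    and supp: "\<And>R. \<lbrakk>subgroup R (H \<times>\<times> G); b R \<noteq> 0\<rbrakk> \<Longrightarrow>
      \<exists>s\<in>carrier H. R = graph_subgroup U (\<lambda>u. s \<otimes>\<^bsub>H\<^esub> \<phi> u \<otimes>\<^bsub>H\<^esub> inv\<^bsub>H\<^esub> s)"
    and total: "(\<Sum>R | subgroup R (H \<times>\<times> G). b R) = of_nat (order H)"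
    and conj: "\<And>s. s \<in> carrier H \<Longrightarrow>
      marks_of (K \<times>\<times> H) a (map_prod id (\<lambda>u. s \<otimes>\<^bsub>H\<^esub> \<phi> u \<otimes>\<^bsub>H\<^esub> inv\<^bsub>H\<^esub> s) ` D) = m"
  shows "comp_marks G H K a b D = m"
proof -
  interpret H: group H using gr by (simp add: finite_group_def)
  have fin: "finite (carrier (K \<times>\<times> H))" using gr by (simp add: finite_group_def)
  have ordH: "order H > 0" using H.order_gt_0_iff_finite gr by (simp add: finite_group_def)
  have "(\<Sum>L | subgroup L (K \<times>\<times> H). comp_weight G H K D L R * a L) * b R = m / of_nat (order H) * b R"
    if R: "subgroup R (H \<times>\<times> G)" for R
  proof (cases "b R = 0")
    case False
    obtain s where s: "s \<in> carrier H"
        "R = graph_subgroup U (\<lambda>u. s \<otimes>\<^bsub>H\<^esub> \<phi> u \<otimes>\<^bsub>H\<^esub> inv\<^bsub>H\<^esub> s)" (is "R = graph_subgroup U ?\<chi>")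
      using supp[OF R False] by blast
    have \<chi>: "?\<chi> \<one>\<^bsub>G\<^esub> = \<one>\<^bsub>H\<^esub>" using one s by simp
    have "(\<Sum>L | subgroup L (K \<times>\<times> H). comp_weight G H K D L R * a L) =
        (\<Sum>L | subgroup L (K \<times>\<times> H). (if map_prod id ?\<chi> ` D \<subseteq> L then a L else 0) / of_nat (order H))"
      unfolding s(2) by (intro sum.cong refl) (simp add: comp_weight_graph[where \<phi> = ?\<chi>, OF gr(2) _ one(1) \<chi>] D)
    also have "\<dots> = m / of_nat (order H)"
      unfolding sum_divide_distrib[symmetric] marks_of_if[OF fin, symmetric] conj[OF s(1)] ..
    finally show ?thesis by simp
  qed simp
  then have "comp_marks G H K a b D = (\<Sum>R | subgroup R (H \<times>\<times> G). m / of_nat (order H) * b R)"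
    unfolding comp_marks_def by (subst sum.swap) (simp add: sum_distrib_right)
  also have "\<dots> = m / of_nat (order H) * of_nat (order H)"
    unfolding sum_distrib_left[symmetric] total ..
  finally show ?thesis using ordH by simp
qed

lemma DirProd_subgrp: "K \<times>\<times> subgrp S P = subgrp (K \<times>\<times> S) (carrier K \<times> P)"
  by (simp add: DirProd_def)

lemma subgroup_DirProd_subgrp_iff:
  assumes "group K" "group S" "subgroup P S"
  shows "subgroup D (K \<times>\<times> subgrp S P) \<longleftrightarrow> subgroup D (K \<times>\<times> S) \<and> snd ` D \<subseteq> P"
proof -
  interpret KS: group "K \<times>\<times> S" using assms DirProd_group by blast
  have KP: "subgroup (carrier K \<times> P) (K \<times>\<times> S)"
    using DirProd_subgroups[OF assms(1) group.subgroup_self[OF assms(1)] assms(2,3)] .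
  show ?thesis
  proof
    assume D: "subgroup D (K \<times>\<times> subgrp S P)"
    then have "D \<subseteq> carrier K \<times> P" using subgroup.subset[OF D] by simp
    then show "subgroup D (K \<times>\<times> S) \<and> snd ` D \<subseteq> P"
      using KS.incl_subgroup[OF KP] D unfolding DirProd_subgrp by auto
  next
    assume D: "subgroup D (K \<times>\<times> S) \<and> snd ` D \<subseteq> P"
    then have "D \<subseteq> carrier K \<times> P" using subgroup.subset[of D "K \<times>\<times> S"] by force
    then show "subgroup D (K \<times>\<times> subgrp S P)"
      using KS.subgroup_incl[OF _ KP] D unfolding DirProd_subgrp by auto
  qed
qed

lemma subgroup_snd_image:
  assumes "group K" "group S" "subgroup D (K \<times>\<times> S)"
  shows "subgroup (snd ` D) S"
proof -
  have "group_hom (K \<times>\<times> S) S snd"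
    unfolding group_hom_def group_hom_axioms_def hom_def
    using assms DirProd_group by (auto simp: mult_DirProd')
  then show ?thesis using group_hom.subgroup_img_is_subgroup assms(3) by blast
qed

lemma subgroup_fst_image:
  assumes "group K" "group S" "subgroup D (K \<times>\<times> S)"
  shows "subgroup (fst ` D) K"
proof -
  have "group_hom (K \<times>\<times> S) K fst"
    unfolding group_hom_def group_hom_axioms_def hom_def
    using assms DirProd_group by (auto simp: mult_DirProd')
  then show ?thesis using group_hom.subgroup_img_is_subgroup assms(3) by blast
qed

lemma subgroup_graph:
  assumes "group S" "group H" "subgroup P S" "\<phi> \<in> hom (subgrp S P) H"
  shows "subgroup (graph_subgroup P \<phi>) (H \<times>\<times> S)"
proof -
  interpret S: group S by fact
  interpret P: group "subgrp S P" using subgroup.subgroup_is_group[OF assms(3,1)] .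
  have "group_hom (subgrp S P) (H \<times>\<times> S) (\<lambda>u. (\<phi> u, u))"
    unfolding group_hom_def group_hom_axioms_def
    using assms subgroup.subset[OF assms(3)] P.group_axioms DirProd_group[OF assms(2,1)]
    by (auto simp: hom_def Pi_iff)
  from group_hom.img_is_subgroup[OF this] show ?thesis
    unfolding graph_subgroup_def image_def by (simp add: setcompr_eq_image image_def) 
qed

lemma conj_set_converse:
  assumes "group G" "group H" "h \<in> carrier H" "g \<in> carrier G"
  shows "conj_set (H \<times>\<times> G) (h, g) (D\<inverse>) = (conj_set (G \<times>\<times> H) (g, h) D)\<inverse>"
  unfolding conj_set_def using assms
  by (auto simp: inv_DirProd mult_DirProd' image_iff) force+

text \<open>
  Conjugating by \<open>t\<close> in the source only changes \<open>\<phi>\<close> by an inner automorphism of the target, because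
  \<open>\<phi>\<close> is a homomorphism. So every conjugate of the graph is again a graph over all of \<open>P\<close>.
\<close>
lemma conj_set_graph:
  assumes S: "group S" and H: "group H" and P: "subgroup P S" and \<phi>: "\<phi> \<in> hom (subgrp S P) H"
    and s: "s \<in> carrier H" and t: "t \<in> P"
  shows "conj_set (H \<times>\<times> subgrp S P) (s, t) (graph_subgroup P \<phi>) =
    graph_subgroup P (\<lambda>u. (s \<otimes>\<^bsub>H\<^esub> inv\<^bsub>H\<^esub> \<phi> t) \<otimes>\<^bsub>H\<^esub> \<phi> u \<otimes>\<^bsub>H\<^esub> inv\<^bsub>H\<^esub> (s \<otimes>\<^bsub>H\<^esub> inv\<^bsub>H\<^esub> \<phi> t))"
    (is "_ = graph_subgroup P ?\<chi>")
proof -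
  interpret S: group S by fact
  interpret H: group H by fact
  interpret P: group "subgrp S P" using subgroup.subgroup_is_group[OF P S] .
  interpret \<phi>: group_hom "subgrp S P" H \<phi>
    by unfold_locales (rule \<phi>)
  have inv: "inv\<^bsub>H \<times>\<times> subgrp S P\<^esub> (s, t) = (inv\<^bsub>H\<^esub> s, inv\<^bsub>subgrp S P\<^esub> t)"
    using s t by (intro inv_DirProd) (auto simp: H P.group_axioms)
  define c where "c u = t \<otimes>\<^bsub>S\<^esub> u \<otimes>\<^bsub>S\<^esub> inv\<^bsub>subgrp S P\<^esub> t" for u
  have cl: "\<phi> u \<in> carrier H" if "u \<in> P" for u using \<phi>.hom_closed that by simp
  have it: "inv\<^bsub>subgrp S P\<^esub> t \<in> P" using P.inv_closed t by simp
  have cP: "c u \<in> P" if "u \<in> P" for u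
    using that t it subgroup.m_closed[OF P] by (simp add: c_def)
  have \<phi>c: "\<phi> (c u) = \<phi> t \<otimes>\<^bsub>H\<^esub> \<phi> u \<otimes>\<^bsub>H\<^esub> inv\<^bsub>H\<^esub> \<phi> t" if u: "u \<in> P" for u
  proof -
    have "\<phi> (c u) = \<phi> (t \<otimes>\<^bsub>S\<^esub> u) \<otimes>\<^bsub>H\<^esub> \<phi> (inv\<^bsub>subgrp S P\<^esub> t)"
      unfolding c_def using \<phi>.hom_mult[of "t \<otimes>\<^bsub>S\<^esub> u" "inv\<^bsub>subgrp S P\<^esub> t"] u t it
        subgroup.m_closed[OF P] by simp
    then show ?thesis using \<phi>.hom_mult[of t u] \<phi>.hom_inv[of t] u t by simp
  qed
  have \<chi>c: "?\<chi> (c u) = s \<otimes>\<^bsub>H\<^esub> \<phi> u \<otimes>\<^bsub>H\<^esub> inv\<^bsub>H\<^esub> s" if u: "u \<in> P" for u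
  proof -
    have "inv\<^bsub>H\<^esub> \<phi> t \<otimes>\<^bsub>H\<^esub> (\<phi> t \<otimes>\<^bsub>H\<^esub> x) = x" if "x \<in> carrier H" for x
      using that cl[OF t] by (simp add: H.m_assoc[symmetric])
    then show ?thesis
      using s cl[OF t] cl[OF u] unfolding \<phi>c[OF u] by (simp add: H.m_assoc H.inv_mult_group)
  qed
  have "c ` P = P"
  proof
    show "P \<subseteq> c ` P"
    proof
      fix v assume v: "v \<in> P"
      let ?u = "inv\<^bsub>subgrp S P\<^esub> t \<otimes>\<^bsub>S\<^esub> v \<otimes>\<^bsub>S\<^esub> t"
      have "?u \<in> P" using v t it subgroup.m_closed[OF P] by simp
      moreover have "c ?u = v"
      proof -
        have mem: "t \<in> carrier (subgrp S P)" "v \<in> carrier (subgrp S P)" using t v by auto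
        have "t \<otimes>\<^bsub>subgrp S P\<^esub> (inv\<^bsub>subgrp S P\<^esub> t \<otimes>\<^bsub>subgrp S P\<^esub> v \<otimes>\<^bsub>subgrp S P\<^esub> t) \<otimes>\<^bsub>subgrp S P\<^esub> inv\<^bsub>subgrp S P\<^esub> t = v"
          using mem P.inv_closed[OF mem(1)]
          by (metis P.inv_solve_left P.inv_solve_right P.m_assoc P.m_closed)
        then show ?thesis by (simp add: c_def)
      qed
      ultimately show "v \<in> c ` P" by force
    qed
  qed (use cP in auto)
  have "conj_set (H \<times>\<times> subgrp S P) (s, t) (graph_subgroup P \<phi>) =
      (\<lambda>u. (s \<otimes>\<^bsub>H\<^esub> \<phi> u \<otimes>\<^bsub>H\<^esub> inv\<^bsub>H\<^esub> s, c u)) ` P"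
    unfolding conj_set_def inv graph_subgroup_def c_def
    by (simp add: setcompr_eq_image image_image Setcompr_eq_image)
  also have "\<dots> = (\<lambda>u. (?\<chi> (c u), c u)) ` P" by (intro image_cong refl) (simp add: \<chi>c)
  also have "\<dots> = (\<lambda>v. (?\<chi> v, v)) ` (c ` P)" by (simp add: image_image)
  also have "\<dots> = graph_subgroup P ?\<chi>" unfolding \<open>c ` P = P\<close> graph_subgroup_def by (simp add: Setcompr_eq_image)
  finally show ?thesis .
qed

lemma card_graph: "card (graph_subgroup P \<phi>) = card P"
proof -
  have "graph_subgroup P \<phi> = (\<lambda>u. (\<phi> u, u)) ` P" by (auto simp: graph_subgroup_def)
  then show ?thesis by (simp add: card_image inj_on_def)
qed

lemma sum_coset_stab_count:
  assumes K: "finite_group K" and D: "subgroup D K" and ord: "order K = n * card D"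
  shows "(\<Sum>L | subgroup L K. of_nat (stab_count K (coset_gset K D) L) :: rat) = of_nat n"
proof -
  have K': "group K" "finite (carrier K)" using K by (auto simp: finite_group_def)
  have "card D > 0" using subgroup.finite_imp_card_positive[OF D K'(2)] .
  moreover have "card (lcosets\<^bsub>K\<^esub> D) * card D = n * card D"
    using group.l_lagrange[OF K' D] ord by simp
  ultimately have "card (lcosets\<^bsub>K\<^esub> D) = n" by simp
  then show ?thesis
    unfolding sum_stab_count[OF coset_gset_finite_gset[OF K' D] K'(2)] by (simp add: coset_gset_def)
qed

lemma order_DirProd: "order (K \<times>\<times> H) = order K * order H"
  by (simp add: order_def card_cartesian_product)

lemma conj_id_map_prod:
  assumes "group K" "group H" "s \<in> carrier H" "D \<subseteq> carrier K \<times> P"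
  shows "map_prod id (\<lambda>u. s \<otimes>\<^bsub>H\<^esub> \<phi> u \<otimes>\<^bsub>H\<^esub> inv\<^bsub>H\<^esub> s) ` D =
    conj_set (K \<times>\<times> H) (\<one>\<^bsub>K\<^esub>, s) (map_prod id \<phi> ` D)"
proof -
  interpret K: group K by fact
  have inv: "inv\<^bsub>K \<times>\<times> H\<^esub> (\<one>\<^bsub>K\<^esub>, s) = (\<one>\<^bsub>K\<^esub>, inv\<^bsub>H\<^esub> s)"
    using inv_DirProd[OF assms(1,2) _ assms(3)] by simp
  show ?thesis
    unfolding conj_set_def inv image_image using assms(4)
    by (intro image_cong refl) (auto simp: mult_DirProd' subset_iff)
qed

context
  fixes p :: nat and S :: "('a, 'm) monoid_scheme" and K :: "('k, 'n) monoid_scheme"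
    and P :: "'a set" and \<phi> :: "'a \<Rightarrow> 'a"
  assumes p: "prime p" and gr: "finite_group S" "finite_group K" and P: "subgroup P S"
    and \<phi>: "\<phi> \<in> hom (subgrp S P) S"
begin

private lemma groups: "group S" "group K" "group (subgrp S P)" "finite_group (subgrp S P)"
  using gr subgroup.subgroup_is_group[OF P] finite_group_subgroup[OF gr(1) P]
  by (auto simp: finite_group_def)

private lemma \<phi>_one: "\<phi> \<one>\<^bsub>subgrp S P\<^esub> = \<one>\<^bsub>S\<^esub>"
  using group_hom.hom_one[of "subgrp S P" S \<phi>] \<phi> groups
  by (simp add: group_hom_def group_hom_axioms_def)

private lemma graph: "subgroup (graph_subgroup P \<phi>) (S \<times>\<times> subgrp S P)"
  unfolding subgroup_DirProd_subgrp_iff[OF groups(1,1) P]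
  using subgroup_graph[OF groups(1,1) P \<phi>] by (auto simp: graph_subgroup_def)

text \<open>
  Composition with \<open>[P, \<phi>]\<close> restricts the action of \<open>S\<close> along \<open>\<phi>\<close>. This is what turns the definition of
  stability into invariance of marks.
\<close>
lemma marks_comp_graph_right:
  assumes f: "f \<in> formal_sums p (K \<times>\<times> S)" and D: "subgroup D (K \<times>\<times> subgrp S P)"
  shows "single (graph_class (subgrp S P) S P \<phi>) 1 \<in> formal_sums p (S \<times>\<times> subgrp S P)"
    and "marks_of (K \<times>\<times> subgrp S P) (coords (K \<times>\<times> subgrp S P) (formal_comp (subgrp S P) S K f
        (single (graph_class (subgrp S P) S P \<phi>) 1))) D
      = marks_of (K \<times>\<times> S) (coords (K \<times>\<times> S) f) (map_prod id \<phi> ` D)"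
proof -
  let ?G = "subgrp S P" and ?e = "single (graph_class (subgrp S P) S P \<phi>) (1 :: rat)"
  let ?X = "coset_gset (S \<times>\<times> ?G) (graph_subgroup P \<phi>)"
  have SG: "finite_group (S \<times>\<times> ?G)" using finite_group_DirProd gr(1) groups(4) by blast
  have X: "finite_gset (S \<times>\<times> ?G) ?X"
    by (rule coset_gset_finite_gset[OF _ _ graph]) (use SG in \<open>simp_all add: finite_group_def\<close>)
  show e: "?e \<in> formal_sums p (S \<times>\<times> ?G)"
    unfolding graph_class_def
    by (intro formal_sums_single p iso_class_in_gset_classes X) (use Z_loc_of_int[OF p, of 1] in simp)
  have c: "coords (S \<times>\<times> ?G) ?e R = of_nat (stab_count (S \<times>\<times> ?G) ?X R)" for R
    unfolding graph_class_def coords_single[OF X] by simp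
  have DK: "D \<subseteq> carrier K \<times> P" using subgroup.subset[OF D] by simp
  have closed: "\<phi> u \<in> carrier S" if "u \<in> P" for u using \<phi> that by (auto simp: hom_def)
  have "comp_marks ?G S K (coords (K \<times>\<times> S) f) (coords (S \<times>\<times> ?G) ?e) D
      = marks_of (K \<times>\<times> S) (coords (K \<times>\<times> S) f) (map_prod id \<phi> ` D)"
  proof (rule comp_marks_graph_transitive[where U = P and \<phi> = \<phi>])
    show "\<exists>s\<in>carrier S. R = graph_subgroup P (\<lambda>u. s \<otimes>\<^bsub>S\<^esub> \<phi> u \<otimes>\<^bsub>S\<^esub> inv\<^bsub>S\<^esub> s)"
      if "subgroup R (S \<times>\<times> ?G)" "coords (S \<times>\<times> ?G) ?e R \<noteq> 0" for R
    proof -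
      have "stab_count (S \<times>\<times> ?G) ?X R \<noteq> 0" using that(2) c by simp
      from coset_gset_stab_conj[OF SG graph this]
      obtain s t where st: "s \<in> carrier S" "t \<in> P" "R = conj_set (S \<times>\<times> ?G) (s, t) (graph_subgroup P \<phi>)"
        by auto
      interpret S: group S using groups(1) .
      have "s \<otimes>\<^bsub>S\<^esub> inv\<^bsub>S\<^esub> \<phi> t \<in> carrier S" using st(1) closed[OF st(2)] by simp
      then show ?thesis
        using st(3) conj_set_graph[OF groups(1,1) P \<phi> st(1,2)] by blast
    qed
    show "(\<Sum>R | subgroup R (S \<times>\<times> ?G). coords (S \<times>\<times> ?G) ?e R) = of_nat (order S)"
      unfolding c by (rule sum_coset_stab_count[OF SG graph])
        (simp add: order_DirProd card_graph, simp add: order_def)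
    show "marks_of (K \<times>\<times> S) (coords (K \<times>\<times> S) f) (map_prod id (\<lambda>u. s \<otimes>\<^bsub>S\<^esub> \<phi> u \<otimes>\<^bsub>S\<^esub> inv\<^bsub>S\<^esub> s) ` D) =
        marks_of (K \<times>\<times> S) (coords (K \<times>\<times> S) f) (map_prod id \<phi> ` D)" if s: "s \<in> carrier S" for s
      unfolding conj_id_map_prod[OF groups(2,1) s DK]
    proof (rule marks_conj_invariant[OF finite_group_DirProd[OF gr(2,1)] f])
      show "(\<one>\<^bsub>K\<^esub>, s) \<in> carrier (K \<times>\<times> S)"
        using s group.is_monoid[OF groups(2)] by (simp add: monoid.one_closed)
      show "map_prod id \<phi> ` D \<subseteq> carrier (K \<times>\<times> S)" using DK closed by auto
    qed
  qed (use gr groups \<phi>_one DK subgroup.one_closed[OF P] in auto)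
  then show "marks_of (K \<times>\<times> ?G) (coords (K \<times>\<times> ?G) (formal_comp ?G S K f ?e)) D
      = marks_of (K \<times>\<times> S) (coords (K \<times>\<times> S) f) (map_prod id \<phi> ` D)"
    using marks_formal_comp[OF p groups(4) gr f e] subgroup.subset[OF D] by simp
qed

text \<open>
  The mirror image. Here \<open>[\<phi> P, \<phi>\<inverse>]\<close> is the coset space of the converse of \<open>\<Delta>(P,\<phi>)\<close>, so
  the statement about right multiplication applies to the converses of all coordinates.
\<close>
lemma marks_comp_graph_left:
  assumes inj: "inj_on \<phi> P"
    and f: "f \<in> formal_sums p (S \<times>\<times> K)" and D: "subgroup D (subgrp S P \<times>\<times> K)"
  shows "single (graph_class S (subgrp S P) (\<phi> ` P) (inv_into P \<phi>)) 1
      \<in> formal_sums p (subgrp S P \<times>\<times> S)"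
    and "marks_of (subgrp S P \<times>\<times> K) (coords (subgrp S P \<times>\<times> K) (formal_comp K S (subgrp S P)
        (single (graph_class S (subgrp S P) (\<phi> ` P) (inv_into P \<phi>)) 1) f)) D
      = marks_of (K \<times>\<times> S) (coords (S \<times>\<times> K) f \<circ> converse) (map_prod id \<phi> ` (D\<inverse>))"
proof -
  let ?G = "subgrp S P"
  let ?e = "single (graph_class S ?G (\<phi> ` P) (inv_into P \<phi>)) (1 :: rat)"
  have conv: "graph_subgroup (\<phi> ` P) (inv_into P \<phi>) = (graph_subgroup P \<phi>)\<inverse>"
    using inj by (auto simp: graph_subgroup_def)
  let ?X = "coset_gset (?G \<times>\<times> S) ((graph_subgroup P \<phi>)\<inverse>)"
  note graph' = subgroup_converse[OF groups(1,3) graph]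
  have GS: "finite_group (?G \<times>\<times> S)" using finite_group_DirProd gr(1) groups(4) by blast
  have X: "finite_gset (?G \<times>\<times> S) ?X"
    by (rule coset_gset_finite_gset[OF _ _ graph']) (use GS in \<open>simp_all add: finite_group_def\<close>)
  show e: "?e \<in> formal_sums p (?G \<times>\<times> S)"
    unfolding graph_class_def conv
    by (intro formal_sums_single p iso_class_in_gset_classes X) (use Z_loc_of_int[OF p, of 1] in simp)
  have c: "coords (?G \<times>\<times> S) ?e R = of_nat (stab_count (?G \<times>\<times> S) ?X R)" for R
    unfolding graph_class_def conv coords_single[OF X] by simp
  let ?a = "coords (S \<times>\<times> K) f" and ?b = "coords (?G \<times>\<times> S) ?e"
  have DK: "D\<inverse> \<subseteq> carrier K \<times> P" using subgroup.subset[OF D] by auto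
  have closed: "\<phi> u \<in> carrier S" if "u \<in> P" for u using \<phi> that by (auto simp: hom_def)
  have "comp_marks ?G S K (?a \<circ> converse) (?b \<circ> converse) (D\<inverse>)
      = marks_of (K \<times>\<times> S) (?a \<circ> converse) (map_prod id \<phi> ` (D\<inverse>))"
  proof (rule comp_marks_graph_transitive[where U = P and \<phi> = \<phi>])
    show "\<exists>s\<in>carrier S. R = graph_subgroup P (\<lambda>u. s \<otimes>\<^bsub>S\<^esub> \<phi> u \<otimes>\<^bsub>S\<^esub> inv\<^bsub>S\<^esub> s)"
      if "subgroup R (S \<times>\<times> ?G)" "(?b \<circ> converse) R \<noteq> 0" for R
    proof -
      have "stab_count (?G \<times>\<times> S) ?X (R\<inverse>) \<noteq> 0" using that(2) c by simp
      from coset_gset_stab_conj[OF GS graph' this]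
      obtain t s where st: "s \<in> carrier S" "t \<in> P" "R\<inverse> = conj_set (?G \<times>\<times> S) (t, s) ((graph_subgroup P \<phi>)\<inverse>)"
        by auto
      then have R: "R = conj_set (S \<times>\<times> ?G) (s, t) (graph_subgroup P \<phi>)"
        using conj_set_converse[OF groups(1,3), of t s "graph_subgroup P \<phi>"] by simp
      interpret S: group S using groups(1) .
      have "s \<otimes>\<^bsub>S\<^esub> inv\<^bsub>S\<^esub> \<phi> t \<in> carrier S" using st(1) closed[OF st(2)] by simp
      then show ?thesis
        using R conj_set_graph[OF groups(1,1) P \<phi> st(1,2)] by blast
    qed
    have "(\<Sum>R | subgroup R (S \<times>\<times> ?G). (?b \<circ> converse) R) = (\<Sum>R | subgroup R (?G \<times>\<times> S). ?b R)"
      using sum.reindex_bij_betw[OF bij_converse_subgroups[OF groups(1,3)], of ?b] by simp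
    also have "\<dots> = of_nat (order S)"
      unfolding c by (rule sum_coset_stab_count[OF GS graph'])
        (simp add: order_DirProd card_graph card_inverse, simp add: order_def)
    finally show "(\<Sum>R | subgroup R (S \<times>\<times> ?G). (?b \<circ> converse) R) = of_nat (order S)" .
    show "marks_of (K \<times>\<times> S) (?a \<circ> converse) (map_prod id (\<lambda>u. s \<otimes>\<^bsub>S\<^esub> \<phi> u \<otimes>\<^bsub>S\<^esub> inv\<^bsub>S\<^esub> s) ` (D\<inverse>)) =
        marks_of (K \<times>\<times> S) (?a \<circ> converse) (map_prod id \<phi> ` (D\<inverse>))" if s: "s \<in> carrier S" for s
    proof -
      let ?E = "(map_prod id \<phi> ` (D\<inverse>))\<inverse>"
      have one: "\<one>\<^bsub>K\<^esub> \<in> carrier K" using group.is_monoid[OF groups(2)] by (simp add: monoid.one_closed)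
      have E: "?E \<subseteq> carrier (S \<times>\<times> K)" using DK closed by auto
      have "marks_of (K \<times>\<times> S) (?a \<circ> converse) (conj_set (K \<times>\<times> S) (\<one>\<^bsub>K\<^esub>, s) (?E\<inverse>)) =
          marks_of (S \<times>\<times> K) ?a (conj_set (S \<times>\<times> K) (s, \<one>\<^bsub>K\<^esub>) ?E)"
        unfolding conj_set_converse[OF groups(1,2) one s] marks_of_converse[OF gr] ..
      also have "\<dots> = marks_of (S \<times>\<times> K) ?a ?E"
        using s one by (intro marks_conj_invariant[OF finite_group_DirProd[OF gr] f _ E]) simp
      also have "\<dots> = marks_of (K \<times>\<times> S) (?a \<circ> converse) (?E\<inverse>)"
        by (rule marks_of_converse[OF gr])
      finally show ?thesis unfolding conj_id_map_prod[OF groups(2,1) s DK] by simp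
    qed
  qed (use gr groups \<phi>_one DK subgroup.one_closed[OF P] in auto)
  moreover have "D \<subseteq> carrier (?G \<times>\<times> K)" using subgroup.subset[OF D] .
  ultimately show "marks_of (?G \<times>\<times> K) (coords (?G \<times>\<times> K) (formal_comp K S ?G ?e f)) D
      = marks_of (K \<times>\<times> S) (?a \<circ> converse) (map_prod id \<phi> ` (D\<inverse>))"
    using marks_formal_comp[OF p gr(2,1) groups(4) e f] comp_marks_converse[OF gr(2,1) groups(4)] by simp
qed

end

section \<open>Stability in terms of marks\<close>

definition fusion_graphs ::
  "('a, 'm) monoid_scheme \<Rightarrow> ('a set \<Rightarrow> 'a set \<Rightarrow> ('a \<Rightarrow> 'a) set) \<Rightarrow> ('a \<times> 'a) set set"
  where "fusion_graphs S F = {graph_subgroup Q \<chi> | Q \<chi>. subgroup Q S \<and> \<chi> \<in> F Q (carrier S)}"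

text \<open>
  Right stability of an element with coordinates \<open>a\<close>. Left stability is the same condition on
  \<open>a \<circ> converse\<close>, so that one notion serves both sides.
\<close>
definition stable_marks ::
  "('k, 'n) monoid_scheme \<Rightarrow> ('a, 'm) monoid_scheme \<Rightarrow> ('a set \<Rightarrow> 'a set \<Rightarrow> ('a \<Rightarrow> 'a) set) \<Rightarrow>
   (('k \<times> 'a) set \<Rightarrow> rat) \<Rightarrow> bool"
  where "stable_marks K S F a \<longleftrightarrow>
    (\<forall>P \<phi> D. subgroup P S \<longrightarrow> \<phi> \<in> F P (carrier S) \<longrightarrow> subgroup D (K \<times>\<times> S) \<longrightarrow> snd ` D \<subseteq> P \<longrightarrow>
       marks_of (K \<times>\<times> S) a (map_prod id \<phi> ` D) = marks_of (K \<times>\<times> S) a D)"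

context fusion_system
begin

abbreviation (input) "SS \<equiv> S \<times>\<times> S"

lemma finite_group_S: "finite_group S"
  using finite_carrier by (simp add: finite_group_def is_group)

lemma F_mon:
  assumes "subgroup P S" "\<phi> \<in> F P (carrier S)"
  shows "\<phi> \<in> hom (subgrp S P) S" "inj_on \<phi> P" "\<phi> \<in> extensional P"
  using morphism[OF assms(1) subgroup_self] assms(2) by (auto simp: mon_def)

lemma F_closed:
  assumes "subgroup P S" "\<phi> \<in> F P (carrier S)" "u \<in> P" shows "\<phi> u \<in> carrier S"
  using F_mon(1)[OF assms(1,2)] assms(3) by (auto simp: hom_def)

lemma F_group_hom:
  assumes "subgroup P S" "\<phi> \<in> F P (carrier S)" shows "group_hom (subgrp S P) S \<phi>"
  using F_mon(1)[OF assms] subgroup.subgroup_is_group[OF assms(1) is_group]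
  by (simp add: group_hom_def group_hom_axioms_def is_group)

lemma F_one:
  assumes "subgroup P S" "\<phi> \<in> F P (carrier S)" shows "\<phi> \<one> = \<one>"
  using group_hom.hom_one[OF F_group_hom[OF assms]] by simp

lemma F_mult:
  assumes "subgroup P S" "\<phi> \<in> F P (carrier S)" "u \<in> P" "v \<in> P" shows "\<phi> (u \<otimes> v) = \<phi> u \<otimes> \<phi> v"
  using group_hom.hom_mult[OF F_group_hom[OF assms(1,2)], of u v] assms(3,4) by simp

lemma F_image_subgroup:
  assumes "subgroup P S" "\<phi> \<in> F P (carrier S)" shows "subgroup (\<phi> ` P) S"
  using group_hom.img_is_subgroup[OF F_group_hom[OF assms]] by simp

lemma F_inclusion:
  assumes "subgroup P S" "subgroup Q S" "P \<subseteq> Q" shows "(\<lambda>u\<in>P. u) \<in> F P Q"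
proof -
  have "conj_map S P \<one> = (\<lambda>u\<in>P. u)"
    unfolding conj_map_def using subgroup.subset[OF assms(1)] by (intro restrict_ext) auto
  then show ?thesis using conjugation[OF assms(1,2) one_closed] assms(3) by auto
qed

lemma F_restrict:
  assumes "subgroup P S" "subgroup Q S" "Q \<subseteq> P" "\<phi> \<in> F P (carrier S)"
  shows "restrict \<phi> Q \<in> F Q (carrier S)"
proof -
  have "compose Q \<phi> (\<lambda>u\<in>Q. u) \<in> F Q (carrier S)"
    using composition[OF assms(2,1) subgroup_self F_inclusion[OF assms(2,1,3)] assms(4)] .
  moreover have "compose Q \<phi> (\<lambda>u\<in>Q. u) = restrict \<phi> Q" by (auto simp: compose_def)
  ultimately show ?thesis by simp
qed

lemma F_compose:
  assumes P: "subgroup P S" and Q: "subgroup Q S" and \<phi>: "\<phi> \<in> F P (carrier S)" and im: "\<phi> ` P \<subseteq> Q"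
    and \<psi>: "\<psi> \<in> F Q (carrier S)"
  shows "compose P \<psi> \<phi> \<in> F P (carrier S)"
proof -
  note P' = F_image_subgroup[OF P \<phi>]
  have "compose P (restrict \<psi> (\<phi> ` P)) \<phi> \<in> F P (carrier S)"
    by (rule composition[OF P P' subgroup_self iso_onto_image[OF P subgroup_self \<phi>]
          F_restrict[OF Q P' im \<psi>]])
  moreover have "compose P (restrict \<psi> (\<phi> ` P)) \<phi> = compose P \<psi> \<phi>"
    by (auto simp: compose_def intro!: restrict_ext)
  ultimately show ?thesis by simp
qed

lemma F_inverse:
  assumes P: "subgroup P S" and \<phi>: "\<phi> \<in> F P (carrier S)"
  shows "restrict (inv_into P \<phi>) (\<phi> ` P) \<in> F (\<phi> ` P) (carrier S)"
proof -
  note P' = F_image_subgroup[OF P \<phi>]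
  have "compose (\<phi> ` P) (\<lambda>u\<in>P. u) (restrict (inv_into P \<phi>) (\<phi> ` P)) \<in> F (\<phi> ` P) (carrier S)"
    by (rule composition[OF P' P subgroup_self inverse_from_image[OF P subgroup_self \<phi>]
          F_inclusion[OF P subgroup_self subgroup.subset[OF P]]])
  moreover have "compose (\<phi> ` P) (\<lambda>u\<in>P. u) (restrict (inv_into P \<phi>) (\<phi> ` P)) =
      restrict (inv_into P \<phi>) (\<phi> ` P)"
    unfolding compose_def by (rule restrict_ext) (simp add: inv_into_into)
  ultimately show ?thesis by simp
qed

lemma F_conj:
  assumes "subgroup P S" "s \<in> carrier S" shows "conj_map S P s \<in> F P (carrier S)"
  using subgroup.subset[OF assms(1)] assms
  by (intro conjugation subgroup_self) (auto simp: conj_map_def)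

lemma F_finite:
  assumes "subgroup P S" shows "finite (F P (carrier S))"
proof (rule finite_subset)
  show "F P (carrier S) \<subseteq> P \<rightarrow>\<^sub>E carrier S"
    using F_closed[OF assms] F_mon(3)[OF assms] by (auto simp: PiE_def)
  show "finite (P \<rightarrow>\<^sub>E carrier S)"
    by (intro finite_PiE finite_carrier finite_subset[OF subgroup.subset[OF assms] finite_carrier])
qed

lemma F_card_pos:
  assumes "subgroup P S" shows "card (F P (carrier S)) > 0"
  using F_finite[OF assms] F_inclusion[OF assms subgroup_self subgroup.subset[OF assms]]
  by (auto simp: card_gt_0_iff)

lemma F_trivial: "F {\<one>} (carrier S) = {\<lambda>u\<in>{\<one>}. u}"
proof -
  have T: "subgroup {\<one>} S" by (rule triv_subgroup)
  have "\<phi> = (\<lambda>u\<in>{\<one>}. u)" if \<phi>: "\<phi> \<in> F {\<one>} (carrier S)" for \<phi>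
    using F_mon(3)[OF T \<phi>] F_one[OF T \<phi>] by (intro extensionalityI[where A = "{\<one>}"]) auto
  then have "F {\<one>} (carrier S) \<subseteq> {\<lambda>u\<in>{\<one>}. u}" by blast
  moreover have "(\<lambda>u\<in>{\<one>}. u) \<in> F {\<one>} (carrier S)"
    by (rule F_inclusion[OF T subgroup_self]) simp
  ultimately show ?thesis by blast
qed

lemma fusion_graphs_converse:
  assumes "R \<in> fusion_graphs S F" shows "R\<inverse> \<in> fusion_graphs S F"
proof -
  obtain Q \<chi> where R: "R = graph_subgroup Q \<chi>" "subgroup Q S" "\<chi> \<in> F Q (carrier S)"
    using assms unfolding fusion_graphs_def by blast
  have "R\<inverse> = graph_subgroup (\<chi> ` Q) (restrict (inv_into Q \<chi>) (\<chi> ` Q))"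
  proof -
    have "(u, v) \<in> R\<inverse> \<longleftrightarrow> (u, v) \<in> graph_subgroup (\<chi> ` Q) (restrict (inv_into Q \<chi>) (\<chi> ` Q))" for u v
      unfolding R(1) converse_iff graph_subgroup_mem using F_mon(2)[OF R(2,3)] by auto
    then show ?thesis by auto
  qed
  then show ?thesis
    unfolding fusion_graphs_def using F_image_subgroup[OF R(2,3)] F_inverse[OF R(2,3)] by blast
qed

lemma fusion_graphs_conj:
  assumes P: "subgroup P S" and \<phi>: "\<phi> \<in> F P (carrier S)" and st: "s \<in> carrier S" "t \<in> carrier S"
  shows "conj_set SS (s, t) (graph_subgroup P \<phi>) \<in> fusion_graphs S F"
proof -
  define c where "c = conj_map S P t"
  have c: "c \<in> F P (carrier S)" unfolding c_def by (rule F_conj[OF P st(2)])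
  define d where "d = restrict (inv_into P c) (c ` P)"
  have d: "d \<in> F (c ` P) (carrier S)" unfolding d_def by (rule F_inverse[OF P c])
  have dc: "d (c u) = u" if "u \<in> P" for u using F_mon(2)[OF P c] that by (simp add: d_def)
  note P' = F_image_subgroup[OF P c]
  have d\<phi>: "compose (c ` P) \<phi> d \<in> F (c ` P) (carrier S)"
    by (rule F_compose[OF P' P d _ \<phi>]) (auto simp: dc)
  define \<chi> where "\<chi> = compose (c ` P) (conj_map S (carrier S) s) (compose (c ` P) \<phi> d)"
  have \<chi>: "\<chi> \<in> F (c ` P) (carrier S)"
    unfolding \<chi>_def using F_closed[OF P' d\<phi>]
    by (intro F_compose[OF P' subgroup_self d\<phi> _ F_conj[OF subgroup_self st(1)]]) auto
  have \<chi>c: "\<chi> (c u) = s \<otimes> \<phi> u \<otimes> inv s" if "u \<in> P" for u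
    using that F_closed[OF P \<phi>] by (simp add: \<chi>_def compose_def dc conj_map_def)
  have "conj_set SS (s, t) (graph_subgroup P \<phi>) = (\<lambda>u. (s \<otimes> \<phi> u \<otimes> inv s, c u)) ` P"
    using inv_DirProd[OF is_group is_group st]
    by (simp add: conj_set_def graph_subgroup_def Setcompr_eq_image image_image c_def conj_map_def
        cong: image_cong)
  also have "\<dots> = (\<lambda>u. (\<chi> (c u), c u)) ` P" by (intro image_cong refl) (simp add: \<chi>c)
  also have "\<dots> = graph_subgroup (c ` P) \<chi>"
    by (simp add: graph_subgroup_def Setcompr_eq_image image_image)
  finally show ?thesis unfolding fusion_graphs_def using P' \<chi> by blast
qed

text \<open>
  Both sides of the stability equation are composites with transitive bisets, so their marks are marks
  of \<open>f\<close> itself; for \<open>id\<close> the subgroup \<open>D\<close> is not moved.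
\<close>
lemma right_stable_iff:
  fixes K :: "('k, 'n) monoid_scheme"
  assumes K: "finite_group K" and f: "f \<in> formal_sums p (K \<times>\<times> S)"
  shows "right_stable p S K F (burnside_rel p S K `` {f}) \<longleftrightarrow> stable_marks K S F (coords (K \<times>\<times> S) f)"
proof -
  note S = finite_group_S
  have gr: "group K" using K by (simp add: finite_group_def)
  let ?e = "\<lambda>P \<phi>. single (graph_class (subgrp S P) S P \<phi>) (1 :: rat)"
  have iff: "burnside_comp p (subgrp S P) S K (burnside_rel p S K `` {f}) (graph_elem p (subgrp S P) S P \<phi>)
      = burnside_comp p (subgrp S P) S K (burnside_rel p S K `` {f}) (graph_elem p (subgrp S P) S P id)
    \<longleftrightarrow> (\<forall>D. subgroup D (K \<times>\<times> S) \<longrightarrow> snd ` D \<subseteq> P \<longrightarrow>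
        marks_of (K \<times>\<times> S) (coords (K \<times>\<times> S) f) (map_prod id \<phi> ` D) = marks_of (K \<times>\<times> S) (coords (K \<times>\<times> S) f) D)"
    if P: "subgroup P S" and \<phi>: "\<phi> \<in> F P (carrier S)" for P \<phi>
  proof -
    let ?G = "subgrp S P"
    have G: "finite_group ?G" by (rule finite_group_subgroup[OF S P])
    have KG: "finite (carrier (K \<times>\<times> ?G))"
      using finite_group_DirProd[OF K G] by (simp only: finite_group_def)
    have id: "id \<in> hom ?G S" using subgroup.subset[OF P] by (auto simp: hom_def)
    note \<phi>' = F_mon(1)[OF P \<phi>]
    have triv: "subgroup {\<one>\<^bsub>K \<times>\<times> ?G\<^esub>} (K \<times>\<times> ?G)"
      using finite_group_DirProd[OF K G] by (intro group.triv_subgroup) (simp only: finite_group_def)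
    note e = marks_comp_graph_right(1)[OF prime_p S K P \<phi>' f triv]
      marks_comp_graph_right(1)[OF prime_p S K P id f triv]
    note m = marks_comp_graph_right(2)[OF prime_p S K P \<phi>' f]
      marks_comp_graph_right(2)[OF prime_p S K P id f]
    note cl = formal_comp_closed[OF prime_p G S K f e(1)] formal_comp_closed[OF prime_p G S K f e(2)]
    have "map_prod id id ` D = D" for D :: "('k \<times> 'a) set" by (simp add: map_prod.id)
    note m' = m(2)[unfolded this]
    show ?thesis
      unfolding graph_elem_def burnside_comp_class[OF prime_p G S K f e(1)]
        burnside_comp_class[OF prime_p G S K f e(2)] burnside_class_eq_iff[OF prime_p KG cl]
      by (simp only: m(1) m' cong: imp_cong,
          simp only: subgroup_DirProd_subgrp_iff[OF gr is_group P], blast)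
  qed
  show ?thesis
    unfolding right_stable_def stable_marks_def using burnside_classI[OF f]
    by (simp only: iff simp_thms cong: imp_cong) blast
qed

lemma left_stable_iff:
  fixes K :: "('k, 'n) monoid_scheme"
  assumes K: "finite_group K" and f: "f \<in> formal_sums p (S \<times>\<times> K)"
  shows "left_stable p K S F (burnside_rel p K S `` {f}) \<longleftrightarrow>
    stable_marks K S F (coords (S \<times>\<times> K) f \<circ> converse)"
proof -
  note S = finite_group_S
  have gr: "group K" using K by (simp add: finite_group_def)
  let ?a = "coords (S \<times>\<times> K) f \<circ> converse"
  let ?e = "\<lambda>P \<phi>. single (graph_class S (subgrp S P) (\<phi> ` P) (inv_into P \<phi>)) (1 :: rat)"
  have iff: "burnside_comp p K S (subgrp S P) (graph_elem p S (subgrp S P) (\<phi> ` P) (inv_into P \<phi>)) (burnside_rel p K S `` {f})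
      = burnside_comp p K S (subgrp S P) (graph_elem p S (subgrp S P) P id) (burnside_rel p K S `` {f})
    \<longleftrightarrow> (\<forall>D. subgroup D (K \<times>\<times> S) \<longrightarrow> snd ` D \<subseteq> P \<longrightarrow>
        marks_of (K \<times>\<times> S) ?a (map_prod id \<phi> ` D) = marks_of (K \<times>\<times> S) ?a D)"
    if P: "subgroup P S" and \<phi>: "\<phi> \<in> F P (carrier S)" for P \<phi>
  proof -
    let ?G = "subgrp S P"
    have G: "finite_group ?G" by (rule finite_group_subgroup[OF S P])
    have gG: "group ?G" using G by (simp only: finite_group_def)
    have GK: "finite (carrier (?G \<times>\<times> K))"
      using finite_group_DirProd[OF G K] by (simp only: finite_group_def)
    have id: "id \<in> hom ?G S" using subgroup.subset[OF P] by (auto simp: hom_def)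
    have idinv: "graph_elem p S ?G P id = graph_elem p S ?G (id ` P) (inv_into P id)"
    proof -
      have "graph_subgroup P id = graph_subgroup (id ` P) (inv_into P id)"
      proof -
        have "inv_into P id u = u" if "u \<in> P" for u using inv_into_f_f[OF inj_on_id that] by simp
        then show ?thesis by (auto simp: graph_subgroup_def)
      qed
      then show ?thesis by (simp only: graph_elem_def graph_class_def)
    qed
    note \<phi>' = F_mon(1)[OF P \<phi>] F_mon(2)[OF P \<phi>]
    have triv: "subgroup {\<one>\<^bsub>?G \<times>\<times> K\<^esub>} (?G \<times>\<times> K)"
      using finite_group_DirProd[OF G K] by (intro group.triv_subgroup) (simp only: finite_group_def)
    note e = marks_comp_graph_left(1)[OF prime_p S K P \<phi>' f triv]
      marks_comp_graph_left(1)[OF prime_p S K P id inj_on_id f triv]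
    note m = marks_comp_graph_left(2)[OF prime_p S K P \<phi>' f]
      marks_comp_graph_left(2)[OF prime_p S K P id inj_on_id f]
    note cl = formal_comp_closed[OF prime_p K S G e(1) f] formal_comp_closed[OF prime_p K S G e(2) f]
    have "map_prod id id ` (D\<inverse>) = D\<inverse>" for D :: "('a \<times> 'k) set" by (simp add: map_prod.id)
    note m' = m(2)[unfolded this]
    have conv: "(\<forall>D. subgroup D (?G \<times>\<times> K) \<longrightarrow> Q (D\<inverse>)) \<longleftrightarrow> (\<forall>D. subgroup D (K \<times>\<times> ?G) \<longrightarrow> Q D)" for Q
      using subgroup_converse[OF gG gr] subgroup_converse[OF gr gG] converse_converse by metis
    show ?thesis
      unfolding idinv unfolding graph_elem_def burnside_comp_class[OF prime_p K S G e(1) f]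
        burnside_comp_class[OF prime_p K S G e(2) f] burnside_class_eq_iff[OF prime_p GK cl]
      by (simp only: m(1) m' cong: imp_cong, subst conv,
          simp only: subgroup_DirProd_subgrp_iff[OF gr is_group P], blast)
  qed
  show ?thesis
    unfolding left_stable_def stable_marks_def using burnside_classI[OF f]
    by (simp only: iff simp_thms cong: imp_cong) blast
qed

text \<open>
  For fixed \<open>L\<close> and a graph \<open>R = \<Delta>(Q,\<chi>)\<close> with \<open>P \<subseteq> Q\<close>, where \<open>P\<close> is the second projection of \<open>D\<close>,
  exactly one \<open>\<psi> \<in> F(P,S)\<close> has its graph inside \<open>R\<close>, namely the restriction of \<open>\<chi>\<close>. So the weight of
  \<open>(L, R)\<close> is the number of \<open>\<psi>\<close> with \<open>(1 \<times> \<psi>)D \<subseteq> L\<close> and \<open>\<Delta>(P,\<psi>) \<subseteq> R\<close>, divided by \<open>|S|\<close>.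
\<close>
lemma comp_marks_generated:
  fixes K :: "('k, 'n) monoid_scheme"
  assumes K: "finite_group K" and D: "subgroup D (K \<times>\<times> S)"
    and supp: "\<And>R. \<lbrakk>subgroup R SS; b R \<noteq> 0\<rbrakk> \<Longrightarrow> R \<in> fusion_graphs S F"
  shows "comp_marks S S K a b D =
    (\<Sum>\<psi>\<in>F (snd ` D) (carrier S). marks_of (K \<times>\<times> S) a (map_prod id \<psi> ` D) *
      marks_of SS b (graph_subgroup (snd ` D) \<psi>)) / of_nat (order S)"
proof -
  let ?P = "snd ` D" and ?F = "F (snd ` D) (carrier S)"
  have gr: "group K" "finite (carrier (K \<times>\<times> S))" "finite (carrier SS)"
    using K finite_carrier by (auto simp: finite_group_def)
  have P: "subgroup ?P S" by (rule subgroup_snd_image[OF gr(1) is_group D])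
  have "comp_weight S S K D L R * a L * b R =
      (\<Sum>\<psi>\<in>?F. (if map_prod id \<psi> ` D \<subseteq> L then a L else 0) *
        (if graph_subgroup ?P \<psi> \<subseteq> R then b R else 0)) / of_nat (order S)"
    if L: "subgroup L (K \<times>\<times> S)" and R: "subgroup R SS" for L R
  proof (cases "b R = 0")
    case False
    then obtain Q \<chi> where Q: "R = graph_subgroup Q \<chi>" "subgroup Q S" "\<chi> \<in> F Q (carrier S)"
      using supp[OF R] unfolding fusion_graphs_def by blast
    have w: "comp_weight S S K D L R =
        (if ?P \<subseteq> Q \<and> map_prod id \<chi> ` D \<subseteq> L then 1 / of_nat (order S) else 0)"
      unfolding Q(1) by (rule comp_weight_graph[where \<phi> = \<chi>, OF finite_group_S L subgroup.one_closed[OF Q(2)] F_one[OF Q(2,3)]])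
    show ?thesis
    proof (cases "?P \<subseteq> Q")
      case True
      let ?\<psi> = "restrict \<chi> ?P"
      have \<psi>: "?\<psi> \<in> ?F" by (rule F_restrict[OF Q(2) P True Q(3)])
      have "graph_subgroup ?P \<psi> \<subseteq> R \<longleftrightarrow> \<psi> = ?\<psi>" if "\<psi> \<in> ?F" for \<psi>
      proof
        assume *: "graph_subgroup ?P \<psi> \<subseteq> R"
        show "\<psi> = ?\<psi>"
          using * F_mon(3)[OF P that] unfolding Q(1)
          by (intro extensionalityI[where A = ?P]) (auto simp: graph_subgroup_mem subset_iff)
      qed (use True in \<open>auto simp: Q(1) graph_subgroup_mem image_subset_iff\<close>)
      then have "(\<Sum>\<psi>\<in>?F. (if map_prod id \<psi> ` D \<subseteq> L then a L else 0) *
          (if graph_subgroup ?P \<psi> \<subseteq> R then b R else 0)) =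
          (\<Sum>\<psi>\<in>?F. if \<psi> = ?\<psi> then (if map_prod id ?\<psi> ` D \<subseteq> L then a L else 0) * b R else 0)"
        by (intro sum.cong refl) auto
      also have "\<dots> = (if map_prod id ?\<psi> ` D \<subseteq> L then a L else 0) * b R"
        using \<psi> F_finite[OF P] by simp
      also have "map_prod id ?\<psi> ` D = map_prod id \<chi> ` D"
        by (intro image_cong refl) (force simp: map_prod_def)
      finally have eq: "(\<Sum>\<psi>\<in>?F. (if map_prod id \<psi> ` D \<subseteq> L then a L else 0) *
          (if graph_subgroup ?P \<psi> \<subseteq> R then b R else 0)) =
          (if map_prod id \<chi> ` D \<subseteq> L then a L else 0) * b R" .
      show ?thesis unfolding eq w using True by simp
    next
      case False
      then have "\<not> graph_subgroup ?P \<psi> \<subseteq> R" for \<psi>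
        unfolding Q(1) by (auto simp: graph_subgroup_mem subset_iff)
      then show ?thesis using w False by simp
    qed
  qed (simp cong: if_cong)
  then have "comp_marks S S K a b D = (\<Sum>L | subgroup L (K \<times>\<times> S). \<Sum>R | subgroup R SS.
      (\<Sum>\<psi>\<in>?F. (if map_prod id \<psi> ` D \<subseteq> L then a L else 0) *
        (if graph_subgroup ?P \<psi> \<subseteq> R then b R else 0)) / of_nat (order S))"
    unfolding comp_marks_def by simp
  also have "\<dots> = (\<Sum>\<psi>\<in>?F. \<Sum>L | subgroup L (K \<times>\<times> S). \<Sum>R | subgroup R SS.
      (if map_prod id \<psi> ` D \<subseteq> L then a L else 0) *
        (if graph_subgroup ?P \<psi> \<subseteq> R then b R else 0)) / of_nat (order S)"
    unfolding sum_divide_distrib[symmetric]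
    by (rule arg_cong2[of _ _ _ _ "(/)"], rule trans[OF _ sum.swap], intro sum.cong refl,
        rule sum.swap, rule refl)
  finally show ?thesis
    by (simp add: marks_of_if[OF gr(2)] marks_of_if[OF gr(3)] sum_product)
qed

section \<open>Characteristic idempotents\<close>

text \<open>
  What the argument uses of a characteristic idempotent, phrased so that it is invariant under
  taking converses. The last condition replaces the invertibility of the augmentation.
\<close>
definition idempotent_coords :: "(('a \<times> 'a) set \<Rightarrow> rat) \<Rightarrow> bool"
  where "idempotent_coords c \<longleftrightarrow>
    (\<forall>R. subgroup R SS \<longrightarrow> c R \<noteq> 0 \<longrightarrow> R \<in> fusion_graphs S F) \<and>
    stable_marks S S F c \<and> stable_marks S S F (c \<circ> converse) \<and>
    (\<forall>D. subgroup D SS \<longrightarrow> comp_marks S S S c c D = marks_of SS c D) \<and>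
    (\<forall>P. subgroup P S \<longrightarrow> marks_of SS c (Id_on P) \<noteq> 0)"

lemma Id_on_subgroup:
  assumes "subgroup P S" shows "subgroup (Id_on P) SS"
proof -
  have "id \<in> hom (subgrp S P) S" using subgroup.subset[OF assms] by (auto simp: hom_def)
  moreover have "Id_on P = graph_subgroup P id" by (auto simp: graph_subgroup_def)
  ultimately show ?thesis using subgroup_graph[OF is_group is_group assms, of id] by simp
qed

lemma idempotent_coords_converse:
  assumes "idempotent_coords c" shows "idempotent_coords (c \<circ> converse)"
proof -
  note c = assms[unfolded idempotent_coords_def]
  note S = finite_group_S
  have [simp]: "c \<circ> converse \<circ> converse = c" by (simp add: fun_eq_iff)
  have conv: "subgroup (R\<inverse>) SS" if "subgroup R SS" for R
    by (rule subgroup_converse[OF is_group is_group that])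
  have "R \<in> fusion_graphs S F" if "subgroup R SS" "c (R\<inverse>) \<noteq> 0" for R
    using c conv[OF that(1)] that(2) fusion_graphs_converse[of "R\<inverse>"] by auto
  moreover have "comp_marks S S S (c \<circ> converse) (c \<circ> converse) D = marks_of SS (c \<circ> converse) D"
    if "subgroup D SS" for D
    using comp_marks_converse[OF S S S, of c c "D\<inverse>"] marks_of_converse[OF S S, of c "D\<inverse>"]
      c conv[OF that] by simp
  moreover have "marks_of SS (c \<circ> converse) (Id_on P) \<noteq> 0" if "subgroup P S" for P
  proof -
    have "marks_of SS c (Id_on P) \<noteq> 0" using c that by blast
    then show ?thesis using marks_of_converse[OF S S, of c "Id_on P"] by simp
  qed
  ultimately show ?thesis unfolding idempotent_coords_def using c by simp
qed

text \<open>
  The graph of \<open>\<psi>\<close> is the image of the diagonal of \<open>P\<close> under \<open>\<psi>\<close> in the first component, so left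
  stability applies.
\<close>
lemma marks_graph_Id_on:
  assumes st: "stable_marks S S F (c \<circ> converse)" and P: "subgroup P S" and \<psi>: "\<psi> \<in> F P (carrier S)"
  shows "marks_of SS c (graph_subgroup P \<psi>) = marks_of SS c (Id_on P)"
proof -
  note S = finite_group_S
  have "(graph_subgroup P \<psi>)\<inverse> = map_prod id \<psi> ` Id_on P" by (force simp: graph_subgroup_def)
  moreover have "marks_of SS (c \<circ> converse) (map_prod id \<psi> ` Id_on P) =
      marks_of SS (c \<circ> converse) (Id_on P)"
    by (rule st[unfolded stable_marks_def, rule_format, OF P \<psi> Id_on_subgroup[OF P]]) auto
  ultimately show ?thesis
    using marks_of_converse[OF S S, of c "graph_subgroup P \<psi>"] marks_of_converse[OF S S, of c "Id_on P"]
    by simp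
qed

text \<open>The scalar \<open>\<lambda> = m k / s\<close> of a nonzero idempotent is \<open>1\<close>.\<close>
lemma idempotent_scalar:
  fixes m s k :: rat
  assumes "m = m / s * (k * m)" "m \<noteq> 0" shows "m / s = 1 / k"
proof -
  have "m * (m / s * k) = m * 1" using assms(1) by (metis mult.assoc mult.commute mult.right_neutral)
  then have "m / s * k = 1" using assms(2) by (metis mult_left_cancel)
  then show ?thesis by (metis div_by_1 eq_divide_eq mult_zero_right zero_neq_one)
qed

text \<open>
  The average is taken over morphisms and not over the class of \<open>D\<close>, since this is the form in which
  averages for two fusion systems can be nested.
\<close>
definition fusion_average :: "(('k \<times> 'a) set \<Rightarrow> rat) \<Rightarrow> ('k \<times> 'a) set \<Rightarrow> rat"
  where "fusion_average m D =
    (\<Sum>\<psi>\<in>F (snd ` D) (carrier S). m (map_prod id \<psi> ` D)) / of_nat (card (F (snd ` D) (carrier S)))"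

lemma sum_F_precompose:
  assumes P: "subgroup P S" and \<phi>: "\<phi> \<in> F P (carrier S)"
  shows "(\<Sum>\<psi>\<in>F (\<phi> ` P) (carrier S). g (compose P \<psi> \<phi>)) = (\<Sum>\<psi>\<in>F P (carrier S). g \<psi> :: rat)"
proof -
  define \<theta> where "\<theta> = restrict (inv_into P \<phi>) (\<phi> ` P)"
  note P' = F_image_subgroup[OF P \<phi>]
  have \<theta>: "\<theta> \<in> F (\<phi> ` P) (carrier S)" unfolding \<theta>_def by (rule F_inverse[OF P \<phi>])
  have \<theta>\<phi>: "\<theta> (\<phi> u) = u" if "u \<in> P" for u
    using F_mon(2)[OF P \<phi>] that by (simp add: \<theta>_def)
  show ?thesis
  proof (rule sum.reindex_bij_witness[where j = "\<lambda>\<psi>. compose P \<psi> \<phi>" and i = "\<lambda>\<chi>. compose (\<phi> ` P) \<chi> \<theta>"])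
    fix \<psi> assume \<psi>: "\<psi> \<in> F (\<phi> ` P) (carrier S)"
    show "compose P \<psi> \<phi> \<in> F P (carrier S)" by (rule F_compose[OF P P' \<phi> order.refl \<psi>])
    show "compose (\<phi> ` P) (compose P \<psi> \<phi>) \<theta> = \<psi>"
      using F_mon(3)[OF P' \<psi>]
      by (intro extensionalityI[where A = "\<phi> ` P"]) (auto simp: compose_def \<theta>\<phi>)
  next
    fix \<chi> assume \<chi>: "\<chi> \<in> F P (carrier S)"
    show "compose (\<phi> ` P) \<chi> \<theta> \<in> F (\<phi> ` P) (carrier S)"
      by (rule F_compose[OF P' P \<theta> _ \<chi>]) (auto simp: \<theta>\<phi>)
    show "compose P (compose (\<phi> ` P) \<chi> \<theta>) \<phi> = \<chi>"
      using F_mon(3)[OF P \<chi>]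
      by (intro extensionalityI[where A = P]) (auto simp: compose_def \<theta>\<phi>)
  qed simp
qed

lemma fusion_average_invariant:
  assumes D: "subgroup (snd ` D) S" and P: "subgroup P S" and \<phi>: "\<phi> \<in> F P (carrier S)" and DP: "snd ` D \<subseteq> P"
  shows "fusion_average m (map_prod id \<phi> ` D) = fusion_average m D"
proof -
  let ?P = "snd ` D"
  define \<phi>' where "\<phi>' = restrict \<phi> ?P"
  have \<phi>': "\<phi>' \<in> F ?P (carrier S)" unfolding \<phi>'_def by (rule F_restrict[OF P D DP \<phi>])
  have D': "snd ` map_prod id \<phi> ` D = \<phi>' ` ?P"
    unfolding image_image by (intro image_cong refl) (auto simp: \<phi>'_def)
  have im: "map_prod id \<psi> ` map_prod id \<phi> ` D = map_prod id (compose ?P \<psi> \<phi>') ` D" for \<psi>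
    unfolding image_image by (intro image_cong refl) (force simp: compose_def \<phi>'_def)
  have "card (F (\<phi>' ` ?P) (carrier S)) = card (F ?P (carrier S))"
    using sum_F_precompose[OF D \<phi>', of "\<lambda>_. 1"] by simp
  then show ?thesis
    unfolding fusion_average_def D' im
    using sum_F_precompose[OF D \<phi>', of "\<lambda>\<chi>. m (map_prod id \<chi> ` D)"] by simp
qed

text \<open>
  By left stability the composite is a multiple of the average, with a factor that does not depend on
  \<open>a\<close>. Evaluating at \<open>a = c\<close> and the diagonal of the second projection of \<open>D\<close>, where idempotency
  gives the composite and right stability the average, determines the factor.
\<close>
lemma comp_marks_idempotent:
  fixes K :: "('k, 'n) monoid_scheme"
  assumes c: "idempotent_coords c" and K: "finite_group K" and D: "subgroup D (K \<times>\<times> S)"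
  shows "comp_marks S S K a c D = fusion_average (marks_of (K \<times>\<times> S) a) D"
proof -
  note c = c[unfolded idempotent_coords_def]
  note S = finite_group_S
  let ?P = "snd ` D" let ?F = "F ?P (carrier S)" let ?m = "marks_of SS c (Id_on ?P)"
  have P: "subgroup ?P S" by (rule subgroup_snd_image[OF _ is_group D]) (use K in \<open>simp add: finite_group_def\<close>)
  note I = Id_on_subgroup[OF P]
  have formula: "comp_marks S S K' b c D' =
      ?m / of_nat (order S) * (\<Sum>\<psi>\<in>?F. marks_of (K' \<times>\<times> S) b (map_prod id \<psi> ` D'))"
    if "finite_group K'" "subgroup D' (K' \<times>\<times> S)" "snd ` D' = ?P"
    for K' :: "('l, 'o) monoid_scheme" and b D'
  proof -
    have "comp_marks S S K' b c D' = (\<Sum>\<psi>\<in>?F. marks_of (K' \<times>\<times> S) b (map_prod id \<psi> ` D') * ?m) / of_nat (order S)"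
      unfolding that(3)[symmetric]
      by (subst comp_marks_generated[OF that(1,2)])
        (use c marks_graph_Id_on[OF _ P] in \<open>auto simp: that(3)\<close>)
    then show ?thesis by (simp add: sum_distrib_left sum_divide_distrib mult_ac)
  qed
  have "?m = comp_marks S S S c c (Id_on ?P)" using c I by simp
  also have "\<dots> = ?m / of_nat (order S) * (\<Sum>\<psi>\<in>?F. marks_of SS c (map_prod id \<psi> ` Id_on ?P))"
    by (rule formula[OF S I]) force
  also have "(\<Sum>\<psi>\<in>?F. marks_of SS c (map_prod id \<psi> ` Id_on ?P)) = (\<Sum>\<psi>\<in>?F. ?m)"
  proof (intro sum.cong refl)
    fix \<psi> assume \<psi>: "\<psi> \<in> ?F"
    have st: "stable_marks S S F c" using c by blast
    show "marks_of SS c (map_prod id \<psi> ` Id_on ?P) = ?m"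
      by (rule st[unfolded stable_marks_def, rule_format, OF P \<psi> I]) force
  qed
  finally have "?m = ?m / of_nat (order S) * (of_nat (card ?F) * ?m)"
    by (simp only: sum_constant)
  moreover have "?m \<noteq> 0" using c P by blast
  ultimately have "?m / of_nat (order S) = 1 / of_nat (card ?F)"
    by (rule idempotent_scalar)
  then show ?thesis using formula[OF K D refl, of a] by (simp add: fusion_average_def)
qed

text \<open>
  A point of \<open>[P, \<phi>]\<close> has as stabilizer a conjugate of \<open>\<Delta>(P,\<phi>)\<close>, which is the graph of a composite of
  \<open>\<phi>\<close> with two conjugation maps.
\<close>
lemma generated_coords_support:
  assumes I: "finite I" "I \<subseteq> {(P, \<phi>). subgroup P S \<and> \<phi> \<in> F P (carrier S)}"
    and R: "coords SS (\<Sum>(P, \<phi>)\<in>I. single (graph_class S S P \<phi>) (r (P, \<phi>))) R \<noteq> 0"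
  shows "R \<in> fusion_graphs S F"
proof -
  note grSS = finite_group_DirProd[OF finite_group_S finite_group_S]
  have "(\<Sum>i\<in>I. coords SS (case i of (P, \<phi>) \<Rightarrow>
      single (graph_class S S P \<phi>) (r (P, \<phi>))) R) \<noteq> 0"
    using R unfolding coords_def linear_ext_sum .
  then obtain i where i: "i \<in> I" "coords SS (case i of (P, \<phi>) \<Rightarrow>
      single (graph_class S S P \<phi>) (r (P, \<phi>))) R \<noteq> 0"
    by (rule sum.not_neutral_contains_not_neutral)
  obtain P \<phi> where P\<phi>: "i = (P, \<phi>)" by fastforce
  then have P: "subgroup P S" and \<phi>: "\<phi> \<in> F P (carrier S)" using I(2) i(1) by auto
  have graph: "subgroup (graph_subgroup P \<phi>) SS"
    by (rule subgroup_graph[OF is_group is_group P F_mon(1)[OF P \<phi>]])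
  have X: "finite_gset SS (coset_gset SS (graph_subgroup P \<phi>))"
    by (rule coset_gset_finite_gset[OF _ _ graph]) (use grSS in \<open>simp_all add: finite_group_def\<close>)
  have "stab_count SS (coset_gset SS (graph_subgroup P \<phi>)) R \<noteq> 0"
    using i(2) unfolding P\<phi> prod.case graph_class_def coords_single[OF X] by simp
  from coset_gset_stab_conj[OF grSS graph this]
  obtain s t where "s \<in> carrier S" "t \<in> carrier S" "R = conj_set SS (s, t) (graph_subgroup P \<phi>)"
    by auto
  then show ?thesis using fusion_graphs_conj[OF P \<phi>] by simp
qed

lemma augmentation_class:
  assumes f: "f \<in> formal_sums p SS"
  shows "augmentation S (burnside_rel p S S `` {f}) = formal_mark {\<one>\<^bsub>SS\<^esub>} f / of_nat (order S)"
proof -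
  note grSS = finite_group_DirProd[OF finite_group_S finite_group_S]
  then have fin: "finite (carrier SS)" and grp: "group SS" by (simp_all only: finite_group_def)
  have T: "subgroup {\<one>\<^bsub>SS\<^esub>} SS" by (rule group.triv_subgroup[OF grp])
  let ?A = "\<lambda>g. \<Sum>C\<in>keys g.
      lookup g C * (of_nat (card (fst (rep C))) / of_nat (order S))"
  have A: "?A g = formal_mark {\<one>\<^bsub>SS\<^esub>} g / of_nat (order S)" if g: "g \<in> formal_sums p SS" for g
  proof -
    have "fixed_points {\<one>\<^bsub>SS\<^esub>} (rep C) = fst (rep C)" if "C \<in> keys g" for C
      using gset_one[OF formal_sums_keysD(2)[OF g that]] by (auto simp: fixed_points_def)
    then show ?thesis unfolding formal_mark_def sum_divide_distrib by (intro sum.cong refl) simp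
  qed
  have "augmentation S (burnside_rel p S S `` {f}) = ?A f"
    unfolding augmentation_def
  proof (rule the_elem_image_const[OF burnside_class_self[OF f]])
    fix g assume "g \<in> burnside_rel p S S `` {f}"
    then have g: "g \<in> formal_sums p SS" and
      eq: "marks_of SS (coords SS f) {\<one>\<^bsub>SS\<^esub>} = marks_of SS (coords SS g) {\<one>\<^bsub>SS\<^esub>}"
      using burnside_rel_class_eq[OF prime_p fin f] T by auto
    show "?A g = ?A f"
      unfolding A[OF g] A[OF f] formal_mark_eq_marks_of[OF g fin subgroup.subset[OF T]]
        formal_mark_eq_marks_of[OF f fin subgroup.subset[OF T]] eq ..
  qed
  then show ?thesis using A[OF f] by simp
qed

text \<open>
  The composite of the one-point biset with \<open>f\<close> has at \<open>1 \<times> P\<close> a mark that is a multiple of the mark of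
  \<open>f\<close> at the diagonal of \<open>P\<close>, and at the trivial subgroup the augmentation of \<open>f\<close>. As \<open>P\<close> is a
  \<open>p\<close>-group, the two agree modulo \<open>p\<close>; if the former were zero, the augmentation would be a
  multiple of \<open>p\<close>.
\<close>
lemma characteristic_marks_nonzero:
  assumes f: "f \<in> formal_sums p SS"
    and supp: "\<And>R. \<lbrakk>subgroup R SS; coords SS f R \<noteq> 0\<rbrakk> \<Longrightarrow> R \<in> fusion_graphs S F"
    and st: "stable_marks S S F (coords SS f \<circ> converse)"
    and aug: "u \<in> Z_loc p" "formal_mark {\<one>\<^bsub>SS\<^esub>} f / of_nat (order S) * u = 1"
    and P: "subgroup P S"
  shows "marks_of SS (coords SS f) (Id_on P) \<noteq> 0"
proof
  let ?K = SS let ?c = "coords ?K f"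
  assume zero: "marks_of ?K ?c (Id_on P) = 0"
  note S = finite_group_S and grSS = finite_group_DirProd[OF finite_group_S finite_group_S]
  from grSS have fin: "finite (carrier ?K)" and grp: "group ?K" by (simp_all only: finite_group_def)
  \<comment> \<open>the one-point biset, all of whose marks are \<open>1\<close>\<close>
  define pt :: "('a \<times> 'a, nat) gset" where "pt = ({0}, \<lambda>_. \<lambda>x\<in>{0}. 0)"
  have pt: "finite_gset ?K pt"
    by (rule finite_gsetI[OF grp]) (auto simp: pt_def)
  let ?e = "single (iso_class ?K pt) (1 :: rat)"
  have e: "?e \<in> formal_sums p ?K"
    by (intro formal_sums_single prime_p iso_class_in_gset_classes pt)
      (use Z_loc_of_int[OF prime_p, of 1] in simp)
  have mpt: "marks_of ?K (coords ?K ?e) E = 1" if "E \<subseteq> carrier ?K" for E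
  proof -
    have "fixed_points E pt = {0}" by (auto simp: fixed_points_def pt_def)
    then show ?thesis
      using card_fixed_points[OF pt fin that] unfolding marks_of_def coords_single[OF pt] by simp
  qed
  let ?h = "formal_comp S S S ?e f"
  have h: "?h \<in> formal_sums p ?K" by (rule formal_comp_closed[OF prime_p S S S e f])
  have marks: "formal_mark D ?h = (\<Sum>\<psi>\<in>F (snd ` D) (carrier S).
      marks_of ?K ?c (Id_on (snd ` D))) / of_nat (order S)" if D: "subgroup D ?K" for D
  proof -
    note P' = subgroup_snd_image[OF is_group is_group D]
    have "formal_mark D ?h = comp_marks S S S (coords ?K ?e) ?c D"
      using formal_mark_eq_marks_of[OF h fin subgroup.subset[OF D]]
        marks_formal_comp[OF prime_p S S S e f subgroup.subset[OF D]] by simp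
    also have "\<dots> = (\<Sum>\<psi>\<in>F (snd ` D) (carrier S). marks_of ?K (coords ?K ?e) (map_prod id \<psi> ` D) *
        marks_of ?K ?c (graph_subgroup (snd ` D) \<psi>)) / of_nat (order S)"
      by (rule comp_marks_generated[OF S D supp])
    also have "\<dots> = (\<Sum>\<psi>\<in>F (snd ` D) (carrier S). marks_of ?K ?c (Id_on (snd ` D))) / of_nat (order S)"
    proof (intro arg_cong2[of _ _ _ _ "(/)"] sum.cong refl)
      fix \<psi> assume \<psi>: "\<psi> \<in> F (snd ` D) (carrier S)"
      have "map_prod id \<psi> ` D \<subseteq> carrier ?K"
        using F_closed[OF P' \<psi>] subgroup.subset[OF D] by force
      then show "marks_of ?K (coords ?K ?e) (map_prod id \<psi> ` D) *
          marks_of ?K ?c (graph_subgroup (snd ` D) \<psi>) = marks_of ?K ?c (Id_on (snd ` D))"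
        using mpt marks_graph_Id_on[OF st P' \<psi>] by simp
    qed
    finally show ?thesis .
  qed
  let ?D = "{\<one>} \<times> P"
  have D: "subgroup ?D ?K"
    by (rule DirProd_subgroups[OF is_group triv_subgroup is_group P])
  have T: "subgroup {\<one>\<^bsub>?K\<^esub>} ?K" by (rule group.triv_subgroup[OF grp])
  have "formal_mark ?D ?h = 0" using marks[OF D] zero by simp
  moreover have "formal_mark {\<one>\<^bsub>?K\<^esub>} ?h = formal_mark {\<one>\<^bsub>?K\<^esub>} f / of_nat (order S)"
  proof -
    have "Id_on (snd ` {\<one>\<^bsub>?K\<^esub>}) = {\<one>\<^bsub>?K\<^esub>}" "snd ` {\<one>\<^bsub>?K\<^esub>} = {\<one>}" by auto
    then show ?thesis
      unfolding marks[OF T] formal_mark_eq_marks_of[OF f fin subgroup.subset[OF T]]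
      by (simp add: F_trivial)
  qed
  moreover obtain n where "card ?D = p ^ n"
  proof -
    obtain k where k: "order S = p ^ k" using order_prime_power by blast
    have "card P dvd p ^ k" using lagrange[OF P] k by (metis dvd_triv_right)
    then obtain i where "card P = p ^ i" using divides_primepow_nat[OF prime_p] by blast
    then show ?thesis by (intro that[of i]) (simp add: card_cartesian_product)
  qed
  from formal_mark_mod_p[OF prime_p h D this]
  obtain z where "z \<in> Z_loc p" "formal_mark {\<one>\<^bsub>?K\<^esub>} ?h - formal_mark ?D ?h = of_nat p * z" by blast
  ultimately have "of_nat p * z * u = 1" "z * u \<in> Z_loc p"
    using aug Z_loc_mult[OF prime_p] by auto
  then show False using unit_not_p_multiple[OF prime_p, of "z * u"] by (simp add: mult.assoc)
qed

lemma characteristic_idempotent_coords: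
  assumes \<omega>: "characteristic_idempotent p S F \<omega>"
  obtains f where "f \<in> formal_sums p SS" "\<omega> = burnside_rel p S S `` {f}"
    "idempotent_coords (coords SS f)"
proof -
  note S = finite_group_S and grSS = finite_group_DirProd[OF finite_group_S finite_group_S]
  from grSS have fin: "finite (carrier SS)" and grp: "group SS" by (simp_all only: finite_group_def)
  obtain I r where I: "finite I" "I \<subseteq> {(P, \<phi>). subgroup P S \<and> \<phi> \<in> F P (carrier S)}" "r ` I \<subseteq> Z_loc p"
      "\<omega> = burnside_rel p S S `` {\<Sum>(P, \<phi>)\<in>I. single (graph_class S S P \<phi>) (r (P, \<phi>))}"
    using \<omega> unfolding characteristic_idempotent_def characteristic_def generated_def by blast
  define f where "f = (\<Sum>(P, \<phi>)\<in>I. single (graph_class S S P \<phi>) (r (P, \<phi>)))"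
  have \<omega>f: "\<omega> = burnside_rel p S S `` {f}" using I(4) by (simp add: f_def)
  have f: "f \<in> formal_sums p SS"
    unfolding f_def
  proof (intro formal_sums_sum prime_p)
    fix i assume i: "i \<in> I"
    obtain P \<phi> where P\<phi>: "i = (P, \<phi>)" by fastforce
    then have P: "subgroup P S" and \<phi>: "\<phi> \<in> F P (carrier S)" and r: "r (P, \<phi>) \<in> Z_loc p"
      using I(2,3) i by auto
    have "graph_class S S P \<phi> \<in> gset_classes SS"
      unfolding graph_class_def
      by (intro iso_class_in_gset_classes coset_gset_finite_gset grp fin
          subgroup_graph is_group P F_mon(1)[OF P \<phi>])
    then show "(case i of (P, \<phi>) \<Rightarrow> single (graph_class S S P \<phi>) (r (P, \<phi>))) \<in> formal_sums p SS"
      unfolding P\<phi> prod.case using r by (intro formal_sums_single prime_p)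
  qed
  have supp: "R \<in> fusion_graphs S F" if "coords SS f R \<noteq> 0" for R
    using generated_coords_support[OF I(1,2)] that unfolding f_def by blast
  have "left_stable p S S F \<omega>" "right_stable p S S F \<omega>"
    using \<omega> unfolding characteristic_idempotent_def characteristic_def by auto
  then have st: "stable_marks S S F (coords SS f)" "stable_marks S S F (coords SS f \<circ> converse)"
    unfolding \<omega>f left_stable_iff[OF S f] right_stable_iff[OF S f] by auto
  obtain u where u: "u \<in> Z_loc p" "augmentation S \<omega> * u = 1"
    using \<omega> unfolding characteristic_idempotent_def characteristic_def by blast
  have "burnside_rel p S S `` {formal_comp S S S f f} = burnside_rel p S S `` {f}"
    using \<omega> burnside_comp_class[OF prime_p S S S f f]
    unfolding characteristic_idempotent_def \<omega>f by simp
  then have "comp_marks S S S (coords SS f) (coords SS f) D = marks_of SS (coords SS f) D"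
    if "subgroup D SS" for D
    using burnside_class_eq_iff[OF prime_p fin formal_comp_closed[OF prime_p S S S f f] f] that
      marks_formal_comp[OF prime_p S S S f f subgroup.subset[OF that]] by simp
  moreover have "marks_of SS (coords SS f) (Id_on P) \<noteq> 0" if "subgroup P S" for P
    using characteristic_marks_nonzero[OF f supp st(2) u(1) _ that] u(2)
    unfolding \<omega>f augmentation_class[OF f] by simp
  ultimately have "idempotent_coords (coords SS f)"
    unfolding idempotent_coords_def using supp st by blast
  then show ?thesis using that f \<omega>f by blast
qed

end

section \<open>The product of two fusion systems\<close>

context
  fixes p :: nat
    and S1 :: "('a, 'm) monoid_scheme" and S2 :: "('b, 'n) monoid_scheme"
    and F1 :: "'a set \<Rightarrow> 'a set \<Rightarrow> ('a \<Rightarrow> 'a) set"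
    and F2 :: "'b set \<Rightarrow> 'b set \<Rightarrow> ('b \<Rightarrow> 'b) set"
  assumes fusion: "fusion_system p S1 F1" "fusion_system p S2 F2"
begin

interpretation F1: fusion_system p S1 F1 by (rule fusion(1))
interpretation F2: fusion_system p S2 F2 by (rule fusion(2))

private abbreviation "E1 D \<equiv> F1 (snd ` D) (carrier S1)"
private abbreviation "E2 D \<equiv> F2 (fst ` D) (carrier S2)"

context
  fixes D :: "('b \<times> 'a) set"
  assumes D: "subgroup D (S2 \<times>\<times> S1)"
begin

lemma projection_subgroups: "subgroup (snd ` D) S1" "subgroup (fst ` D) S2"
  using subgroup_snd_image[OF F2.is_group F1.is_group D] subgroup_fst_image[OF F2.is_group F1.is_group D]
  by auto

lemma map_prod_hom:
  assumes "\<phi>1 \<in> E1 D" "\<phi>2 \<in> E2 D"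
  shows "group_hom (subgrp (S2 \<times>\<times> S1) D) (S2 \<times>\<times> S1) (map_prod \<phi>2 \<phi>1)"
proof -
  have grp: "group (S2 \<times>\<times> S1)" using DirProd_group[OF F2.is_group F1.is_group] .
  have mem: "fst d \<in> fst ` D" "snd d \<in> snd ` D" if "d \<in> D" for d using that by auto
  have "map_prod \<phi>2 \<phi>1 (d \<otimes>\<^bsub>S2 \<times>\<times> S1\<^esub> e) = map_prod \<phi>2 \<phi>1 d \<otimes>\<^bsub>S2 \<times>\<times> S1\<^esub> map_prod \<phi>2 \<phi>1 e"
    if "d \<in> D" "e \<in> D" for d e
    using F1.F_mult[OF projection_subgroups(1) assms(1) mem(2)[OF that(1)] mem(2)[OF that(2)]]
      F2.F_mult[OF projection_subgroups(2) assms(2) mem(1)[OF that(1)] mem(1)[OF that(2)]]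
    by (cases d; cases e) simp
  moreover have "map_prod \<phi>2 \<phi>1 d \<in> carrier (S2 \<times>\<times> S1)" if "d \<in> D" for d
    using F1.F_closed[OF projection_subgroups(1) assms(1)] F2.F_closed[OF projection_subgroups(2) assms(2)] mem[OF that]
    by (cases d) simp
  ultimately show ?thesis
    using subgroup.subgroup_is_group[OF D grp] grp
    by (simp add: group_hom_def group_hom_axioms_def hom_def)
qed

lemma map_prod_subgroup:
  assumes "\<phi>1 \<in> E1 D" "\<phi>2 \<in> E2 D" shows "subgroup (map_prod \<phi>2 \<phi>1 ` D) (S2 \<times>\<times> S1)"
  using group_hom.img_is_subgroup[OF map_prod_hom[OF assms]] by simp

lemma map_prod_projections:
  "snd ` map_prod \<phi>2 \<phi>1 ` D = \<phi>1 ` snd ` D" "fst ` map_prod \<phi>2 \<phi>1 ` D = \<phi>2 ` fst ` D"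
  by (simp_all add: image_image)

lemma map_prod_inverse:
  assumes "\<phi>1 \<in> E1 D" "\<phi>2 \<in> E2 D"
  obtains \<psi>1 \<psi>2 where "\<psi>1 \<in> E1 (map_prod \<phi>2 \<phi>1 ` D)" "\<psi>2 \<in> E2 (map_prod \<phi>2 \<phi>1 ` D)"
    "\<And>u. u \<in> snd ` D \<Longrightarrow> \<psi>1 (\<phi>1 u) = u" "\<And>u. u \<in> fst ` D \<Longrightarrow> \<psi>2 (\<phi>2 u) = u"
proof (rule that)
  show "restrict (inv_into (snd ` D) \<phi>1) (\<phi>1 ` snd ` D) \<in> E1 (map_prod \<phi>2 \<phi>1 ` D)"
    unfolding map_prod_projections by (rule F1.F_inverse[OF projection_subgroups(1) assms(1)])
  show "restrict (inv_into (fst ` D) \<phi>2) (\<phi>2 ` fst ` D) \<in> E2 (map_prod \<phi>2 \<phi>1 ` D)"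
    unfolding map_prod_projections by (rule F2.F_inverse[OF projection_subgroups(2) assms(2)])
  show "restrict (inv_into (snd ` D) \<phi>1) (\<phi>1 ` snd ` D) (\<phi>1 u) = u" if "u \<in> snd ` D" for u
    unfolding restrict_apply'[OF imageI[OF that]]
    by (rule inv_into_f_f[OF F1.F_mon(2)[OF projection_subgroups(1) assms(1)] that])
  show "restrict (inv_into (fst ` D) \<phi>2) (\<phi>2 ` fst ` D) (\<phi>2 u) = u" if "u \<in> fst ` D" for u
    unfolding restrict_apply'[OF imageI[OF that]]
    by (rule inv_into_f_f[OF F2.F_mon(2)[OF projection_subgroups(2) assms(2)] that])
qed

end

lemma map_prod_id_subgroup:
  assumes D: "subgroup D (S2 \<times>\<times> S1)" and P: "subgroup P S1" "\<phi> \<in> F1 P (carrier S1)" "snd ` D \<subseteq> P"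
  shows "subgroup (map_prod id \<phi> ` D) (S2 \<times>\<times> S1)"
proof -
  note pr = projection_subgroups[OF D]
  have "map_prod (\<lambda>b\<in>fst ` D. b) (restrict \<phi> (snd ` D)) ` D = map_prod id \<phi> ` D"
    by (intro image_cong refl) force
  from map_prod_subgroup[OF D F1.F_restrict[OF P(1) pr(1) P(3,2)]
      F2.F_inclusion[OF pr(2) F2.subgroup_self subgroup.subset[OF pr(2)]], unfolded this]
  show ?thesis .
qed

lemma restrict_map_prod_in_product_fusion:
  assumes D: "subgroup D (S2 \<times>\<times> S1)" and \<phi>: "\<phi>1 \<in> E1 D" "\<phi>2 \<in> E2 D"
    and C: "map_prod \<phi>2 \<phi>1 ` D \<subseteq> C"
  shows "restrict (map_prod \<phi>2 \<phi>1) D \<in> product_fusion S2 F2 S1 F1 D C"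
proof -
  interpret group_hom "subgrp (S2 \<times>\<times> S1) D" "S2 \<times>\<times> S1" "map_prod \<phi>2 \<phi>1"
    by (rule map_prod_hom[OF D \<phi>])
  have "restrict (map_prod \<phi>2 \<phi>1) D \<in> hom (subgrp (S2 \<times>\<times> S1) D) (subgrp (S2 \<times>\<times> S1) C)"
    using C hom_mult subgroup.m_closed[OF D] by (auto simp: hom_def)
  then show ?thesis
    unfolding product_fusion_def using \<phi> by auto
qed

text \<open>
  A morphism in the product is determined by its two components, and the inverse components provide
  the inverse, so the class consists of the images of \<open>D\<close> under pairs of morphisms.
\<close>
lemma fusion_class_product:
  assumes D: "subgroup D (S2 \<times>\<times> S1)"
  shows "fusion_class (S2 \<times>\<times> S1) (product_fusion S2 F2 S1 F1) D =
    (\<lambda>(\<phi>1, \<phi>2). map_prod \<phi>2 \<phi>1 ` D) ` (E1 D \<times> E2 D)"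
proof (intro equalityI subsetI)
  fix Q assume "Q \<in> fusion_class (S2 \<times>\<times> S1) (product_fusion S2 F2 S1 F1) D"
  then obtain \<phi> \<psi> where \<phi>: "\<phi> \<in> product_fusion S2 F2 S1 F1 D Q" and \<psi>: "\<psi> \<in> product_fusion S2 F2 S1 F1 Q D"
      and inv: "\<And>v. v \<in> Q \<Longrightarrow> \<phi> (\<psi> v) = v"
    unfolding fusion_class_def by blast
  obtain \<phi>1 \<phi>2 where \<phi>': "\<phi>1 \<in> E1 D" "\<phi>2 \<in> E2 D" "\<And>d. d \<in> D \<Longrightarrow> \<phi> d = map_prod \<phi>2 \<phi>1 d"
    using \<phi> unfolding product_fusion_def by (fastforce simp: split_beta map_prod_def)
  have "\<phi> ` D \<subseteq> Q" "\<psi> ` Q \<subseteq> D" using \<phi> \<psi> by (auto simp: product_fusion_def hom_def)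
  then have "Q = \<phi> ` D" using inv by force
  also have "\<dots> = map_prod \<phi>2 \<phi>1 ` D" using \<phi>'(3) by (intro image_cong refl)
  finally show "Q \<in> (\<lambda>(\<phi>1, \<phi>2). map_prod \<phi>2 \<phi>1 ` D) ` (E1 D \<times> E2 D)" using \<phi>'(1,2) by auto
next
  fix Q assume "Q \<in> (\<lambda>(\<phi>1, \<phi>2). map_prod \<phi>2 \<phi>1 ` D) ` (E1 D \<times> E2 D)"
  then obtain \<phi>1 \<phi>2 where \<phi>: "\<phi>1 \<in> E1 D" "\<phi>2 \<in> E2 D" and Q: "Q = map_prod \<phi>2 \<phi>1 ` D" by auto
  have Qsub: "subgroup Q (S2 \<times>\<times> S1)" unfolding Q by (rule map_prod_subgroup[OF D \<phi>])
  obtain \<psi>1 \<psi>2 where \<psi>: "\<psi>1 \<in> E1 Q" "\<psi>2 \<in> E2 Q"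
    and inv: "\<And>u. u \<in> snd ` D \<Longrightarrow> \<psi>1 (\<phi>1 u) = u" "\<And>u. u \<in> fst ` D \<Longrightarrow> \<psi>2 (\<phi>2 u) = u"
    using map_prod_inverse[OF D \<phi>] unfolding Q by metis
  have inv': "map_prod \<psi>2 \<psi>1 (map_prod \<phi>2 \<phi>1 d) = d" if "d \<in> D" for d
    using inv that by (cases d) force
  let ?\<phi> = "restrict (map_prod \<phi>2 \<phi>1) D" and ?\<psi> = "restrict (map_prod \<psi>2 \<psi>1) Q"
  have "?\<phi> \<in> product_fusion S2 F2 S1 F1 D Q"
    by (rule restrict_map_prod_in_product_fusion[OF D \<phi>]) (simp add: Q)
  moreover have "?\<psi> \<in> product_fusion S2 F2 S1 F1 Q D"
  proof (rule restrict_map_prod_in_product_fusion[OF Qsub \<psi>])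
    show "map_prod \<psi>2 \<psi>1 ` Q \<subseteq> D" unfolding Q image_image using inv' by (intro image_subsetI) simp
  qed
  moreover have "?\<psi> (?\<phi> u) = u" if "u \<in> D" for u
  proof -
    have "map_prod \<phi>2 \<phi>1 u \<in> Q" unfolding Q using that by (rule imageI)
    then show ?thesis using that inv'[OF that] by (simp del: map_prod_simp)
  qed
  moreover have "?\<phi> (?\<psi> v) = v" if v: "v \<in> Q" for v
  proof -
    obtain d where d: "v = map_prod \<phi>2 \<phi>1 d" "d \<in> D" using v unfolding Q by (rule imageE)
    have "?\<psi> v = map_prod \<psi>2 \<psi>1 v" using v by simp
    also have "\<dots> = d" unfolding d(1) by (rule inv'[OF d(2)])
    finally show ?thesis using d by simp
  qed
  ultimately show "Q \<in> fusion_class (S2 \<times>\<times> S1) (product_fusion S2 F2 S1 F1) D"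
    unfolding fusion_class_def mem_Collect_eq using Qsub
    by (intro conjI bexI[of _ ?\<phi>] bexI[of _ ?\<psi>] ballI)
qed

text \<open>
  Composition with \<open>\<chi>2 \<times> \<chi>1\<close> carries the pairs that map \<open>D\<close> onto itself bijectively to those that
  map it onto the image of \<open>D\<close> under \<open>\<chi>2 \<times> \<chi>1\<close>. Hence an average over pairs of morphisms is an
  average over the class.
\<close>
lemma card_fibre:
  assumes D: "subgroup D (S2 \<times>\<times> S1)" and \<chi>: "\<chi>1 \<in> E1 D" "\<chi>2 \<in> E2 D"
  shows "card {(\<phi>1, \<phi>2) \<in> E1 D \<times> E2 D. map_prod \<phi>2 \<phi>1 ` D = map_prod \<chi>2 \<chi>1 ` D} =
    card {(\<phi>1, \<phi>2) \<in> E1 D \<times> E2 D. map_prod \<phi>2 \<phi>1 ` D = D}" (is "card ?A = card ?B")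
proof -
  let ?Q = "map_prod \<chi>2 \<chi>1 ` D"
  note P = projection_subgroups[OF D]
  have Q: "subgroup ?Q (S2 \<times>\<times> S1)" by (rule map_prod_subgroup[OF D \<chi>])
  note PQ = projection_subgroups[OF Q]
  obtain \<psi>1 \<psi>2 where \<psi>: "\<psi>1 \<in> E1 ?Q" "\<psi>2 \<in> E2 ?Q"
    and inv: "\<And>u. u \<in> snd ` D \<Longrightarrow> \<psi>1 (\<chi>1 u) = u" "\<And>u. u \<in> fst ` D \<Longrightarrow> \<psi>2 (\<chi>2 u) = u"
    using map_prod_inverse[OF D \<chi>] by metis
  let ?f = "\<lambda>(\<phi>1, \<phi>2). (compose (snd ` D) \<psi>1 \<phi>1, compose (fst ` D) \<psi>2 \<phi>2)"
  let ?g = "\<lambda>(\<phi>1, \<phi>2). (compose (snd ` D) \<chi>1 \<phi>1, compose (fst ` D) \<chi>2 \<phi>2)"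
  have inv': "\<chi>1 (\<psi>1 v) = v" if "v \<in> snd ` ?Q" for v using that inv(1) by force
  have inv'': "\<chi>2 (\<psi>2 v) = v" if "v \<in> fst ` ?Q" for v using that inv(2) by force
  have proj: "\<phi>1 ` snd ` D = snd ` map_prod \<phi>2 \<phi>1 ` D" "\<phi>2 ` fst ` D = fst ` map_prod \<phi>2 \<phi>1 ` D"
    for \<phi>1 :: "'a \<Rightarrow> 'a" and \<phi>2 :: "'b \<Rightarrow> 'b" by (simp_all add: image_image)
  have comp: "map_prod (compose (fst ` D) \<beta>2 \<alpha>2) (compose (snd ` D) \<beta>1 \<alpha>1) ` D = map_prod \<beta>2 \<beta>1 ` map_prod \<alpha>2 \<alpha>1 ` D"
    for \<alpha>1 \<beta>1 :: "'a \<Rightarrow> 'a" and \<alpha>2 \<beta>2 :: "'b \<Rightarrow> 'b"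
    unfolding image_image by (intro image_cong refl) (force simp: compose_def)
  have DQ: "map_prod \<psi>2 \<psi>1 ` ?Q = D"
  proof -
    have "map_prod \<psi>2 \<psi>1 (map_prod \<chi>2 \<chi>1 d) = d" if "d \<in> D" for d using inv that by (cases d) force
    then show ?thesis by (simp add: image_image del: map_prod_simp cong: image_cong)
  qed
  have "bij_betw ?f ?A ?B"
  proof (rule bij_betw_byWitness[where f' = ?g])
    have ext: "compose (snd ` D) \<alpha> (compose (snd ` D) \<beta> \<phi>1) = \<phi>1"
      if "\<phi>1 \<in> E1 D" "\<And>u. u \<in> snd ` D \<Longrightarrow> \<alpha> (\<beta> (\<phi>1 u)) = \<phi>1 u" for \<alpha> \<beta> \<phi>1
      using F1.F_mon(3)[OF P(1) that(1)] that(2)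
      by (intro extensionalityI[where A = "snd ` D"]) (auto simp: compose_def)
    have ext': "compose (fst ` D) \<alpha> (compose (fst ` D) \<beta> \<phi>2) = \<phi>2"
      if "\<phi>2 \<in> E2 D" "\<And>u. u \<in> fst ` D \<Longrightarrow> \<alpha> (\<beta> (\<phi>2 u)) = \<phi>2 u" for \<alpha> \<beta> \<phi>2
      using F2.F_mon(3)[OF P(2) that(1)] that(2)
      by (intro extensionalityI[where A = "fst ` D"]) (auto simp: compose_def)
    show "\<forall>a\<in>?A. ?g (?f a) = a"
    proof
      fix a assume a: "a \<in> ?A"
      obtain \<phi>1 \<phi>2 where \<phi>: "a = (\<phi>1, \<phi>2)" by fastforce
      then have m: "\<phi>1 \<in> E1 D" "\<phi>2 \<in> E2 D" "map_prod \<phi>2 \<phi>1 ` D = ?Q" using a by auto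
      have "\<phi>1 u \<in> snd ` ?Q" if "u \<in> snd ` D" for u using proj(1)[of \<phi>1 \<phi>2] m(3) that by auto
      moreover have "\<phi>2 u \<in> fst ` ?Q" if "u \<in> fst ` D" for u using proj(2)[of \<phi>2 \<phi>1] m(3) that by auto
      ultimately show "?g (?f a) = a"
        unfolding \<phi> using ext[OF m(1), of \<chi>1 \<psi>1] ext'[OF m(2), of \<chi>2 \<psi>2] inv' inv'' by simp
    qed
    show "\<forall>b\<in>?B. ?f (?g b) = b"
    proof
      fix b assume b: "b \<in> ?B"
      obtain \<phi>1 \<phi>2 where \<phi>: "b = (\<phi>1, \<phi>2)" by fastforce
      then have m: "\<phi>1 \<in> E1 D" "\<phi>2 \<in> E2 D" "map_prod \<phi>2 \<phi>1 ` D = D" using b by auto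
      have "\<phi>1 u \<in> snd ` D" if "u \<in> snd ` D" for u using proj(1)[of \<phi>1 \<phi>2] m(3) that by auto
      moreover have "\<phi>2 u \<in> fst ` D" if "u \<in> fst ` D" for u using proj(2)[of \<phi>2 \<phi>1] m(3) that by auto
      ultimately show "?f (?g b) = b"
        unfolding \<phi> using ext[OF m(1), of \<psi>1 \<chi>1] ext'[OF m(2), of \<psi>2 \<chi>2] inv by simp
    qed
    show "?f ` ?A \<subseteq> ?B"
    proof
      fix b assume "b \<in> ?f ` ?A"
      then obtain \<phi>1 \<phi>2 where b: "b = ?f (\<phi>1, \<phi>2)"
        and m: "\<phi>1 \<in> E1 D" "\<phi>2 \<in> E2 D" "map_prod \<phi>2 \<phi>1 ` D = ?Q" by auto
      have "compose (snd ` D) \<psi>1 \<phi>1 \<in> E1 D"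
        by (rule F1.F_compose[OF P(1) PQ(1) m(1) _ \<psi>(1)]) (simp add: proj(1)[of \<phi>1 \<phi>2] m(3))
      moreover have "compose (fst ` D) \<psi>2 \<phi>2 \<in> E2 D"
        by (rule F2.F_compose[OF P(2) PQ(2) m(2) _ \<psi>(2)]) (simp add: proj(2)[of \<phi>2 \<phi>1] m(3))
      ultimately show "b \<in> ?B" unfolding b using comp[of \<psi>2 \<phi>2 \<psi>1 \<phi>1] m(3) DQ by simp
    qed
    show "?g ` ?B \<subseteq> ?A"
    proof
      fix a assume "a \<in> ?g ` ?B"
      then obtain \<phi>1 \<phi>2 where a: "a = ?g (\<phi>1, \<phi>2)"
        and m: "\<phi>1 \<in> E1 D" "\<phi>2 \<in> E2 D" "map_prod \<phi>2 \<phi>1 ` D = D" by auto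
      have "compose (snd ` D) \<chi>1 \<phi>1 \<in> E1 D"
        by (rule F1.F_compose[OF P(1) P(1) m(1) _ \<chi>(1)]) (simp add: proj(1)[of \<phi>1 \<phi>2] m(3))
      moreover have "compose (fst ` D) \<chi>2 \<phi>2 \<in> E2 D"
        by (rule F2.F_compose[OF P(2) P(2) m(2) _ \<chi>(2)]) (simp add: proj(2)[of \<phi>2 \<phi>1] m(3))
      ultimately show "a \<in> ?A" unfolding a using comp[of \<chi>2 \<phi>2 \<chi>1 \<phi>1] m(3) by simp
    qed
  qed
  then show ?thesis by (rule bij_betw_same_card)
qed

lemma average_over_product_fusion_class:
  fixes m :: "('b \<times> 'a) set \<Rightarrow> rat"
  assumes D: "subgroup D (S2 \<times>\<times> S1)"
  shows "(\<Sum>\<phi>1\<in>E1 D. \<Sum>\<phi>2\<in>E2 D. m (map_prod \<phi>2 \<phi>1 ` D)) / (of_nat (card (E1 D)) * of_nat (card (E2 D))) =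
    1 / of_nat (card (fusion_class (S2 \<times>\<times> S1) (product_fusion S2 F2 S1 F1) D)) *
      (\<Sum>D'\<in>fusion_class (S2 \<times>\<times> S1) (product_fusion S2 F2 S1 F1) D. m D')"
proof -
  note P = projection_subgroups[OF D]
  let ?E = "E1 D \<times> E2 D" let ?h = "\<lambda>(\<phi>1, \<phi>2). map_prod \<phi>2 \<phi>1 ` D"
  let ?C = "fusion_class (S2 \<times>\<times> S1) (product_fusion S2 F2 S1 F1) D"
  let ?n = "card {e \<in> ?E. ?h e = D}"
  have C: "?C = ?h ` ?E" by (rule fusion_class_product[OF D])
  have fin: "finite ?E" using F1.F_finite[OF P(1)] F2.F_finite[OF P(2)] by simp
  have fibre: "card {e \<in> ?E. ?h e = Q} = ?n" if Q: "Q \<in> ?C" for Q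
  proof -
    obtain e where e: "Q = ?h e" "e \<in> ?E" using Q unfolding C by (rule imageE)
    obtain \<chi>1 \<chi>2 where "e = (\<chi>1, \<chi>2)" by fastforce
    then have "\<chi>1 \<in> E1 D" "\<chi>2 \<in> E2 D" "Q = map_prod \<chi>2 \<chi>1 ` D" using e by auto
    moreover have "{e \<in> ?E. ?h e = Q} = {(\<phi>1, \<phi>2) \<in> ?E. map_prod \<phi>2 \<phi>1 ` D = Q}" for Q by auto
    ultimately show ?thesis using card_fibre[OF D, of \<chi>1 \<chi>2] by simp
  qed
  have sum: "(\<Sum>e\<in>?E. g (?h e)) = of_nat ?n * (\<Sum>Q\<in>?C. g Q)" for g :: "_ \<Rightarrow> rat"
  proof -
    have "(\<Sum>e\<in>?E. g (?h e)) = (\<Sum>Q\<in>?h ` ?E. \<Sum>e\<in>{e \<in> ?E. ?h e = Q}. g (?h e))"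
      by (rule sum.image_gen[OF fin])
    also have "\<dots> = (\<Sum>Q\<in>?C. of_nat ?n * g Q)"
    proof (unfold C[symmetric], intro sum.cong refl)
      fix Q assume Q: "Q \<in> ?C"
      have "(\<Sum>e\<in>{e \<in> ?E. ?h e = Q}. g (?h e)) = (\<Sum>e\<in>{e \<in> ?E. ?h e = Q}. g Q)"
        by (intro sum.cong refl) auto
      then show "(\<Sum>e\<in>{e \<in> ?E. ?h e = Q}. g (?h e)) = of_nat ?n * g Q" using fibre[OF Q] by simp
    qed
    finally show ?thesis by (simp add: sum_distrib_left)
  qed
  have "(of_nat (card (E1 D)) * of_nat (card (E2 D)) :: rat) = of_nat ?n * of_nat (card ?C)"
    using sum[of "\<lambda>_. 1"] by (simp add: card_cartesian_product)
  moreover have "(of_nat (card (E1 D)) * of_nat (card (E2 D)) :: rat) \<noteq> 0"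
    using F1.F_card_pos[OF P(1)] F2.F_card_pos[OF P(2)] by simp
  moreover have "(\<Sum>\<phi>1\<in>E1 D. \<Sum>\<phi>2\<in>E2 D. m (map_prod \<phi>2 \<phi>1 ` D)) = of_nat ?n * (\<Sum>Q\<in>?C. m Q)"
    using sum[of m] by (simp add: sum.cartesian_product split_def)
  ultimately show ?thesis by simp
qed

end

theorem theorem3:
  fixes p :: nat
    and S\<^sub>1 :: "('a, 'm) monoid_scheme" and S\<^sub>2 :: "('b, 'n) monoid_scheme"
    and F\<^sub>1 :: "'a set \<Rightarrow> 'a set \<Rightarrow> ('a \<Rightarrow> 'a) set"
    and F\<^sub>2 :: "'b set \<Rightarrow> 'b set \<Rightarrow> ('b \<Rightarrow> 'b) set"
    and \<omega>\<^sub>1 :: "('a \<times> 'a) formal set" and \<omega>\<^sub>2 :: "('b \<times> 'b) formal set"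
    and X :: "('b \<times> 'a) formal set"
  assumes "saturated_fusion_system p S\<^sub>1 F\<^sub>1"
    and "saturated_fusion_system p S\<^sub>2 F\<^sub>2"
    and "characteristic_idempotent p S\<^sub>1 F\<^sub>1 \<omega>\<^sub>1"
    and "characteristic_idempotent p S\<^sub>2 F\<^sub>2 \<omega>\<^sub>2"
    and "X \<in> burnside p S\<^sub>1 S\<^sub>2"
  shows
    "let Y = burnside_comp p S\<^sub>1 S\<^sub>1 S\<^sub>2 (burnside_comp p S\<^sub>1 S\<^sub>2 S\<^sub>2 \<omega>\<^sub>2 X) \<omega>\<^sub>1 in
       right_stable p S\<^sub>1 S\<^sub>2 F\<^sub>1 Y \<and>
       left_stable p S\<^sub>1 S\<^sub>2 F\<^sub>2 Y \<and>
       (\<forall>D. subgroup D (S\<^sub>2 \<times>\<times> S\<^sub>1) \<longrightarrow>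
          mark D Y =
            1 / of_nat (card (fusion_class (S\<^sub>2 \<times>\<times> S\<^sub>1) (product_fusion S\<^sub>2 F\<^sub>2 S\<^sub>1 F\<^sub>1) D)) *
            (\<Sum>D'\<in>fusion_class (S\<^sub>2 \<times>\<times> S\<^sub>1) (product_fusion S\<^sub>2 F\<^sub>2 S\<^sub>1 F\<^sub>1) D. mark D' X))"
proof -
  interpret F1: saturated_fusion_system p S\<^sub>1 F\<^sub>1 by fact
  interpret F2: saturated_fusion_system p S\<^sub>2 F\<^sub>2 by fact
  note fusion = F1.fusion_system_axioms F2.fusion_system_axioms
  note S1 = F1.finite_group_S and S2 = F2.finite_group_S and p = F1.prime_p
  let ?K = "S\<^sub>2 \<times>\<times> S\<^sub>1"
  have fin: "finite (carrier ?K)" using finite_group_DirProd[OF S2 S1] by (simp only: finite_group_def)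
  obtain f1 where f1: "f1 \<in> formal_sums p (S\<^sub>1 \<times>\<times> S\<^sub>1)" "\<omega>\<^sub>1 = burnside_rel p S\<^sub>1 S\<^sub>1 `` {f1}"
      "F1.idempotent_coords (coords (S\<^sub>1 \<times>\<times> S\<^sub>1) f1)"
    by (rule F1.characteristic_idempotent_coords[OF assms(3)])
  obtain f2 where f2: "f2 \<in> formal_sums p (S\<^sub>2 \<times>\<times> S\<^sub>2)" "\<omega>\<^sub>2 = burnside_rel p S\<^sub>2 S\<^sub>2 `` {f2}"
      "F2.idempotent_coords (coords (S\<^sub>2 \<times>\<times> S\<^sub>2) f2)"
    by (rule F2.characteristic_idempotent_coords[OF assms(4)])
  obtain x where x: "x \<in> formal_sums p ?K" "X = burnside_rel p S\<^sub>1 S\<^sub>2 `` {x}"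
    by (rule burnside_classE[OF assms(5)])
  define g where "g = formal_comp S\<^sub>1 S\<^sub>2 S\<^sub>2 f2 x"
  have g: "g \<in> formal_sums p ?K" unfolding g_def by (rule formal_comp_closed[OF p S1 S2 S2 f2(1) x(1)])
  define y where "y = formal_comp S\<^sub>1 S\<^sub>1 S\<^sub>2 g f1"
  have y: "y \<in> formal_sums p ?K" unfolding y_def by (rule formal_comp_closed[OF p S1 S1 S2 g f1(1)])
  have Y: "burnside_comp p S\<^sub>1 S\<^sub>1 S\<^sub>2 (burnside_comp p S\<^sub>1 S\<^sub>2 S\<^sub>2 \<omega>\<^sub>2 X) \<omega>\<^sub>1 = burnside_rel p S\<^sub>1 S\<^sub>2 `` {y}"
    unfolding f1(2) f2(2) x(2) burnside_comp_class[OF p S1 S2 S2 f2(1) x(1)] g_def[symmetric]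
      burnside_comp_class[OF p S1 S1 S2 g f1(1)] y_def[symmetric] ..
  let ?mx = "marks_of ?K (coords ?K x)" and ?mg = "marks_of ?K (coords ?K g)" and ?my = "marks_of ?K (coords ?K y)"
  \<comment> \<open>multiplication by \<open>\<omega>\<^sub>1\<close> from the right averages over morphisms of the first system\<close>
  have my: "?my D = F1.fusion_average ?mg D" if D: "subgroup D ?K" for D
    unfolding y_def marks_formal_comp[OF p S1 S1 S2 g f1(1) subgroup.subset[OF D]]
    by (rule F1.comp_marks_idempotent[OF f1(3) S2 D])
  \<comment> \<open>multiplication by \<open>\<omega>\<^sub>2\<close> from the left does so for the second, after passing to converses\<close>
  have mg: "?mg D = F2.fusion_average (\<lambda>E. ?mx (E\<inverse>)) (D\<inverse>)" if D: "subgroup D ?K" for D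
  proof -
    have "?mg D = F2.fusion_average (marks_of (S\<^sub>1 \<times>\<times> S\<^sub>2) (coords ?K x \<circ> converse)) (D\<inverse>)"
      unfolding g_def marks_formal_comp[OF p S1 S2 S2 f2(1) x(1) subgroup.subset[OF D]]
        comp_marks_converse[OF S1 S2 S2]
      by (rule F2.comp_marks_idempotent[OF F2.idempotent_coords_converse[OF f2(3)] S1
            subgroup_converse[OF F2.is_group F1.is_group D]])
    moreover have "marks_of (S\<^sub>1 \<times>\<times> S\<^sub>2) (coords ?K x \<circ> converse) = (\<lambda>E. ?mx (E\<inverse>))"
      by (rule ext) (simp add: marks_of_converse[OF S2 S1, of "coords ?K x"])
    ultimately show ?thesis by simp
  qed
  have my_double: "?my D = (\<Sum>\<phi>1\<in>F\<^sub>1 (snd ` D) (carrier S\<^sub>1). \<Sum>\<phi>2\<in>F\<^sub>2 (fst ` D) (carrier S\<^sub>2).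
      ?mx (map_prod \<phi>2 \<phi>1 ` D)) /
      (of_nat (card (F\<^sub>1 (snd ` D) (carrier S\<^sub>1))) * of_nat (card (F\<^sub>2 (fst ` D) (carrier S\<^sub>2))))"
    if D: "subgroup D ?K" for D
  proof -
    note P = projection_subgroups[OF fusion D]
    have "?mg (map_prod id \<phi>1 ` D) = (\<Sum>\<phi>2\<in>F\<^sub>2 (fst ` D) (carrier S\<^sub>2). ?mx (map_prod \<phi>2 \<phi>1 ` D)) /
        of_nat (card (F\<^sub>2 (fst ` D) (carrier S\<^sub>2)))" if \<phi>1: "\<phi>1 \<in> F\<^sub>1 (snd ` D) (carrier S\<^sub>1)" for \<phi>1
    proof -
      note sub = map_prod_id_subgroup[OF fusion D P(1) \<phi>1 order.refl]
      have "snd ` (map_prod id \<phi>1 ` D)\<inverse> = fst ` D" by force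
      moreover have "(map_prod id \<phi>2 ` (map_prod id \<phi>1 ` D)\<inverse>)\<inverse> = map_prod \<phi>2 \<phi>1 ` D" for \<phi>2 :: "'b \<Rightarrow> 'b"
        by force
      ultimately show ?thesis unfolding mg[OF sub] F2.fusion_average_def by simp
    qed
    then show ?thesis
      unfolding my[OF D] F1.fusion_average_def by (simp add: sum_divide_distrib mult.commute)
  qed
  have "right_stable p S\<^sub>1 S\<^sub>2 F\<^sub>1 (burnside_rel p S\<^sub>1 S\<^sub>2 `` {y})"
    unfolding F1.right_stable_iff[OF S2 y] stable_marks_def
  proof (intro allI impI)
    fix P \<phi> D assume P: "subgroup P S\<^sub>1" "\<phi> \<in> F\<^sub>1 P (carrier S\<^sub>1)" and D: "subgroup D ?K" "snd ` D \<subseteq> P"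
    note D1 = subgroup_snd_image[OF F2.is_group F1.is_group D(1)]
    show "?my (map_prod id \<phi> ` D) = ?my D"
      using my[OF map_prod_id_subgroup[OF fusion D(1) P D(2)]] my[OF D(1)] F1.fusion_average_invariant[OF D1 P D(2)] by simp
  qed
  moreover have "left_stable p S\<^sub>1 S\<^sub>2 F\<^sub>2 (burnside_rel p S\<^sub>1 S\<^sub>2 `` {y})"
    unfolding F2.left_stable_iff[OF S1 y] stable_marks_def
  proof (intro allI impI)
    fix P \<phi> D
    assume P: "subgroup P S\<^sub>2" "\<phi> \<in> F\<^sub>2 P (carrier S\<^sub>2)" and D: "subgroup D (S\<^sub>1 \<times>\<times> S\<^sub>2)" "snd ` D \<subseteq> P"
    note D2 = subgroup_snd_image[OF F1.is_group F2.is_group D(1)]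
    \<comment> \<open>the double average with the second system outermost: invariance of this outer average holds
      whatever is averaged, so the inner one may be hidden in \<open>?h\<close>\<close>
    let ?h = "\<lambda>E. (\<Sum>\<phi>1\<in>F\<^sub>1 (fst ` E) (carrier S\<^sub>1). ?mx ((map_prod \<phi>1 id ` E)\<inverse>)) /
      of_nat (card (F\<^sub>1 (fst ` E) (carrier S\<^sub>1)))"
    have avg: "marks_of (S\<^sub>1 \<times>\<times> S\<^sub>2) (coords ?K y \<circ> converse) E = F2.fusion_average ?h E"
      if E: "subgroup E (S\<^sub>1 \<times>\<times> S\<^sub>2)" for E
    proof -
      have im: "fst ` map_prod id \<phi>2 ` E = fst ` E"
        "(map_prod \<phi>1 id ` map_prod id \<phi>2 ` E)\<inverse> = map_prod \<phi>2 \<phi>1 ` (E\<inverse>)"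
        for \<phi>1 :: "'a \<Rightarrow> 'a" and \<phi>2 :: "'b \<Rightarrow> 'b" by force+
      have pr: "snd ` (E\<inverse>) = fst ` E" "fst ` (E\<inverse>) = snd ` E" by force+
      have "marks_of (S\<^sub>1 \<times>\<times> S\<^sub>2) (coords ?K y \<circ> converse) E = ?my (E\<inverse>)"
        using marks_of_converse[OF S2 S1, of "coords ?K y" "E\<inverse>"] by simp
      also have "\<dots> = F2.fusion_average ?h E"
        unfolding my_double[OF subgroup_converse[OF F1.is_group F2.is_group E]] F2.fusion_average_def
          im pr sum_divide_distrib[symmetric]
        by (subst sum.swap) simp
      finally show ?thesis .
    qed
    show "marks_of (S\<^sub>1 \<times>\<times> S\<^sub>2) (coords ?K y \<circ> converse) (map_prod id \<phi> ` D) =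
        marks_of (S\<^sub>1 \<times>\<times> S\<^sub>2) (coords ?K y \<circ> converse) D"
      using avg[OF map_prod_id_subgroup[OF fusion(2,1) D(1) P D(2)]] avg[OF D(1)]
        F2.fusion_average_invariant[OF D2 P D(2), of ?h] by simp
  qed
  moreover have "mark D (burnside_rel p S\<^sub>1 S\<^sub>2 `` {y}) =
      1 / of_nat (card (fusion_class ?K (product_fusion S\<^sub>2 F\<^sub>2 S\<^sub>1 F\<^sub>1) D)) *
      (\<Sum>D'\<in>fusion_class ?K (product_fusion S\<^sub>2 F\<^sub>2 S\<^sub>1 F\<^sub>1) D. mark D' X)" if D: "subgroup D ?K" for D
  proof -
    have "mark D' X = ?mx D'" if "D' \<in> fusion_class ?K (product_fusion S\<^sub>2 F\<^sub>2 S\<^sub>1 F\<^sub>1) D" for D'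
      using that mark_class[OF p fin x(1)] unfolding x(2) fusion_class_def by blast
    then show ?thesis
      unfolding mark_class[OF p fin y D] my_double[OF D]
        average_over_product_fusion_class[OF fusion D] by simp
  qed
  ultimately show ?thesis unfolding Let_def Y by blast
qed

end
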